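(* Let $\mathbb{T}^n$ be a standard flat $n$-torus and $\gamma \colon S^1 \to \mathbb{T}^n$ a closed geodesic with $\mathrm{minind}(\gamma)=k$. Using the negative of a gradient-like vector of the uniform energy $E^{k} \colon (\mathbb{T}^n)^{k} \to \mathbb{R}$ to restart the negative gradient flow of the Morse energy (by the restarting procedure described in the context) yields a closed geodesic $\sigma \colon S^1 \to \mathbb{T}^n$ with $\mathrm{minind}(\sigma) \leq k$.
   Context: $S^1=\mathbb{R}/2\pi\mathbb{Z}$, $d$ is the Riemannian distance and $l(\gamma)$ is the length of $\gamma$. A standard flat $n$-torus is a Riemannian product of $n$ circles. Minimizing index: for an integer $k\geq 2$, a closed geodesic $\gamma \colon S^1 \to M$ in a Riemannian manifold $M$ is a $1/k$-geodesic if $d(\gamma(t),\gamma(t+2\pi/k))=l(\gamma)/k$ for all $t\in S^1$; $\mathrm{minind}(\gamma)$ is the smallest integer $k\geq 2$ such that $\gamma$ is a $1/k$-geodesic. Uniform energy: for $\bar{x}=(x_1,\dots,x_k)\in M^k$, $E^k(\bar{x})=\sum_{i=1}^k \frac{d(x_i,x_{i+1})^2}{1/k}$ with $x_{k+1}=x_1$. Gradient-like vectors: given $\bar{x}\in M^k$, put $l_i=d(x_i,x_{i+1})$ (indices mod $k$). For each choice of unit-speed minimizing geodesics $\eta_i\colon[0,l_i]\to M$ with $\eta_i(0)=x_i$, $\eta_i(l_i)=x_{i+1}$ ($i=1,\dots,k$), the vector in $T_{\bar{x}}M^k$ whose $i$-th component is $-\bigl(-l_{i-1}\dot{\eta}_{i-1}(l_{i-1})+l_i\dot{\eta}_i(0)\bigr)$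 is called a candidate gradient of $E^k$ at $\bar{x}$. A gradient-like vector at $\bar{x}$ is a candidate gradient of maximal magnitude, the magnitude being calculated using the Riemannian product structure on $M^k$. Morse energy and its flow: $E(c)=\int_{S^1}|\dot{c}(t)|^2\,dt$ for a piecewise smooth closed curve $c\colon S^1\to M$. Its critical points are the closed geodesics. The negative gradient flow of $E$ deforms a closed curve within its homotopy class in the direction of maximal decrease of $E$, and terminates at critical points of $E$, i.e. at closed geodesics. Restarting procedure for a closed geodesic $\gamma$ with $\mathrm{minind}(\gamma)=k$: (1) identify a pair $(x_1,x_2)$ of cut points on $\gamma$ (that is, $x_2$ is a cut point of $x_1$ along $\gamma$) which are at maximal distance for such pairs, and let $\bar{x}=(x_1,\dots,x_k)\in M^k$, where $x_3,\dots,x_k$ are chosen evenly spaced along the remainder of $\gamma$ (for a flat torus, $\bar{x}$ is a choice of evenly spaced points on $\gamma$); (2) perturb $\bar{x}$ in the direction of the negative of a gradient-like vector of $E^k$ at $\bar{x}$; (3) reconnect the perturbed pairs $(x_i,x_{i+1})$, cyclically, via minimal geodesics, obtaining a piecewise smooth closed curve; (4) run the negative gradient flow of $E$ starting from this closed curve. *)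

theory Defs
  imports "HOL-Analysis.Analysis"
begin

section \<open>Standard flat tori\<close>

text \<open>
  The standard flat torus with circumferences \<open>L $ i > 0\<close> is the Riemannian product of the circles
  \<open>\<real> / (L $ i) \<int>\<close>, that is, the quotient of Euclidean space by the lattice of vectors whose
  \<open>i\<close>-th coordinate is an integer multiple of \<open>L $ i\<close>. A point is a coset of this lattice.
  The covering map \<open>torus_proj L\<close> is a local isometry; through it all tangent spaces are identified
  with Euclidean space.
\<close>

definition torus_proj :: "real ^ 'n \<Rightarrow> real ^ 'n \<Rightarrow> (real ^ 'n) set" where
  "torus_proj L p = {q. \<forall>i. \<exists>m::int. q $ i = p $ i + of_int m * L $ i}"

text \<open>The Riemannian exponential map: \<open>torus_exp (torus_proj L p) v = torus_proj L (p + v)\<close>.\<close>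

definition torus_exp :: "(real ^ 'n) set \<Rightarrow> real ^ 'n \<Rightarrow> (real ^ 'n) set" where
  "torus_exp x v = (\<lambda>q. q + v) ` x"

section \<open>Curves\<close>

text \<open>
  Curves in the torus are handled through continuous lifts to Euclidean space. Two continuous lifts
  of a curve differ by a constant lattice vector, so \<open>velocity\<close> does not depend on the lift.
\<close>

definition is_lift :: "real ^ 'n \<Rightarrow> (real \<Rightarrow> (real ^ 'n) set) \<Rightarrow> (real \<Rightarrow> real ^ 'n) \<Rightarrow> bool" where
  "is_lift L c C \<longleftrightarrow> continuous_on UNIV C \<and> (\<forall>t. c t = torus_proj L (C t))"

definition velocity :: "real ^ 'n \<Rightarrow> (real \<Rightarrow> (real ^ 'n) set) \<Rightarrow> real \<Rightarrow> real ^ 'n" where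
  "velocity L c t = vector_derivative (SOME C. is_lift L c C) (at t)"

definition curve_length :: "real ^ 'n \<Rightarrow> (real \<Rightarrow> (real ^ 'n) set) \<Rightarrow> real \<Rightarrow> real \<Rightarrow> real" where
  "curve_length L c a b = integral {a..b} (\<lambda>t. norm (velocity L c t))"

text \<open>Derivatives at the end points of the interval are one-sided.\<close>

definition smooth_on_interval :: "real \<Rightarrow> real \<Rightarrow> (real \<Rightarrow> real ^ 'n) \<Rightarrow> bool" where
  "smooth_on_interval a b f \<longleftrightarrow>
     (\<exists>D :: nat \<Rightarrow> real \<Rightarrow> real ^ 'n. D 0 = f \<and>
        (\<forall>m. \<forall>t\<in>{a..b}. (D m has_vector_derivative D (Suc m) t) (at t within {a..b})))"

text \<open>\<open>P\<close> is the finite set of break points.\<close>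

definition piecewise_smooth :: "real \<Rightarrow> real \<Rightarrow> (real \<Rightarrow> real ^ 'n) \<Rightarrow> bool" where
  "piecewise_smooth a b f \<longleftrightarrow> continuous_on {a..b} f \<and>
     (\<exists>P. finite P \<and> (\<forall>p q. a \<le> p \<and> p < q \<and> q \<le> b \<and> {p<..<q} \<inter> P = {} \<longrightarrow>
        smooth_on_interval p q f))"

definition piecewise_smooth_curve ::
  "real ^ 'n \<Rightarrow> real \<Rightarrow> real \<Rightarrow> (real \<Rightarrow> (real ^ 'n) set) \<Rightarrow> bool" where
  "piecewise_smooth_curve L a b c \<longleftrightarrow> (\<exists>C. is_lift L c C \<and> piecewise_smooth a b C)"

text \<open>The Riemannian distance.\<close>

definition torus_dist :: "real ^ 'n \<Rightarrow> (real ^ 'n) set \<Rightarrow> (real ^ 'n) set \<Rightarrow> real" where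
  "torus_dist L x y =
     Inf {curve_length L c 0 1 |c. piecewise_smooth_curve L 0 1 c \<and> c 0 = x \<and> c 1 = y}"

section \<open>Geodesics and the minimizing index\<close>

text \<open>
  The metric is flat, so the geodesic equation says that the second derivative of a lift vanishes.
  Geodesics are taken to be defined on the whole line (the torus is complete). Constant curves are
  included, since closed geodesics are to be the critical points of the energy.
\<close>

definition geodesic :: "real ^ 'n \<Rightarrow> (real \<Rightarrow> (real ^ 'n) set) \<Rightarrow> bool" where
  "geodesic L g \<longleftrightarrow> (\<exists>C V. is_lift L g C \<and>
     (\<forall>t. (C has_vector_derivative V t) (at t)) \<and> (\<forall>t. (V has_vector_derivative 0) (at t)))"

text \<open>A map on the circle \<open>\<real> / 2\<pi>\<int>\<close> is a function on \<open>\<real>\<close> with period \<open>2\<pi>\<close>.\<close>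

definition on_circle :: "(real \<Rightarrow> 'a) \<Rightarrow> bool" where
  "on_circle c \<longleftrightarrow> (\<forall>t. c (t + 2 * pi) = c t)"

definition closed_geodesic :: "real ^ 'n \<Rightarrow> (real \<Rightarrow> (real ^ 'n) set) \<Rightarrow> bool" where
  "closed_geodesic L g \<longleftrightarrow> on_circle g \<and> geodesic L g"

definition one_over_geodesic :: "real ^ 'n \<Rightarrow> nat \<Rightarrow> (real \<Rightarrow> (real ^ 'n) set) \<Rightarrow> bool" where
  "one_over_geodesic L k g \<longleftrightarrow>
     (\<forall>t. torus_dist L (g t) (g (t + 2 * pi / real k)) = curve_length L g 0 (2 * pi) / real k)"

definition minind :: "real ^ 'n \<Rightarrow> (real \<Rightarrow> (real ^ 'n) set) \<Rightarrow> nat" where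
  "minind L g = (LEAST k. 2 \<le> k \<and> one_over_geodesic L k g)"

text \<open>The point \<open>g b\<close> is the cut point of \<open>g a\<close> along \<open>g\<close>: minimization stops at time \<open>b\<close>.\<close>

definition cut_along :: "real ^ 'n \<Rightarrow> (real \<Rightarrow> (real ^ 'n) set) \<Rightarrow> real \<Rightarrow> real \<Rightarrow> bool" where
  "cut_along L g a b \<longleftrightarrow> a < b \<and>
     (\<forall>r\<in>{a..b}. torus_dist L (g a) (g r) = curve_length L g a r) \<and>
     (\<forall>r>b. torus_dist L (g a) (g r) < curve_length L g a r)"

text \<open>
  Unit-speed minimizing geodesics from \<open>x\<close> to \<open>y\<close>, to be considered on \<open>{0..torus_dist L x y}\<close>:
  there the length equals the distance of the end points. For \<open>x = y\<close> this is a degenerate interval.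
\<close>

definition min_geodesic ::
  "real ^ 'n \<Rightarrow> (real ^ 'n) set \<Rightarrow> (real ^ 'n) set \<Rightarrow> (real \<Rightarrow> (real ^ 'n) set) \<Rightarrow> bool" where
  "min_geodesic L x y h \<longleftrightarrow> geodesic L h \<and> (\<forall>t. norm (velocity L h t) = 1) \<and>
     h 0 = x \<and> h (torus_dist L x y) = y"

section \<open>Uniform energy and gradient-like vectors\<close>

text \<open>
  A point of the \<open>k\<close>-fold product is a function on \<open>{..<k}\<close> (values outside are ignored), so indices
  run over \<open>0, \<dots>, k - 1\<close> and are cyclic modulo \<open>k\<close>. Where the uniform energy is differentiable, its
  gradient is \<open>2 * k\<close> times the unique candidate gradient.
\<close>

definition uniform_energy :: "real ^ 'n \<Rightarrow> nat \<Rightarrow> (nat \<Rightarrow> (real ^ 'n) set) \<Rightarrow> real" where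
  "uniform_energy L k x =
     (\<Sum>i<k. (torus_dist L (x i) (x (Suc i mod k)))\<^sup>2 / (1 / real k))"

definition candidate_gradient ::
  "real ^ 'n \<Rightarrow> nat \<Rightarrow> (nat \<Rightarrow> (real ^ 'n) set) \<Rightarrow> (nat \<Rightarrow> real ^ 'n) \<Rightarrow> bool" where
  "candidate_gradient L k x v \<longleftrightarrow>
     (\<exists>\<eta>. (\<forall>i<k. min_geodesic L (x i) (x (Suc i mod k)) (\<eta> i)) \<and>
          (\<forall>i<k. v i =
             (let l = (\<lambda>j. torus_dist L (x j) (x (Suc j mod k))); p = (i + k - 1) mod k
              in - (- (l p *\<^sub>R velocity L (\<eta> p) (l p)) + l i *\<^sub>R velocity L (\<eta> i) 0))))"

definition magnitude :: "nat \<Rightarrow> (nat \<Rightarrow> real ^ 'n) \<Rightarrow> real" where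
  "magnitude k v = sqrt (\<Sum>i<k. (norm (v i))\<^sup>2)"

definition gradient_like ::
  "real ^ 'n \<Rightarrow> nat \<Rightarrow> (nat \<Rightarrow> (real ^ 'n) set) \<Rightarrow> (nat \<Rightarrow> real ^ 'n) \<Rightarrow> bool" where
  "gradient_like L k x v \<longleftrightarrow> candidate_gradient L k x v \<and>
     (\<forall>w. candidate_gradient L k x w \<longrightarrow> magnitude k w \<le> magnitude k v)"

section \<open>The Morse energy and its negative gradient flow\<close>

definition morse_energy :: "real ^ 'n \<Rightarrow> (real \<Rightarrow> (real ^ 'n) set) \<Rightarrow> real" where
  "morse_energy L c = integral {0..2 * pi} (\<lambda>t. (norm (velocity L c t))\<^sup>2)"

definition loop :: "real ^ 'n \<Rightarrow> (real \<Rightarrow> (real ^ 'n) set) \<Rightarrow> bool" where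
  "loop L c \<longleftrightarrow> on_circle c \<and> piecewise_smooth_curve L 0 (2 * pi) c"

text \<open>
  Piecewise smooth vector fields along a closed curve. The gradient of the energy is taken with
  respect to the usual \<open>H\<^sup>1\<close> Riemannian metric of the free loop space.
\<close>

definition loop_field :: "(real \<Rightarrow> real ^ 'n) \<Rightarrow> bool" where
  "loop_field X \<longleftrightarrow> on_circle X \<and> piecewise_smooth 0 (2 * pi) X"

definition h1_inner :: "(real \<Rightarrow> real ^ 'n) \<Rightarrow> (real \<Rightarrow> real ^ 'n) \<Rightarrow> real" where
  "h1_inner X Y = integral {0..2 * pi}
     (\<lambda>t. X t \<bullet> Y t + vector_derivative X (at t) \<bullet> vector_derivative Y (at t))"

definition h1_norm :: "(real \<Rightarrow> real ^ 'n) \<Rightarrow> real" where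
  "h1_norm X = sqrt (h1_inner X X)"

definition energy_gradient ::
  "real ^ 'n \<Rightarrow> (real \<Rightarrow> (real ^ 'n) set) \<Rightarrow> (real \<Rightarrow> real ^ 'n) \<Rightarrow> bool" where
  "energy_gradient L c \<xi> \<longleftrightarrow> loop_field \<xi> \<and>
     (\<forall>X. loop_field X \<longrightarrow>
        ((\<lambda>e. morse_energy L (\<lambda>t. torus_exp (c t) (e *\<^sub>R X t)))
           has_real_derivative h1_inner \<xi> X) (at 0))"

text \<open>
  A flow line \<open>u\<close> on \<open>[0, \<infinity>)\<close>: the derivative of a lifted family \<open>U\<close> with respect to the flow time,
  taken in the \<open>H\<^sup>1\<close> norm, is minus the gradient.
\<close>

definition neg_gradient_flow ::
  "real ^ 'n \<Rightarrow> (real \<Rightarrow> real \<Rightarrow> (real ^ 'n) set) \<Rightarrow> bool" where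
  "neg_gradient_flow L u \<longleftrightarrow>
     (\<exists>U \<Xi>. \<forall>s\<ge>0. loop L (u s) \<and> is_lift L (u s) (U s) \<and> energy_gradient L (u s) (\<Xi> s) \<and>
        ((\<lambda>r. h1_norm (\<lambda>t. (U r t - U s t) /\<^sub>R (r - s) - (- \<Xi> s t))) \<longlongrightarrow> 0) (at s within {0..}))"

definition loop_tendsto ::
  "real ^ 'n \<Rightarrow> (real \<Rightarrow> real \<Rightarrow> (real ^ 'n) set) \<Rightarrow> (real \<Rightarrow> (real ^ 'n) set) \<Rightarrow> bool" where
  "loop_tendsto L u \<sigma> \<longleftrightarrow> loop L \<sigma> \<and>
     (\<exists>U S. (\<forall>s\<ge>0. is_lift L (u s) (U s)) \<and> is_lift L \<sigma> S \<and>
        ((\<lambda>s. h1_norm (\<lambda>t. U s t - S t)) \<longlongrightarrow> 0) at_top)"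

text \<open>The negative gradient flow started at \<open>c\<close> terminates at \<open>\<sigma>\<close>.\<close>

definition flow_limit ::
  "real ^ 'n \<Rightarrow> (real \<Rightarrow> (real ^ 'n) set) \<Rightarrow> (real \<Rightarrow> (real ^ 'n) set) \<Rightarrow> bool" where
  "flow_limit L c \<sigma> \<longleftrightarrow> (\<exists>u. neg_gradient_flow L u \<and> u 0 = c \<and> loop_tendsto L u \<sigma>)"

section \<open>The restarting procedure\<close>

text \<open>
  The pair \<open>(g a, g b)\<close> is a cut pair on \<open>g\<close> at maximal distance, and the remaining points are
  evenly spaced on the rest of \<open>g\<close>, from time \<open>b\<close> to time \<open>a + 2\<pi>\<close>. A constant curve has no cut
  pairs; on it, as on every flat torus geodesic, all \<open>k\<close> points are simply evenly spaced.
\<close>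

definition restart_points ::
  "real ^ 'n \<Rightarrow> (real \<Rightarrow> (real ^ 'n) set) \<Rightarrow> nat \<Rightarrow> (nat \<Rightarrow> (real ^ 'n) set) \<Rightarrow> bool" where
  "restart_points L g k x \<longleftrightarrow>
     (\<exists>a b. (if \<exists>a' b'. cut_along L g a' b'
             then cut_along L g a b \<and>
               (\<forall>a' b'. cut_along L g a' b' \<longrightarrow>
                  torus_dist L (g a') (g b') \<le> torus_dist L (g a) (g b))
             else b = a + 2 * pi / real k) \<and>
        x 0 = g a \<and>
        (\<forall>i\<in>{1..<k}. x i = g (b + (real i - 1) * (a + 2 * pi - b) / (real k - 1))))"

text \<open>
  Cyclic reconnection by minimal geodesics; each of the \<open>k\<close> arcs is traversed at constant speed in
  time \<open>2\<pi>/k\<close>, as for the uniform energy.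
\<close>

definition reconnects ::
  "real ^ 'n \<Rightarrow> nat \<Rightarrow> (nat \<Rightarrow> (real ^ 'n) set) \<Rightarrow> (real \<Rightarrow> (real ^ 'n) set) \<Rightarrow> bool" where
  "reconnects L k y c \<longleftrightarrow> on_circle c \<and>
     (\<forall>i<k. \<exists>\<eta>. min_geodesic L (y i) (y (Suc i mod k)) \<eta> \<and>
        (\<forall>r\<in>{0..2 * pi / real k}.
           c (2 * pi * real i / real k + r) =
           \<eta> (torus_dist L (y i) (y (Suc i mod k)) * (r / (2 * pi / real k)))))"

text \<open>The closed curves from which the flow is restarted, for a perturbation of step size \<open>h\<close>.\<close>

definition restart_curve ::
  "real ^ 'n \<Rightarrow> (real \<Rightarrow> (real ^ 'n) set) \<Rightarrow> nat \<Rightarrow> real \<Rightarrow> (real \<Rightarrow> (real ^ 'n) set) \<Rightarrow> bool" where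
  "restart_curve L g k h c \<longleftrightarrow>
     (\<exists>x v. restart_points L g k x \<and> gradient_like L k x v \<and>
        reconnects L k (\<lambda>i. torus_exp (x i) (h *\<^sub>R (- v i))) c)"

end

(*
  A closed geodesic lifts to a line with velocity v, and it is a 1/k-geodesic as soon as every
  coordinate of (2 pi / k) v has absolute value at most half the corresponding circumference.
  A reconnected curve consists of k minimal segments, each of whose coordinates obeys the same bound;
  hence 1/k times its total displacement obeys it too, whatever the perturbation was.

  A flow limit has the same total displacement as the initial curve, because displacement is
  continuous in H^1 and its derivative along the flow vanishes. It is a geodesic: pairing the flow
  with the mean-zero periodic part X of the limit gives a convergent function of time whose derivative
  converges to -2 <S', X'> for the lift S of the limit, so <S', X'> = 0 and X is constant.

  For the existence of the limit, write the lift of the initial curve as a line plus a periodic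
  piecewise affine function f of mean zero. With K the inverse of 1 - d^2/dt^2 on periodic functions, the H^1
  gradient of the energy is 2 (1 - K) f, and the flow is exp (-2 s (1 - K)) f, expanded in powers of
  K. On functions of mean zero K is a contraction in the sup norm, so the flow decays.
*)
theory Submission
  imports Defs
begin

section \<open>Lifts and distance\<close>

lemma torus_proj_eq_iff:
  "torus_proj L p = torus_proj L q \<longleftrightarrow> (\<forall>i. \<exists>m::int. q $ i = p $ i + of_int m * L $ i)"
proof
  assume "torus_proj L p = torus_proj L q"
  moreover have "q \<in> torus_proj L q"
    by (auto simp: torus_proj_def intro!: exI[of _ 0])
  ultimately show "\<forall>i. \<exists>m::int. q $ i = p $ i + of_int m * L $ i"
    by (simp add: torus_proj_def set_eq_iff)
next
  assume *: "\<forall>i. \<exists>m::int. q $ i = p $ i + of_int m * L $ i"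
  have "(\<exists>m::int. r $ i = p $ i + of_int m * L $ i) \<longleftrightarrow> (\<exists>m::int. r $ i = q $ i + of_int m * L $ i)" for r i
  proof -
    obtain m :: int where m: "q $ i = p $ i + of_int m * L $ i" using * by blast
    show ?thesis
    proof
      assume "\<exists>m::int. r $ i = p $ i + of_int m * L $ i"
      then obtain m' :: int where "r $ i = p $ i + of_int m' * L $ i" by blast
      then show "\<exists>m::int. r $ i = q $ i + of_int m * L $ i"
        using m by (intro exI[of _ "m' - m"]) (simp add: algebra_simps)
    next
      assume "\<exists>m::int. r $ i = q $ i + of_int m * L $ i"
      then obtain m' :: int where "r $ i = q $ i + of_int m' * L $ i" by blast
      then show "\<exists>m::int. r $ i = p $ i + of_int m * L $ i"
        using m by (intro exI[of _ "m' + m"]) (simp add: algebra_simps)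
    qed
  qed
  then show "torus_proj L p = torus_proj L q"
    by (simp add: torus_proj_def)
qed

lemma torus_proj_add:
  assumes "torus_proj L p = torus_proj L q"
  shows "torus_proj L (p + v) = torus_proj L (q + v)"
  using assms unfolding torus_proj_eq_iff by (simp add: algebra_simps)

lemma torus_exp_proj: "torus_exp (torus_proj L p) v = torus_proj L (p + v)"
proof
  show "torus_exp (torus_proj L p) v \<subseteq> torus_proj L (p + v)"
    by (auto simp: torus_exp_def torus_proj_def algebra_simps)
  show "torus_proj L (p + v) \<subseteq> torus_exp (torus_proj L p) v"
  proof
    fix q assume "q \<in> torus_proj L (p + v)"
    then have "q - v \<in> torus_proj L p"
      by (simp add: torus_proj_def algebra_simps)
    then show "q \<in> torus_exp (torus_proj L p) v"
      unfolding torus_exp_def by (intro image_eqI[of _ _ "q - v"]) auto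
  qed
qed

lemma lifts_differ_by_constant:
  fixes L :: "real ^ 'n"
  assumes L: "\<And>i. L $ i > 0" and C: "is_lift L c C" "is_lift L c D"
  shows "\<exists>w. \<forall>t. D t = C t + w"
proof -
  have *: "D t $ i - C t $ i = D 0 $ i - C 0 $ i" for t i
  proof -
    define f where "f = (\<lambda>t. (D t $ i - C t $ i) / L $ i)"
    have int: "\<exists>m::int. f t = of_int m" for t
    proof -
      have "torus_proj L (C t) = torus_proj L (D t)"
        using C unfolding is_lift_def by metis
      then obtain m :: int where "D t $ i = C t $ i + of_int m * L $ i"
        unfolding torus_proj_eq_iff by blast
      then show ?thesis using L[of i] by (auto simp: f_def field_simps intro!: exI[of _ m])
    qed
    have "f constant_on UNIV"
    proof (rule continuous_discrete_range_constant)
      have "continuous_on UNIV C" "continuous_on UNIV D"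
        using C by (auto simp: is_lift_def)
      then show "continuous_on UNIV f"
        unfolding f_def using L[of i] by (intro continuous_intros) auto
      fix x
      show "\<exists>e>0. \<forall>y. y \<in> UNIV \<and> f y \<noteq> f x \<longrightarrow> e \<le> norm (f y - f x)"
      proof (intro exI[of _ 1] conjI allI impI)
        fix y assume ne: "y \<in> UNIV \<and> f y \<noteq> f x"
        obtain m m' :: int where mm: "f y = of_int m" "f x = of_int m'" using int by metis
        then have "m \<noteq> m'" using ne by auto
        then have "1 \<le> \<bar>m - m'\<bar>" by linarith
        then have "(1::real) \<le> \<bar>of_int m - of_int m'\<bar>" by linarith
        then show "1 \<le> norm (f y - f x)" using mm by simp
      qed auto
    qed auto
    then have "f t = f 0" by (auto simp: constant_on_def)
    then show ?thesis using L[of i] by (simp add: f_def)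
  qed
  have "D t = C t + (D 0 - C 0)" for t
    using *[of t] by (simp add: vec_eq_iff algebra_simps)
  then show ?thesis by blast
qed

lemma vector_derivative_add_const:
  "vector_derivative (\<lambda>t. f t + w) (at t) = vector_derivative f (at t)"
  by (simp add: vector_derivative_def has_vector_derivative_def has_derivative_def)

lemma velocity_lift:
  fixes L :: "real ^ 'n"
  assumes L: "\<And>i. L $ i > 0" and C: "is_lift L c C"
  shows "velocity L c t = vector_derivative C (at t)"
proof -
  have "is_lift L c (SOME C. is_lift L c C)" using C by (rule someI[of "is_lift L c"])
  then obtain w where "\<forall>t. C t = (SOME C. is_lift L c C) t + w"
    using lifts_differ_by_constant[OF L _ C] by blast
  then have "C = (\<lambda>t. (SOME C. is_lift L c C) t + w)" by auto
  then have "vector_derivative C (at t) = vector_derivative (SOME C. is_lift L c C) (at t)"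
    by (metis vector_derivative_add_const)
  then show ?thesis by (simp add: velocity_def)
qed

lemma lift_quasi_periodic:
  fixes L :: "real ^ 'n"
  assumes L: "\<And>i. L $ i > 0" and c: "on_circle c" and C: "is_lift L c C"
  shows "C (t + 2 * pi) = C t + (C (2 * pi) - C 0)"
proof -
  have cont: "continuous_on UNIV C" using C by (simp add: is_lift_def)
  have "is_lift L c (\<lambda>t. C (t + 2 * pi))"
    using C c unfolding is_lift_def on_circle_def
    by (auto intro!: continuous_intros continuous_on_compose2[OF cont])
  from lifts_differ_by_constant[OF L C this] obtain w where "\<And>t. C (t + 2 * pi) = C t + w" by blast
  from this[of t] this[of 0] show ?thesis by simp
qed

lemma smooth_on_interval_affine: "smooth_on_interval a b (\<lambda>t. p + t *\<^sub>R v)"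
  unfolding smooth_on_interval_def
proof (intro exI conjI allI ballI)
  let ?D = "\<lambda>m::nat. case m of 0 \<Rightarrow> (\<lambda>t. p + t *\<^sub>R v) | Suc 0 \<Rightarrow> (\<lambda>t. v) | _ \<Rightarrow> (\<lambda>t. 0)"
  show "?D 0 = (\<lambda>t. p + t *\<^sub>R v)" by simp
  fix m t
  show "(?D m has_vector_derivative ?D (Suc m) t) (at t within {a..b})"
    by (cases m rule: nat.exhaust; cases "m - 1")
      (auto intro!: derivative_eq_intros simp: has_vector_derivative_def)
qed

lemma piecewise_smooth_affine: "piecewise_smooth a b (\<lambda>t. p + t *\<^sub>R v)"
  unfolding piecewise_smooth_def
  by (auto intro!: continuous_intros exI[of _ "{}"] smooth_on_interval_affine)

lemma is_lift_affine: "is_lift L (\<lambda>t. torus_proj L (p + t *\<^sub>R v)) (\<lambda>t. p + t *\<^sub>R v)"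
  by (auto simp: is_lift_def intro!: continuous_intros)

lemma vector_derivative_affine: "vector_derivative (\<lambda>t. p + t *\<^sub>R v) (at t) = v"
  by (rule vector_derivative_at) (auto intro!: derivative_eq_intros)

section \<open>Piecewise continuous and piecewise smooth functions\<close>

definition gap :: "real set \<Rightarrow> real \<Rightarrow> real \<Rightarrow> real \<Rightarrow> real \<Rightarrow> bool" where
  "gap P a b p q \<longleftrightarrow> a \<le> p \<and> p < q \<and> q \<le> b \<and> {p<..<q} \<inter> P = {}"

definition piecewise_continuous ::
  "real \<Rightarrow> real \<Rightarrow> (real \<Rightarrow> 'a::topological_space) \<Rightarrow> bool" where
  "piecewise_continuous a b f \<longleftrightarrow>
     (\<exists>P. finite P \<and> (\<forall>p q. gap P a b p q \<longrightarrow>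
        (\<exists>g. continuous_on {p..q} g \<and> (\<forall>t\<in>{p<..<q}. f t = g t))))"

lemma piecewise_smooth_gap:
  "piecewise_smooth a b f \<longleftrightarrow> continuous_on {a..b} f \<and>
     (\<exists>P. finite P \<and> (\<forall>p q. gap P a b p q \<longrightarrow> smooth_on_interval p q f))"
  by (simp add: piecewise_smooth_def gap_def)

lemma piecewise_smooth_imp_continuous: "piecewise_smooth a b f \<Longrightarrow> continuous_on {a..b} f"
  by (simp add: piecewise_smooth_def)

lemma gap_widen: "gap P a' b' p q \<Longrightarrow> a \<le> a' \<Longrightarrow> b' \<le> b \<Longrightarrow> gap P a b p q"
  by (auto simp: gap_def)

lemma gap_around:
  assumes "finite P" "t \<in> {a<..<b} - P"
  obtains p q where "gap P a b p q" "p < t" "t < q"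
proof -
  have "open ({a<..<b} - P)"
    using assms(1) by (intro open_Diff finite_imp_closed) auto
  then obtain e where e: "e > 0" "cball t e \<subseteq> {a<..<b} - P"
    using assms(2) open_contains_cball by blast
  have sub: "{t - e..t + e} \<subseteq> {a<..<b} - P"
    using e(2) by (auto simp: cball_def dist_real_def subset_iff abs_le_iff)
  then have "t - e \<in> {a<..<b}" "t + e \<in> {a<..<b}"
    using e(1) by (auto simp: subset_iff)
  then have "gap P a b (t - e) (t + e)"
    using e(1) sub unfolding gap_def by (fastforce simp: subset_iff)
  then show ?thesis using that[of "t - e" "t + e"] e(1) by simp
qed

lemma piecewise_continuous_compose2:
  assumes f: "piecewise_continuous a b f" and g: "piecewise_continuous a b g"
    and h: "continuous_on UNIV (\<lambda>x. h (fst x) (snd x))"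
  shows "piecewise_continuous a b (\<lambda>t. h (f t) (g t))"
proof -
  obtain P where P: "finite P" "\<And>p q. gap P a b p q \<Longrightarrow>
        \<exists>g. continuous_on {p..q} g \<and> (\<forall>t\<in>{p<..<q}. f t = g t)"
    using f unfolding piecewise_continuous_def by metis
  obtain Q where Q: "finite Q" "\<And>p q. gap Q a b p q \<Longrightarrow>
        \<exists>k. continuous_on {p..q} k \<and> (\<forall>t\<in>{p<..<q}. g t = k t)"
    using g unfolding piecewise_continuous_def by metis
  show ?thesis unfolding piecewise_continuous_def
  proof (intro exI[of _ "P \<union> Q"] conjI allI impI)
    show "finite (P \<union> Q)" using P Q by simp
    fix p q assume "gap (P \<union> Q) a b p q"
    then have "gap P a b p q" "gap Q a b p q" by (auto simp: gap_def)
    then obtain f' g' where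
      fg: "continuous_on {p..q} f'" "\<forall>t\<in>{p<..<q}. f t = f' t"
      "continuous_on {p..q} g'" "\<forall>t\<in>{p<..<q}. g t = g' t"
      using P Q by meson
    have "continuous_on {p..q} (\<lambda>t. h (fst (f' t, g' t)) (snd (f' t, g' t)))"
      by (rule continuous_on_compose2[OF h]) (use fg in \<open>auto intro!: continuous_intros\<close>)
    then show "\<exists>k. continuous_on {p..q} k \<and> (\<forall>t\<in>{p<..<q}. h (f t) (g t) = k t)"
      using fg by (intro exI[of _ "\<lambda>t. h (f' t) (g' t)"]) auto
  qed
qed

lemma continuous_imp_piecewise_continuous:
  "continuous_on {a..b} f \<Longrightarrow> piecewise_continuous a b f"
  unfolding piecewise_continuous_def gap_def
  by (intro exI[of _ "{}"] conjI allI impI exI[of _ f]) (auto elim: continuous_on_subset)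

lemma piecewise_smooth_imp_piecewise_continuous:
  "piecewise_smooth a b f \<Longrightarrow> piecewise_continuous a b f"
  by (intro continuous_imp_piecewise_continuous piecewise_smooth_imp_continuous)

lemma piecewise_continuous_subinterval:
  assumes "piecewise_continuous a b f" "a \<le> a'" "b' \<le> b"
  shows "piecewise_continuous a' b' f"
  using assms unfolding piecewise_continuous_def by (meson gap_widen)

lemma integrable_on_gaps:
  fixes f :: "real \<Rightarrow> 'a::banach"
  assumes "finite P" "\<And>p q. gap P a b p q \<Longrightarrow> f integrable_on {p..q}"
  shows "f integrable_on {a..b}"
  using assms
proof (induction P arbitrary: a b rule: finite_induct)
  case empty
  show ?case
  proof (cases "a < b")
    case True
    then show ?thesis by (intro empty) (auto simp: gap_def)
  next
    case False
    then have "{a..b} = {} \<or> {a..b} = {a}" by auto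
    then show ?thesis
      using integrable_on_refl[of f a] by (auto simp: integrable_on_empty)
  qed
next
  case (insert x P)
  show ?case
  proof (cases "x \<in> {a<..<b}")
    case True
    have "f integrable_on {a..x}"
      by (rule insert.IH, rule insert.prems) (use True in \<open>auto simp: gap_def\<close>)
    moreover have "f integrable_on {x..b}"
      by (rule insert.IH, rule insert.prems) (use True in \<open>auto simp: gap_def\<close>)
    ultimately show ?thesis
      using True by (intro Henstock_Kurzweil_Integration.integrable_combine[of a x b]) auto
  next
    case False
    show ?thesis
      by (rule insert.IH, rule insert.prems) (use False in \<open>auto simp: gap_def\<close>)
  qed
qed

lemma piecewise_continuous_integrable:
  fixes f :: "real \<Rightarrow> 'a::euclidean_space"
  assumes "piecewise_continuous a b f"
  shows "f integrable_on {a..b}"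
proof -
  obtain P where P: "finite P" "\<And>p q. gap P a b p q \<Longrightarrow>
        \<exists>g. continuous_on {p..q} g \<and> (\<forall>t\<in>{p<..<q}. f t = g t)"
    using assms unfolding piecewise_continuous_def by metis
  show ?thesis
  proof (rule integrable_on_gaps[OF P(1)])
    fix p q assume "gap P a b p q"
    then obtain g where g: "continuous_on {p..q} g" "\<forall>t\<in>{p<..<q}. f t = g t"
      using P(2) by blast
    show "f integrable_on {p..q}"
      by (rule integrable_spike_finite[of "{p, q}" _ _ g])
        (use g in \<open>auto intro: integrable_continuous_interval\<close>)
  qed
qed

lemma integral_spike_interior:
  fixes f g :: "real \<Rightarrow> 'a::real_normed_vector"
  assumes "finite N" "\<And>t. t \<in> {a<..<b} - N \<Longrightarrow> g t = f t"
  shows "integral {a..b} f = integral {a..b} g"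
  by (rule integral_spike[of "insert a (insert b N)"])
    (use assms in \<open>auto intro!: negligible_finite\<close>)

lemma smooth_on_interval_comb:
  assumes "smooth_on_interval a b f" "smooth_on_interval a b g"
  shows "smooth_on_interval a b (\<lambda>t. r *\<^sub>R f t + s *\<^sub>R g t)"
proof -
  obtain D where D: "D 0 = f"
    "\<And>m t. t \<in> {a..b} \<Longrightarrow> (D m has_vector_derivative D (Suc m) t) (at t within {a..b})"
    using assms(1) unfolding smooth_on_interval_def by blast
  obtain E where E: "E 0 = g"
    "\<And>m t. t \<in> {a..b} \<Longrightarrow> (E m has_vector_derivative E (Suc m) t) (at t within {a..b})"
    using assms(2) unfolding smooth_on_interval_def by blast
  show ?thesis unfolding smooth_on_interval_def
  proof (intro exI[of _ "\<lambda>m t. r *\<^sub>R D m t + s *\<^sub>R E m t"] conjI allI ballI)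
    fix m t assume t: "t \<in> {a..b}"
    show "((\<lambda>t. r *\<^sub>R D m t + s *\<^sub>R E m t) has_vector_derivative
        r *\<^sub>R D (Suc m) t + s *\<^sub>R E (Suc m) t) (at t within {a..b})"
      by (intro has_vector_derivative_add
          bounded_linear.has_vector_derivative[OF bounded_linear_scaleR_right] D(2) E(2) t)
  qed (simp add: D(1) E(1))
qed

lemma piecewise_smooth_comb:
  assumes f: "piecewise_smooth a b f" and g: "piecewise_smooth a b g"
  shows "piecewise_smooth a b (\<lambda>t. r *\<^sub>R f t + s *\<^sub>R g t)"
proof -
  obtain P where P: "finite P" "\<And>p q. gap P a b p q \<Longrightarrow> smooth_on_interval p q f"
    using f unfolding piecewise_smooth_gap by metis
  obtain Q where Q: "finite Q" "\<And>p q. gap Q a b p q \<Longrightarrow> smooth_on_interval p q g"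
    using g unfolding piecewise_smooth_gap by metis
  have "smooth_on_interval p q (\<lambda>t. r *\<^sub>R f t + s *\<^sub>R g t)" if "gap (P \<union> Q) a b p q" for p q
    using that by (intro smooth_on_interval_comb P Q) (auto simp: gap_def)
  moreover have "continuous_on {a..b} (\<lambda>t. r *\<^sub>R f t + s *\<^sub>R g t)"
    using f g unfolding piecewise_smooth_def by (auto intro!: continuous_intros)
  ultimately show ?thesis unfolding piecewise_smooth_gap
    using P(1) Q(1) by (intro conjI exI[of _ "P \<union> Q"]) auto
qed

lemma piecewise_smooth_const: "piecewise_smooth a b (\<lambda>t. w)"
  using piecewise_smooth_affine[of a b w 0] by simp

lemma piecewise_smooth_add:
  "piecewise_smooth a b f \<Longrightarrow> piecewise_smooth a b g \<Longrightarrow> piecewise_smooth a b (\<lambda>t. f t + g t)"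
  using piecewise_smooth_comb[of a b f g 1 1] by simp

lemma smooth_on_interval_interior:
  assumes "smooth_on_interval p q f"
  obtains D where "continuous_on {p..q} D"
    "\<And>t. t \<in> {p<..<q} \<Longrightarrow> (f has_vector_derivative D t) (at t)"
proof -
  obtain D where D: "D 0 = f"
    "\<And>m t. t \<in> {p..q} \<Longrightarrow> (D m has_vector_derivative D (Suc m) t) (at t within {p..q})"
    using assms(1) unfolding smooth_on_interval_def by blast
  show ?thesis
  proof (rule that[of "D (Suc 0)"])
    show "continuous_on {p..q} (D (Suc 0))"
      unfolding continuous_on_eq_continuous_within
    proof
      fix t assume "t \<in> {p..q}"
      from D(2)[OF this, of "Suc 0"] show "continuous (at t within {p..q}) (D (Suc 0))"
        by (rule has_vector_derivative_continuous)
    qed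
    fix t assume t: "t \<in> {p<..<q}"
    then have "t \<in> {p..q}" by simp
    from D(2)[OF this, of 0] have "(f has_vector_derivative D (Suc 0) t) (at t within {p..q})"
      by (simp add: D(1))
    then have "(f has_vector_derivative D (Suc 0) t) (at t within {p<..<q})"
      by (rule has_vector_derivative_within_subset) auto
    then show "(f has_vector_derivative D (Suc 0) t) (at t)"
      using at_within_open[OF t open_greaterThanLessThan] by simp
  qed
qed

lemma piecewise_smooth_has_derivative:
  assumes "piecewise_smooth a b f"
  obtains N where "finite N"
    "\<And>t. t \<in> {a<..<b} - N \<Longrightarrow> (f has_vector_derivative vector_derivative f (at t)) (at t)"
proof -
  obtain P where P: "finite P" "\<And>p q. gap P a b p q \<Longrightarrow> smooth_on_interval p q f"
    using assms unfolding piecewise_smooth_gap by metis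
  show ?thesis
  proof
    show "finite P" by fact
    fix t assume "t \<in> {a<..<b} - P"
    then obtain p q where pq: "gap P a b p q" "p < t" "t < q"
      using gap_around[OF P(1)] by metis
    obtain D where "\<And>t. t \<in> {p<..<q} \<Longrightarrow> (f has_vector_derivative D t) (at t)"
      using smooth_on_interval_interior[OF P(2)[OF pq(1)]] by metis
    then have "(f has_vector_derivative D t) (at t)" using pq by simp
    then show "(f has_vector_derivative vector_derivative f (at t)) (at t)"
      using vector_derivative_at by metis
  qed
qed

lemma piecewise_continuous_vector_derivative:
  assumes "piecewise_smooth a b f"
  shows "piecewise_continuous a b (\<lambda>t. vector_derivative f (at t))"
proof -
  obtain P where P: "finite P" "\<And>p q. gap P a b p q \<Longrightarrow> smooth_on_interval p q f"
    using assms unfolding piecewise_smooth_gap by metis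
  show ?thesis unfolding piecewise_continuous_def
  proof (intro exI[of _ P] conjI allI impI)
    fix p q assume "gap P a b p q"
    then obtain D where "continuous_on {p..q} D"
      "\<And>t. t \<in> {p<..<q} \<Longrightarrow> (f has_vector_derivative D t) (at t)"
      using smooth_on_interval_interior[OF P(2)] by metis
    then show "\<exists>g. continuous_on {p..q} g \<and> (\<forall>t\<in>{p<..<q}. vector_derivative f (at t) = g t)"
      by (intro exI[of _ D]) (auto intro: vector_derivative_at)
  qed (fact P(1))
qed

lemma vector_derivative_comb:
  assumes f: "piecewise_smooth a b f" and g: "piecewise_smooth a b g"
  obtains N where "finite N" "\<And>t. t \<in> {a<..<b} - N \<Longrightarrow>
    vector_derivative (\<lambda>t. r *\<^sub>R f t + s *\<^sub>R g t) (at t) =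
      r *\<^sub>R vector_derivative f (at t) + s *\<^sub>R vector_derivative g (at t)"
proof -
  obtain M where M: "finite M"
    "\<And>t. t \<in> {a<..<b} - M \<Longrightarrow> (f has_vector_derivative vector_derivative f (at t)) (at t)"
    using piecewise_smooth_has_derivative[OF f] by metis
  obtain N where N: "finite N"
    "\<And>t. t \<in> {a<..<b} - N \<Longrightarrow> (g has_vector_derivative vector_derivative g (at t)) (at t)"
    using piecewise_smooth_has_derivative[OF g] by metis
  show ?thesis
    by (rule that[of "M \<union> N"])
      (use M N in \<open>auto intro!: vector_derivative_at derivative_eq_intros\<close>)
qed

lemma piecewise_smooth_has_integral:
  assumes "piecewise_smooth a b f" "a \<le> b"
  shows "((\<lambda>t. vector_derivative f (at t)) has_integral (f b - f a)) {a..b}"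
proof -
  obtain N where N: "finite N"
    "\<And>t. t \<in> {a<..<b} - N \<Longrightarrow> (f has_vector_derivative vector_derivative f (at t)) (at t)"
    using piecewise_smooth_has_derivative[OF assms(1)] by metis
  show ?thesis
    by (rule fundamental_theorem_of_calculus_interior_strong[OF N(1) assms(2)])
      (use N(2) assms(1) in \<open>auto simp: piecewise_smooth_def\<close>)
qed

lemma piecewise_smooth_displacement_le:
  assumes f: "piecewise_smooth a b f" and ab: "a \<le> b"
  shows "norm (f b - f a) \<le> integral {a..b} (\<lambda>t. norm (vector_derivative f (at t)))"
proof -
  let ?g = "\<lambda>t. vector_derivative f (at t)"
  have g: "piecewise_continuous a b ?g"
    by (rule piecewise_continuous_vector_derivative[OF f])
  have "(\<lambda>t. norm (?g t)) integrable_on {a..b}"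
    by (rule piecewise_continuous_integrable,
        rule piecewise_continuous_compose2[OF g g, of "\<lambda>x y. norm x"]) (intro continuous_intros)
  then have "norm (integral {a..b} ?g) \<le> integral {a..b} (\<lambda>t. norm (?g t))"
    by (intro Henstock_Kurzweil_Integration.integral_norm_bound_integral
        piecewise_continuous_integrable[OF g]) auto
  then show ?thesis
    using integral_unique[OF piecewise_smooth_has_integral[OF f ab]] by simp
qed

section \<open>The \<open>L\<^sup>2\<close> inner product\<close>

definition l2_inner ::
  "real \<Rightarrow> real \<Rightarrow> (real \<Rightarrow> 'a::euclidean_space) \<Rightarrow> (real \<Rightarrow> 'a) \<Rightarrow> real" where
  "l2_inner a b f g = integral {a..b} (\<lambda>t. f t \<bullet> g t)"

lemma piecewise_continuous_inner_integrable:
  assumes "piecewise_continuous a b f" "piecewise_continuous a b g"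
  shows "(\<lambda>t. f t \<bullet> g t) integrable_on {a..b}"
  by (rule piecewise_continuous_integrable, rule piecewise_continuous_compose2[OF assms, of inner])
    (intro continuous_intros)

lemma piecewise_continuous_comb:
  fixes f g :: "real \<Rightarrow> 'a::real_normed_vector"
  assumes "piecewise_continuous a b f" "piecewise_continuous a b g"
  shows "piecewise_continuous a b (\<lambda>t. r *\<^sub>R f t + s *\<^sub>R g t)"
  by (rule piecewise_continuous_compose2[OF assms, of "\<lambda>x y. r *\<^sub>R x + s *\<^sub>R y"])
    (intro continuous_intros)

lemma l2_inner_commute: "l2_inner a b f g = l2_inner a b g f"
  by (simp add: l2_inner_def inner_commute)

lemma l2_inner_comb_left:
  assumes "piecewise_continuous a b f" "piecewise_continuous a b g" "piecewise_continuous a b k"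
  shows "l2_inner a b (\<lambda>t. r *\<^sub>R f t + s *\<^sub>R g t) k = r * l2_inner a b f k + s * l2_inner a b g k"
proof -
  have "(\<lambda>t. f t \<bullet> k t) integrable_on {a..b}" "(\<lambda>t. g t \<bullet> k t) integrable_on {a..b}"
    using assms by (auto intro: piecewise_continuous_inner_integrable)
  then have "((\<lambda>t. r * (f t \<bullet> k t) + s * (g t \<bullet> k t)) has_integral
      (r * l2_inner a b f k + s * l2_inner a b g k)) {a..b}"
    unfolding l2_inner_def by (intro has_integral_add has_integral_mult_right) auto
  then show ?thesis
    by (simp add: l2_inner_def inner_add_left integral_unique)
qed

lemma l2_inner_spike:
  assumes "finite N" "\<And>t. t \<in> {a<..<b} - N \<Longrightarrow> f t = f' t"
  shows "l2_inner a b f g = l2_inner a b f' g"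
  unfolding l2_inner_def by (rule integral_spike_interior[OF assms(1)]) (simp add: assms(2))

lemma l2_inner_self_nonneg: "l2_inner a b f f \<ge> 0"
  unfolding l2_inner_def by (cases "(\<lambda>t. f t \<bullet> f t) integrable_on {a..b}")
    (auto intro: integral_nonneg simp: not_integrable_integral)

lemma l2_inner_comb_self:
  assumes f: "piecewise_continuous a b f" and g: "piecewise_continuous a b g"
  shows "l2_inner a b (\<lambda>t. r *\<^sub>R f t + s *\<^sub>R g t) (\<lambda>t. r *\<^sub>R f t + s *\<^sub>R g t) =
    r\<^sup>2 * l2_inner a b f f + 2 * r * s * l2_inner a b f g + s\<^sup>2 * l2_inner a b g g"
proof -
  let ?h = "\<lambda>t. r *\<^sub>R f t + s *\<^sub>R g t"
  have h: "piecewise_continuous a b ?h" by (rule piecewise_continuous_comb[OF f g])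
  have "l2_inner a b ?h ?h = r * l2_inner a b f ?h + s * l2_inner a b g ?h"
    by (rule l2_inner_comb_left[OF f g h])
  also have "l2_inner a b f ?h = r * l2_inner a b f f + s * l2_inner a b f g"
    unfolding l2_inner_commute[of a b f ?h] l2_inner_commute[of a b f g]
    by (rule l2_inner_comb_left[OF f g f])
  also have "l2_inner a b g ?h = r * l2_inner a b f g + s * l2_inner a b g g"
    unfolding l2_inner_commute[of a b g ?h] by (rule l2_inner_comb_left[OF f g g])
  finally show ?thesis by (simp add: algebra_simps power2_eq_square)
qed

lemma l2_Cauchy_Schwarz:
  assumes f: "piecewise_continuous a b f" and g: "piecewise_continuous a b g"
  shows "(l2_inner a b f g)\<^sup>2 \<le> l2_inner a b f f * l2_inner a b g g"
proof -
  let ?A = "l2_inner a b f f" and ?B = "l2_inner a b f g" and ?D = "l2_inner a b g g"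
  have *: "0 \<le> ?A - 2 * x * ?B + x\<^sup>2 * ?D" for x
    using l2_inner_comb_self[OF f g, of 1 "-x"]
      l2_inner_self_nonneg[of a b "\<lambda>t. 1 *\<^sub>R f t + (-x) *\<^sub>R g t"] by simp
  show ?thesis
  proof (cases "?D = 0")
    case True
    have "?B = 0"
    proof (rule ccontr)
      assume "?B \<noteq> 0"
      then show False using *[of "(?A + 1) / (2 * ?B)"] True by (simp add: field_simps)
    qed
    then show ?thesis using True by simp
  next
    case False
    then have D: "?D > 0" using l2_inner_self_nonneg[of a b g] by simp
    have "0 \<le> ?A - 2 * (?B / ?D) * ?B + (?B / ?D)\<^sup>2 * ?D" by (rule *)
    then have "0 \<le> (?A - 2 * (?B / ?D) * ?B + (?B / ?D)\<^sup>2 * ?D) * ?D" using D by simp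
    also have "\<dots> = ?A * ?D - ?B\<^sup>2" using D by (simp add: field_simps power2_eq_square)
    finally show ?thesis by simp
  qed
qed

lemma displacement_le_l2:
  assumes f: "piecewise_smooth a b f" and ab: "a \<le> b"
  shows "norm (f b - f a) \<le> sqrt ((b - a) *
    l2_inner a b (\<lambda>t. vector_derivative f (at t)) (\<lambda>t. vector_derivative f (at t)))"
proof -
  let ?g = "\<lambda>t. vector_derivative f (at t)"
  define w where "w = f b - f a"
  have w: "piecewise_continuous a b (\<lambda>t. w)"
    by (rule continuous_imp_piecewise_continuous) simp
  have "l2_inner a b ?g (\<lambda>t. w) = w \<bullet> w"
    using has_integral_linear[OF piecewise_smooth_has_integral[OF assms] bounded_linear_inner_left[of w]]
    by (simp add: l2_inner_def integral_unique w_def o_def)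
  moreover have "l2_inner a b (\<lambda>t. w) (\<lambda>t. w) = (b - a) * (w \<bullet> w)"
    using ab by (simp add: l2_inner_def)
  ultimately have *: "(w \<bullet> w)\<^sup>2 \<le> l2_inner a b ?g ?g * ((b - a) * (w \<bullet> w))"
    using l2_Cauchy_Schwarz[OF piecewise_continuous_vector_derivative[OF f] w] by simp
  have "w \<bullet> w \<le> (b - a) * l2_inner a b ?g ?g"
  proof (cases "w = 0")
    case False
    then have "w \<bullet> w > 0" by simp
    moreover from * have "(w \<bullet> w) * (w \<bullet> w) \<le> ((b - a) * l2_inner a b ?g ?g) * (w \<bullet> w)"
      by (simp add: power2_eq_square mult_ac)
    ultimately show ?thesis by (simp only: mult_le_cancel_right_pos)
  qed (use ab l2_inner_self_nonneg[of a b ?g] in simp)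
  then show ?thesis
    by (simp add: w_def[symmetric] norm_eq_sqrt_inner)
qed

lemma l2_inner_derivative_comb_left:
  assumes X: "piecewise_smooth a b X" and Y: "piecewise_smooth a b Y"
    and k: "piecewise_continuous a b k"
  shows "l2_inner a b (\<lambda>t. vector_derivative (\<lambda>t. r *\<^sub>R X t + s *\<^sub>R Y t) (at t)) k =
    r * l2_inner a b (\<lambda>t. vector_derivative X (at t)) k + s * l2_inner a b (\<lambda>t. vector_derivative Y (at t)) k"
proof -
  let ?XY = "\<lambda>t. r *\<^sub>R X t + s *\<^sub>R Y t"
  obtain N where N: "finite N" "\<And>t. t \<in> {a<..<b} - N \<Longrightarrow>
    vector_derivative ?XY (at t) =
      r *\<^sub>R vector_derivative X (at t) + s *\<^sub>R vector_derivative Y (at t)"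
    by (rule vector_derivative_comb[OF X Y, of r s]) blast
  have "l2_inner a b (\<lambda>t. vector_derivative ?XY (at t)) k =
    l2_inner a b (\<lambda>t. r *\<^sub>R vector_derivative X (at t) + s *\<^sub>R vector_derivative Y (at t)) k"
    by (rule l2_inner_spike[OF N])
  also have "\<dots> = r * l2_inner a b (\<lambda>t. vector_derivative X (at t)) k
      + s * l2_inner a b (\<lambda>t. vector_derivative Y (at t)) k"
    by (intro l2_inner_comb_left piecewise_continuous_vector_derivative X Y k)
  finally show ?thesis .
qed

section \<open>The \<open>H\<^sup>1\<close> inner product\<close>

lemma h1_inner_l2:
  assumes "piecewise_smooth 0 (2 * pi) X" "piecewise_smooth 0 (2 * pi) Y"
  shows "h1_inner X Y = l2_inner 0 (2 * pi) X Y +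
    l2_inner 0 (2 * pi) (\<lambda>t. vector_derivative X (at t)) (\<lambda>t. vector_derivative Y (at t))"
proof -
  note X = piecewise_smooth_imp_piecewise_continuous[OF assms(1)] piecewise_smooth_imp_piecewise_continuous[OF assms(2)]
  note dX = piecewise_continuous_vector_derivative[OF assms(1)] piecewise_continuous_vector_derivative[OF assms(2)]
  show ?thesis
    unfolding h1_inner_def l2_inner_def
    by (rule Henstock_Kurzweil_Integration.integral_add
        [OF piecewise_continuous_inner_integrable[OF X] piecewise_continuous_inner_integrable[OF dX]])
qed

lemma h1_inner_comb_left:
  assumes X: "piecewise_smooth 0 (2 * pi) X" and Y: "piecewise_smooth 0 (2 * pi) Y"
    and Z: "piecewise_smooth 0 (2 * pi) Z"
  shows "h1_inner (\<lambda>t. r *\<^sub>R X t + s *\<^sub>R Y t) Z = r * h1_inner X Z + s * h1_inner Y Z"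
proof -
  have "h1_inner (\<lambda>t. r *\<^sub>R X t + s *\<^sub>R Y t) Z = l2_inner 0 (2 * pi) (\<lambda>t. r *\<^sub>R X t + s *\<^sub>R Y t) Z +
    l2_inner 0 (2 * pi) (\<lambda>t. vector_derivative (\<lambda>t. r *\<^sub>R X t + s *\<^sub>R Y t) (at t))
      (\<lambda>t. vector_derivative Z (at t))"
    by (rule h1_inner_l2[OF piecewise_smooth_comb[OF X Y] Z])
  also have "l2_inner 0 (2 * pi) (\<lambda>t. vector_derivative (\<lambda>t. r *\<^sub>R X t + s *\<^sub>R Y t) (at t))
      (\<lambda>t. vector_derivative Z (at t)) =
      r * l2_inner 0 (2 * pi) (\<lambda>t. vector_derivative X (at t)) (\<lambda>t. vector_derivative Z (at t))
      + s * l2_inner 0 (2 * pi) (\<lambda>t. vector_derivative Y (at t)) (\<lambda>t. vector_derivative Z (at t))"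
    by (intro l2_inner_derivative_comb_left piecewise_continuous_vector_derivative X Y Z)
  also have "l2_inner 0 (2 * pi) (\<lambda>t. r *\<^sub>R X t + s *\<^sub>R Y t) Z =
      r * l2_inner 0 (2 * pi) X Z + s * l2_inner 0 (2 * pi) Y Z"
    by (intro l2_inner_comb_left piecewise_smooth_imp_piecewise_continuous X Y Z)
  finally show ?thesis
    by (simp add: h1_inner_l2[OF X Z] h1_inner_l2[OF Y Z] algebra_simps)
qed

lemma h1_norm_nonneg: "h1_norm X \<ge> 0"
proof -
  have "h1_inner X X \<ge> 0"
    unfolding h1_inner_def
    by (cases "(\<lambda>t. X t \<bullet> X t + vector_derivative X (at t) \<bullet> vector_derivative X (at t)) integrable_on {0..2 * pi}")
      (auto intro: integral_nonneg simp: not_integrable_integral)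
  then show ?thesis by (simp add: h1_norm_def)
qed

lemma l2_le_h1_norm:
  assumes "piecewise_smooth 0 (2 * pi) X"
  shows "l2_inner 0 (2 * pi) X X \<le> (h1_norm X)\<^sup>2"
    and "l2_inner 0 (2 * pi) (\<lambda>t. vector_derivative X (at t)) (\<lambda>t. vector_derivative X (at t)) \<le> (h1_norm X)\<^sup>2"
  using h1_inner_l2[OF assms assms] l2_inner_self_nonneg[of 0 "2 * pi" X]
    l2_inner_self_nonneg[of 0 "2 * pi" "\<lambda>t. vector_derivative X (at t)"]
  by (auto simp: h1_norm_def)

lemma l2_inner_le_h1_norm:
  assumes "piecewise_smooth 0 (2 * pi) X" "piecewise_smooth 0 (2 * pi) Y"
  shows "\<bar>l2_inner 0 (2 * pi) X Y\<bar> \<le> h1_norm X * h1_norm Y"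
    and "\<bar>l2_inner 0 (2 * pi) (\<lambda>t. vector_derivative X (at t)) (\<lambda>t. vector_derivative Y (at t))\<bar>
      \<le> h1_norm X * h1_norm Y"
proof -
  have *: "\<bar>u\<bar> \<le> h1_norm X * h1_norm Y"
    if "u\<^sup>2 \<le> v * w" "v \<le> (h1_norm X)\<^sup>2" "w \<le> (h1_norm Y)\<^sup>2" "0 \<le> w" for u v w
  proof -
    have "v * w \<le> (h1_norm X)\<^sup>2 * (h1_norm Y)\<^sup>2"
      using that by (intro mult_mono) auto
    then have "\<bar>u\<bar>\<^sup>2 \<le> (h1_norm X * h1_norm Y)\<^sup>2"
      using that(1) by (simp add: power_mult_distrib)
    then show ?thesis
      by (rule power2_le_imp_le) (simp add: h1_norm_nonneg)
  qed
  show "\<bar>l2_inner 0 (2 * pi) X Y\<bar> \<le> h1_norm X * h1_norm Y"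
    by (rule *[OF l2_Cauchy_Schwarz l2_le_h1_norm(1) l2_le_h1_norm(1) l2_inner_self_nonneg])
      (intro assms piecewise_smooth_imp_piecewise_continuous)+
  show "\<bar>l2_inner 0 (2 * pi) (\<lambda>t. vector_derivative X (at t)) (\<lambda>t. vector_derivative Y (at t))\<bar>
      \<le> h1_norm X * h1_norm Y"
    by (rule *[OF l2_Cauchy_Schwarz l2_le_h1_norm(2) l2_le_h1_norm(2) l2_inner_self_nonneg])
      (intro assms piecewise_continuous_vector_derivative)+
qed

lemma h1_inner_le_h1_norm:
  assumes "piecewise_smooth 0 (2 * pi) X" "piecewise_smooth 0 (2 * pi) Y"
  shows "\<bar>h1_inner X Y\<bar> \<le> 2 * h1_norm X * h1_norm Y"
  using l2_inner_le_h1_norm[OF assms] h1_inner_l2[OF assms] by linarith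

lemma displacement_le_h1:
  assumes "piecewise_smooth 0 (2 * pi) X"
  shows "norm (X (2 * pi) - X 0) \<le> sqrt (2 * pi) * h1_norm X"
proof -
  have "norm (X (2 * pi) - X 0) \<le> sqrt (2 * pi *
    l2_inner 0 (2 * pi) (\<lambda>t. vector_derivative X (at t)) (\<lambda>t. vector_derivative X (at t)))"
    using displacement_le_l2[OF assms] by simp
  also have "\<dots> \<le> sqrt (2 * pi * (h1_norm X)\<^sup>2)"
    using l2_le_h1_norm(2)[OF assms] by simp
  also have "\<dots> = sqrt (2 * pi) * h1_norm X"
    using h1_norm_nonneg[of X] by (simp add: real_sqrt_mult)
  finally show ?thesis .
qed

section \<open>Minimal displacements\<close>

definition reduced :: "real ^ 'n \<Rightarrow> real ^ 'n \<Rightarrow> bool" where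
  "reduced L u \<longleftrightarrow> (\<forall>i. \<bar>u $ i\<bar> \<le> L $ i / 2)"

lemma abs_le_abs_add_period:
  fixes u l :: real and m :: int
  assumes "\<bar>u\<bar> \<le> l / 2" "l > 0"
  shows "\<bar>u\<bar> \<le> \<bar>u + of_int m * l\<bar>"
proof (cases "m = 0")
  case False
  then have "1 \<le> \<bar>m\<bar>" by linarith
  then have "1 \<le> \<bar>real_of_int m\<bar>" by linarith
  then have "l \<le> \<bar>real_of_int m\<bar> * l" using assms(2) by simp
  then have "l \<le> \<bar>of_int m * l\<bar>" using assms(2) by (simp add: abs_mult)
  then show ?thesis using assms by linarith
qed simp

lemma reduced_le_congruent:
  fixes L :: "real ^ 'n"
  assumes L: "\<And>i. L $ i > 0" and u: "reduced L u"
    and eq: "torus_proj L (p + u) = torus_proj L (p + w)"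
  shows "\<bar>u $ i\<bar> \<le> \<bar>w $ i\<bar>"
proof -
  obtain m :: int where "(p + w) $ i = (p + u) $ i + of_int m * L $ i"
    using eq unfolding torus_proj_eq_iff by blast
  then have "w $ i = u $ i + of_int m * L $ i" by simp
  then show ?thesis
    using abs_le_abs_add_period[of "u $ i" "L $ i" m] u L[of i] by (simp add: reduced_def)
qed

lemma reduced_norm_le:
  fixes L :: "real ^ 'n"
  assumes "\<And>i. L $ i > 0" "reduced L u" "torus_proj L (p + u) = torus_proj L (p + w)"
  shows "norm u \<le> norm w"
  using reduced_le_congruent[OF assms] by (intro norm_le_componentwise_cart) simp

lemma torus_dist_reduced:
  fixes L :: "real ^ 'n"
  assumes L: "\<And>i. L $ i > 0" and u: "reduced L u"
  shows "torus_dist L (torus_proj L p) (torus_proj L (p + u)) = norm u"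
  unfolding torus_dist_def
proof (rule cInf_eq_minimum)
  let ?c = "\<lambda>t. torus_proj L (p + t *\<^sub>R u)"
  have "velocity L ?c t = u" for t
    using velocity_lift[OF L is_lift_affine] by (simp add: vector_derivative_affine)
  then have "curve_length L ?c 0 1 = norm u"
    by (simp add: curve_length_def)
  moreover have "piecewise_smooth_curve L 0 1 ?c"
    unfolding piecewise_smooth_curve_def using is_lift_affine piecewise_smooth_affine by blast
  ultimately show "norm u \<in> {curve_length L c 0 1 |c. piecewise_smooth_curve L 0 1 c \<and>
      c 0 = torus_proj L p \<and> c 1 = torus_proj L (p + u)}"
    by (intro CollectI exI[of _ ?c]) auto
next
  fix x assume "x \<in> {curve_length L c 0 1 |c. piecewise_smooth_curve L 0 1 c \<and>
      c 0 = torus_proj L p \<and> c 1 = torus_proj L (p + u)}"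
  then obtain c where c: "x = curve_length L c 0 1" "piecewise_smooth_curve L 0 1 c"
      "c 0 = torus_proj L p" "c 1 = torus_proj L (p + u)" by blast
  then obtain C where C: "is_lift L c C" "piecewise_smooth 0 1 C"
    unfolding piecewise_smooth_curve_def by blast
  have "torus_proj L (C 0) = torus_proj L p" "torus_proj L (C 1) = torus_proj L (p + u)"
    using C(1) c by (auto simp: is_lift_def)
  then have "torus_proj L (p + u) = torus_proj L (p + (C 1 - C 0))"
    using torus_proj_add[of L "C 0" p "C 1 - C 0"] by (simp add: algebra_simps)
  then have "norm u \<le> norm (C 1 - C 0)"
    by (rule reduced_norm_le[OF L u])
  also have "\<dots> \<le> integral {0..1} (\<lambda>t. norm (vector_derivative C (at t)))"
    by (rule piecewise_smooth_displacement_le[OF C(2)]) simp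
  also have "\<dots> = x"
    by (simp add: c(1) curve_length_def velocity_lift[OF L C(1)])
  finally show "norm u \<le> x" .
qed

lemma reduced_displacement_exists:
  fixes L :: "real ^ 'n"
  assumes L: "\<And>i. L $ i > 0"
  obtains u where "reduced L u" "torus_proj L (p + u) = torus_proj L q"
proof -
  define m where "m i = round ((q - p) $ i / L $ i)" for i
  define u :: "real ^ 'n" where "u = (\<chi> i. (q - p) $ i - of_int (m i) * L $ i)"
  have "\<bar>u $ i\<bar> \<le> L $ i / 2" for i
  proof -
    have "\<bar>of_int (m i) - (q - p) $ i / L $ i\<bar> \<le> 1 / 2"
      unfolding m_def by (rule of_int_round_abs_le)
    then have "\<bar>of_int (m i) - (q - p) $ i / L $ i\<bar> * L $ i \<le> 1 / 2 * L $ i"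
      using L[of i] by (intro mult_right_mono) auto
    also have "\<bar>of_int (m i) - (q - p) $ i / L $ i\<bar> * L $ i =
        \<bar>(of_int (m i) - (q - p) $ i / L $ i) * L $ i\<bar>"
      using L[of i] by (simp add: abs_mult)
    also have "(of_int (m i) - (q - p) $ i / L $ i) * L $ i = - (u $ i)"
      using L[of i] by (simp add: u_def field_simps)
    finally show ?thesis by simp
  qed
  moreover have "q $ i = (p + u) $ i + of_int (m i) * L $ i" for i
    by (simp add: u_def)
  ultimately show ?thesis
    using that[of u] unfolding reduced_def torus_proj_eq_iff by blast
qed

lemma norm_eq_imp_abs_component_eq:
  fixes u w :: "real ^ 'n"
  assumes le: "\<And>i. \<bar>u $ i\<bar> \<le> \<bar>w $ i\<bar>" and eq: "norm u = norm w"
  shows "\<bar>u $ i\<bar> = \<bar>w $ i\<bar>"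
proof (rule ccontr)
  assume "\<bar>u $ i\<bar> \<noteq> \<bar>w $ i\<bar>"
  then have lt: "\<bar>u $ i\<bar> < \<bar>w $ i\<bar>" using le[of i] by simp
  have sq: "(norm v)\<^sup>2 = (\<Sum>i\<in>UNIV. \<bar>v $ i\<bar>\<^sup>2)" for v :: "real ^ 'n"
    unfolding power2_norm_eq_inner inner_vec_def by (simp add: power2_eq_square)
  have "(\<Sum>i\<in>UNIV. \<bar>u $ i\<bar>\<^sup>2) < (\<Sum>i\<in>UNIV. \<bar>w $ i\<bar>\<^sup>2)"
  proof (rule sum_strict_mono_ex1)
    show "\<forall>x\<in>UNIV. \<bar>u $ x\<bar>\<^sup>2 \<le> \<bar>w $ x\<bar>\<^sup>2"
      using le by (simp add: abs_le_square_iff)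
    show "\<exists>a\<in>UNIV. \<bar>u $ a\<bar>\<^sup>2 < \<bar>w $ a\<bar>\<^sup>2"
      using power_strict_mono[OF lt, of 2] by (auto simp del: power2_abs)
  qed simp
  then show False unfolding sq[symmetric] using eq by simp
qed

lemma torus_dist_eq_norm_imp_reduced:
  fixes L :: "real ^ 'n"
  assumes L: "\<And>i. L $ i > 0" and u: "torus_dist L (torus_proj L p) (torus_proj L (p + u)) = norm u"
  shows "reduced L u"
proof -
  obtain w where w: "reduced L w" "torus_proj L (p + w) = torus_proj L (p + u)"
    using reduced_displacement_exists[OF L] by blast
  have "norm w = norm u"
    using torus_dist_reduced[OF L w(1), of p] u w(2) by simp
  then have "\<bar>w $ i\<bar> = \<bar>u $ i\<bar>" for i
    using reduced_le_congruent[OF L w] by (intro norm_eq_imp_abs_component_eq) auto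
  then show ?thesis using w(1) by (simp add: reduced_def)
qed

lemma torus_dist_translate:
  fixes L :: "real ^ 'n"
  assumes L: "\<And>i. L $ i > 0"
  shows "torus_dist L (torus_proj L (p + w)) (torus_proj L (q + w)) =
    torus_dist L (torus_proj L p) (torus_proj L q)"
proof -
  obtain u where u: "reduced L u" "torus_proj L (p + u) = torus_proj L q"
    using reduced_displacement_exists[OF L] by blast
  have "torus_proj L (p + w + u) = torus_proj L (q + w)"
    using torus_proj_add[OF u(2), of w] by (simp add: algebra_simps)
  then show ?thesis
    using torus_dist_reduced[OF L u(1), of p] torus_dist_reduced[OF L u(1), of "p + w"] u(2) by simp
qed

lemma finite_reduced_displacements:
  fixes L :: "real ^ 'n"
  assumes L: "\<And>i. L $ i > 0"
  shows "finite {u. reduced L u \<and> torus_proj L (p + u) = y}"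
proof (cases "\<exists>w. torus_proj L (p + w) = y")
  case True
  then obtain w where w: "torus_proj L (p + w) = y" by blast
  define B where "B i = {m::int. \<bar>real_of_int m\<bar> \<le> 1 / 2 + \<bar>w $ i\<bar> / L $ i}" for i
  define A where "A i = (\<lambda>m. w $ i + of_int m * L $ i) ` B i" for i
  have "finite (B i)" for i
  proof (rule finite_subset)
    show "B i \<subseteq> {- \<lceil>1 / 2 + \<bar>w $ i\<bar> / L $ i\<rceil> .. \<lceil>1 / 2 + \<bar>w $ i\<bar> / L $ i\<rceil>}"
      unfolding B_def by (auto; linarith)
  qed simp
  then have fin: "finite (PiE UNIV A)"
    by (intro finite_PiE) (auto simp: A_def)
  have "{u. reduced L u \<and> torus_proj L (p + u) = y} \<subseteq> vec_lambda ` PiE UNIV A"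
  proof
    fix u assume "u \<in> {u. reduced L u \<and> torus_proj L (p + u) = y}"
    then have u: "reduced L u" "torus_proj L (p + w) = torus_proj L (p + u)" using w by auto
    have "u $ i \<in> A i" for i
    proof -
      obtain m :: int where m: "u $ i = w $ i + of_int m * L $ i"
        using u(2) unfolding torus_proj_eq_iff by (auto simp: algebra_simps)
      have "\<bar>u $ i\<bar> \<le> L $ i / 2" using u(1) by (simp add: reduced_def)
      then have "\<bar>of_int m * L $ i\<bar> \<le> L $ i / 2 + \<bar>w $ i\<bar>" using m by linarith
      then have "\<bar>real_of_int m\<bar> \<le> 1 / 2 + \<bar>w $ i\<bar> / L $ i"
        using L[of i] by (simp add: abs_mult field_simps)
      then show ?thesis using m by (auto simp: A_def B_def)
    qed
    then show "u \<in> vec_lambda ` PiE UNIV A"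
      by (intro image_eqI[of _ _ "vec_nth u"]) auto
  qed
  then show ?thesis using fin finite_subset by blast
qed simp

section \<open>Geodesics of the flat torus\<close>

lemma geodesic_iff:
  "geodesic L g \<longleftrightarrow> (\<exists>p v. g = (\<lambda>t. torus_proj L (p + t *\<^sub>R v)))"
proof
  assume "geodesic L g"
  then obtain C V where C: "is_lift L g C" "\<And>t. (C has_vector_derivative V t) (at t)"
    "\<And>t. (V has_vector_derivative 0) (at t)"
    unfolding geodesic_def by blast
  obtain v where v: "\<And>t. V t = v"
    using has_vector_derivative_zero_constant[of UNIV V] C(3) by auto
  have "((\<lambda>t. C t - t *\<^sub>R v) has_vector_derivative 0) (at t)" for t
    using C(2)[of t] by (auto intro!: derivative_eq_intros simp: v)
  then obtain p where p: "\<And>t. C t - t *\<^sub>R v = p"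
    using has_vector_derivative_zero_constant[of UNIV "\<lambda>t. C t - t *\<^sub>R v"] by auto
  have "C t = p + t *\<^sub>R v" for t using p[of t] by (simp add: algebra_simps)
  then have "g = (\<lambda>t. torus_proj L (p + t *\<^sub>R v))"
    using C(1) by (auto simp: is_lift_def)
  then show "\<exists>p v. g = (\<lambda>t. torus_proj L (p + t *\<^sub>R v))" by blast
next
  assume "\<exists>p v. g = (\<lambda>t. torus_proj L (p + t *\<^sub>R v))"
  then obtain p v where g: "g = (\<lambda>t. torus_proj L (p + t *\<^sub>R v))" by blast
  show "geodesic L g"
    unfolding geodesic_def g
    by (intro exI[of _ "\<lambda>t. p + t *\<^sub>R v"] exI[of _ "\<lambda>t. v"] conjI allI is_lift_affine)
      (auto intro!: derivative_eq_intros)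
qed

lemma velocity_geodesic:
  fixes L :: "real ^ 'n"
  assumes "\<And>i. L $ i > 0"
  shows "velocity L (\<lambda>t. torus_proj L (p + t *\<^sub>R v)) t = v"
  using velocity_lift[OF assms is_lift_affine] by (simp add: vector_derivative_affine)

lemma curve_length_geodesic:
  fixes L :: "real ^ 'n"
  assumes "\<And>i. L $ i > 0" "a \<le> b"
  shows "curve_length L (\<lambda>t. torus_proj L (p + t *\<^sub>R v)) a b = (b - a) * norm v"
  using assms(2) by (simp add: curve_length_def velocity_geodesic[OF assms(1)])

lemma one_over_geodesic_reduced:
  fixes L :: "real ^ 'n"
  assumes L: "\<And>i. L $ i > 0" and u: "reduced L ((2 * pi / real k) *\<^sub>R v)"
  shows "one_over_geodesic L k (\<lambda>t. torus_proj L (p + t *\<^sub>R v))"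
proof -
  have "torus_dist L (torus_proj L (p + t *\<^sub>R v)) (torus_proj L (p + (t + 2 * pi / real k) *\<^sub>R v)) =
      2 * pi / real k * norm v" for t
    using torus_dist_reduced[OF L u, of "p + t *\<^sub>R v"] by (simp add: algebra_simps)
  then show ?thesis
    unfolding one_over_geodesic_def by (simp add: curve_length_geodesic[OF L])
qed

lemma minind_ge_2:
  fixes L :: "real ^ 'n"
  assumes L: "\<And>i. L $ i > 0" and g: "geodesic L g"
  shows "2 \<le> minind L g"
proof -
  obtain p v where g: "g = (\<lambda>t. torus_proj L (p + t *\<^sub>R v))"
    using g unfolding geodesic_iff by blast
  define B where "B = (\<Sum>i\<in>UNIV. 4 * pi * \<bar>v $ i\<bar> / L $ i)"
  obtain k :: nat where k: "real k > max 2 B" using reals_Archimedean2 by blast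
  have "reduced L ((2 * pi / real k) *\<^sub>R v)"
    unfolding reduced_def
  proof
    fix i
    have "4 * pi * \<bar>v $ i\<bar> / L $ i \<le> B"
      unfolding B_def by (rule member_le_sum) (use L in \<open>auto simp: less_imp_le\<close>)
    then have "4 * pi * \<bar>v $ i\<bar> / L $ i \<le> real k" using k by simp
    then have "4 * pi * \<bar>v $ i\<bar> \<le> real k * L $ i" using L[of i] by (simp add: field_simps)
    then show "\<bar>((2 * pi / real k) *\<^sub>R v) $ i\<bar> \<le> L $ i / 2"
      using k by (simp add: abs_mult field_simps)
  qed
  then have "2 \<le> k \<and> one_over_geodesic L k g"
    unfolding g using one_over_geodesic_reduced[OF L] k by auto
  from LeastI[of "\<lambda>k. 2 \<le> k \<and> one_over_geodesic L k g", OF this] show ?thesis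
    by (simp add: minind_def)
qed

lemma minind_le:
  "2 \<le> k \<Longrightarrow> one_over_geodesic L k g \<Longrightarrow> minind L g \<le> k"
  unfolding minind_def by (rule Least_le) simp

lemma min_geodesicE:
  fixes L :: "real ^ 'n"
  assumes L: "\<And>i. L $ i > 0" and h: "min_geodesic L x y h"
  obtains p e where "h = (\<lambda>t. torus_proj L (p + t *\<^sub>R e))" "norm e = 1" "torus_proj L p = x"
    "torus_proj L (p + torus_dist L x y *\<^sub>R e) = y" "reduced L (torus_dist L x y *\<^sub>R e)"
proof -
  have "geodesic L h" using h by (simp add: min_geodesic_def)
  then obtain p e where pe: "h = (\<lambda>t. torus_proj L (p + t *\<^sub>R e))"
    unfolding geodesic_iff by blast
  have e: "norm e = 1" using h by (simp add: min_geodesic_def pe velocity_geodesic[OF L])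
  have p: "torus_proj L p = x" "torus_proj L (p + torus_dist L x y *\<^sub>R e) = y"
    using h by (auto simp: min_geodesic_def pe)
  obtain w where w: "reduced L w" "torus_proj L (p + w) = torus_proj L (p + torus_dist L x y *\<^sub>R e)"
    using reduced_displacement_exists[OF L] by blast
  have "torus_dist L x y = norm w"
    using torus_dist_reduced[OF L w(1), of p] w(2) p by simp
  then have "torus_dist L x y \<ge> 0" by simp
  then have "reduced L (torus_dist L x y *\<^sub>R e)"
    by (intro torus_dist_eq_norm_imp_reduced[OF L, where p = p]) (simp add: p e)
  then show ?thesis using that pe e p by blast
qed

lemma min_geodesic_exists:
  fixes L :: "real ^ 'n"
  assumes L: "\<And>i. L $ i > 0" and u: "reduced L u"
  obtains e where "norm u *\<^sub>R e = u"
    "min_geodesic L (torus_proj L p) (torus_proj L (p + u)) (\<lambda>t. torus_proj L (p + t *\<^sub>R e))"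
proof -
  define e where "e = (if u = 0 then axis undefined 1 else sgn u)"
  have e: "norm e = 1" "norm u *\<^sub>R e = u"
    by (auto simp: e_def norm_sgn sgn_div_norm)
  have "geodesic L (\<lambda>t. torus_proj L (p + t *\<^sub>R e))" unfolding geodesic_iff by blast
  then have "min_geodesic L (torus_proj L p) (torus_proj L (p + u)) (\<lambda>t. torus_proj L (p + t *\<^sub>R e))"
    using e by (simp add: min_geodesic_def velocity_geodesic[OF L] torus_dist_reduced[OF L u])
  then show ?thesis using that e by blast
qed

section \<open>Existence of gradient-like vectors and restart points\<close>

lemma gradient_like_exists:
  fixes L :: "real ^ 'n"
  assumes L: "\<And>i. L $ i > 0" and k: "k > 0" and x: "\<And>i. i < k \<Longrightarrow> x i = torus_proj L (q i)"
  shows "\<exists>v. gradient_like L k x v"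
proof -
  define l where "l j = torus_dist L (x j) (x (Suc j mod k))" for j
  define G where "G u i = - (- u ((i + k - 1) mod k) + u i)" for u :: "nat \<Rightarrow> real ^ 'n" and i
  define U where "U i = {u. reduced L u \<and> torus_proj L (q i + u) = x (Suc i mod k)}" for i
  have step: "\<exists>u\<in>U i. l i *\<^sub>R velocity L \<eta> 0 = u \<and> l i *\<^sub>R velocity L \<eta> (l i) = u"
    if i: "i < k" and \<eta>: "min_geodesic L (x i) (x (Suc i mod k)) \<eta>" for i \<eta>
  proof -
    obtain p e where pe: "\<eta> = (\<lambda>t. torus_proj L (p + t *\<^sub>R e))" "norm e = 1"
      "torus_proj L p = x i" "torus_proj L (p + l i *\<^sub>R e) = x (Suc i mod k)" "reduced L (l i *\<^sub>R e)"
      unfolding l_def by (rule min_geodesicE[OF L \<eta>]) blast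
    have "torus_proj L (q i + l i *\<^sub>R e) = x (Suc i mod k)"
      using torus_proj_add[of L "q i" p] pe(3,4) x[OF i] by simp
    then show ?thesis
      using pe by (auto simp: U_def velocity_geodesic[OF L])
  qed
  have "\<exists>\<eta>. min_geodesic L (x i) (x (Suc i mod k)) \<eta>" if i: "i < k" for i
  proof -
    obtain u where u: "reduced L u" "torus_proj L (q i + u) = torus_proj L (q (Suc i mod k))"
      using reduced_displacement_exists[OF L] by blast
    obtain e where "min_geodesic L (torus_proj L (q i)) (torus_proj L (q i + u))
        (\<lambda>t. torus_proj L (q i + t *\<^sub>R e))"
      using min_geodesic_exists[OF L u(1)] by blast
    then show ?thesis using u(2) x i k by auto
  qed
  then obtain \<eta> where "\<And>i. i < k \<Longrightarrow> min_geodesic L (x i) (x (Suc i mod k)) (\<eta> i)" by metis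
  then have "candidate_gradient L k x (\<lambda>i. let l = (\<lambda>j. torus_dist L (x j) (x (Suc j mod k)));
      p = (i + k - 1) mod k in - (- (l p *\<^sub>R velocity L (\<eta> p) (l p)) + l i *\<^sub>R velocity L (\<eta> i) 0))"
    unfolding candidate_gradient_def by (intro exI[of _ \<eta>]) simp
  then obtain v0 where v0: "candidate_gradient L k x v0" by blast
  have mag: "magnitude k v \<in> (\<lambda>u. magnitude k (G u)) ` PiE {..<k} U"
    if cg: "candidate_gradient L k x v" for v
  proof -
    obtain \<eta> where \<eta>: "\<And>i. i < k \<Longrightarrow> min_geodesic L (x i) (x (Suc i mod k)) (\<eta> i)"
      "\<And>i. i < k \<Longrightarrow> v i = - (- (l ((i + k - 1) mod k) *\<^sub>R velocity L (\<eta> ((i + k - 1) mod k)) (l ((i + k - 1) mod k)))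
          + l i *\<^sub>R velocity L (\<eta> i) 0)"
      using cg unfolding candidate_gradient_def Let_def l_def by blast
    define u where "u = restrict (\<lambda>i. l i *\<^sub>R velocity L (\<eta> i) 0) {..<k}"
    have u: "u i \<in> U i" "u i = l i *\<^sub>R velocity L (\<eta> i) 0" "u i = l i *\<^sub>R velocity L (\<eta> i) (l i)"
      if "i < k" for i
      using step[OF that \<eta>(1)[OF that]] that by (auto simp: u_def)
    have "v i = G u i" if i: "i < k" for i
    proof -
      have "(i + k - 1) mod k < k" using k by simp
      from u(3)[OF this] u(2)[OF i] \<eta>(2)[OF i] show ?thesis by (simp add: G_def)
    qed
    then have "magnitude k v = magnitude k (G u)"
      by (simp add: magnitude_def)
    moreover have "u \<in> PiE {..<k} U"
      using u(1) by (auto simp: u_def)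
    ultimately show ?thesis by blast
  qed
  have "finite (PiE {..<k} U)"
    unfolding U_def by (intro finite_PiE finite_reduced_displacements L) auto
  then have fin: "finite (magnitude k ` {v. candidate_gradient L k x v})"
  proof (rule finite_subset[rotated, OF finite_imageI])
    show "magnitude k ` {v. candidate_gradient L k x v} \<subseteq> (\<lambda>u. magnitude k (G u)) ` PiE {..<k} U"
      using mag by blast
  qed
  have "Max (magnitude k ` {v. candidate_gradient L k x v}) \<in> magnitude k ` {v. candidate_gradient L k x v}"
    using v0 by (intro Max_in fin) auto
  then obtain v where v: "candidate_gradient L k x v"
    "magnitude k v = Max (magnitude k ` {v. candidate_gradient L k x v})" by auto
  have "magnitude k w \<le> magnitude k v" if "candidate_gradient L k x w" for w
    unfolding v(2) using that by (intro Max_ge fin) auto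
  then show ?thesis using v(1) unfolding gradient_like_def by blast
qed

lemma cut_along_same_distance:
  fixes L :: "real ^ 'n"
  assumes L: "\<And>i. L $ i > 0" and g: "geodesic L g"
    and ab: "cut_along L g a b" and cd: "cut_along L g c d"
  shows "torus_dist L (g c) (g d) = torus_dist L (g a) (g b)"
proof -
  obtain p v where g: "g = (\<lambda>t. torus_proj L (p + t *\<^sub>R v))"
    using g unfolding geodesic_iff by blast
  have tr: "torus_dist L (g (s + \<tau>)) (g (t + \<tau>)) = torus_dist L (g s) (g t)" for s t \<tau>
    using torus_dist_translate[OF L, of "p + s *\<^sub>R v" "\<tau> *\<^sub>R v" "p + t *\<^sub>R v"]
    by (simp add: g algebra_simps)
  have len: "s \<le> t \<Longrightarrow> curve_length L g s t = (t - s) * norm v" for s t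
    unfolding g by (rule curve_length_geodesic[OF L])
  have not_less: "\<not> b - a < d - c" if "cut_along L g a b" "cut_along L g c d" for a b c d
  proof
    assume less: "b - a < d - c"
    have "torus_dist L (g a) (g (a + (d - c))) < curve_length L g a (a + (d - c))"
      using that(1) less by (auto simp: cut_along_def)
    moreover have "torus_dist L (g c) (g d) = curve_length L g c d" "c < d" "a < b"
      using that by (auto simp: cut_along_def)
    ultimately show False
      using tr[of c "a - c" d] less by (simp add: len algebra_simps)
  qed
  have "b - a = d - c"
    using not_less[OF ab cd] not_less[OF cd ab] by linarith
  then show ?thesis using tr[of a "c - a" b] by (simp add: algebra_simps)
qed

lemma restart_points_exist:
  fixes L :: "real ^ 'n"
  assumes L: "\<And>i. L $ i > 0" and g: "geodesic L g"
  shows "\<exists>x. restart_points L g k x"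
proof -
  have "\<exists>a b. if \<exists>a' b'. cut_along L g a' b'
             then cut_along L g a b \<and>
               (\<forall>a' b'. cut_along L g a' b' \<longrightarrow>
                  torus_dist L (g a') (g b') \<le> torus_dist L (g a) (g b))
             else b = a + 2 * pi / real k"
  proof (cases "\<exists>a' b'. cut_along L g a' b'")
    case True
    then obtain a b where ab: "cut_along L g a b" by blast
    have "torus_dist L (g c) (g d) \<le> torus_dist L (g a) (g b)" if "cut_along L g c d" for c d
      by (rule eq_refl[OF cut_along_same_distance[OF L g ab that]])
    then show ?thesis unfolding if_P[OF True] using ab by blast
  next
    case False
    then show ?thesis unfolding if_not_P[OF False] by blast
  qed
  then obtain a b where ab: "if \<exists>a' b'. cut_along L g a' b'
             then cut_along L g a b \<and>
               (\<forall>a' b'. cut_along L g a' b' \<longrightarrow>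
                  torus_dist L (g a') (g b') \<le> torus_dist L (g a) (g b))
             else b = a + 2 * pi / real k" by blast
  define x where "x i = (if i = 0 then g a
    else g (b + (real i - 1) * (a + 2 * pi - b) / (real k - 1)))" for i
  have "x 0 = g a" "\<forall>i\<in>{1..<k}. x i = g (b + (real i - 1) * (a + 2 * pi - b) / (real k - 1))"
    by (auto simp: x_def)
  then show ?thesis
    unfolding restart_points_def using ab by blast
qed

section \<open>Periodic extension and reconnecting polygons\<close>

lemma quasi_periodic_imp_int_shift:
  fixes f :: "real \<Rightarrow> 'a::real_vector"
  assumes "\<And>t. f (t + T) = f t + w"
  shows "f (t + of_int m * T) = f t + of_int m *\<^sub>R w"
proof -
  have nat: "f (t + real n * T) = f t + real n *\<^sub>R w" for n t
  proof (induction n)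
    case (Suc n)
    have "f (t + real (Suc n) * T) = f ((t + real n * T) + T)" by (simp add: algebra_simps)
    also have "\<dots> = f t + real (Suc n) *\<^sub>R w"
      unfolding assms Suc by (simp add: algebra_simps)
    finally show ?case .
  qed simp
  show ?thesis
  proof (cases m rule: int_cases2)
    case (nonneg n)
    then show ?thesis using nat[of t n] by simp
  next
    case (nonpos n)
    then show ?thesis using nat[of "t - real n * T" n] by (simp add: algebra_simps)
  qed
qed

lemma on_circle_int_shift:
  assumes "on_circle c"
  shows "c (t + of_int m * (2 * pi)) = c t"
proof -
  have nat: "c (t + real n * (2 * pi)) = c t" for n t
  proof (induction n)
    case (Suc n)
    have "c (t + real (Suc n) * (2 * pi)) = c ((t + real n * (2 * pi)) + 2 * pi)"
      by (simp add: algebra_simps)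
    also have "\<dots> = c t" using assms Suc unfolding on_circle_def by simp
    finally show ?case .
  qed simp
  show ?thesis
  proof (cases m rule: int_cases2)
    case (nonneg n)
    then show ?thesis using nat[of t n] by simp
  next
    case (nonpos n)
    then show ?thesis using nat[of "t - real n * (2 * pi)" n] by simp
  qed
qed

lemma floor_period:
  fixes t T :: real
  assumes "T > 0"
  obtains s and m :: int where "t = s + of_int m * T" "0 \<le> s" "s < T"
proof
  show "t = (t - of_int \<lfloor>t / T\<rfloor> * T) + of_int \<lfloor>t / T\<rfloor> * T" by simp
  have "of_int \<lfloor>t / T\<rfloor> * T \<le> t / T * T" "t / T * T < (of_int \<lfloor>t / T\<rfloor> + 1) * T"
    using assms by (intro mult_right_mono mult_strict_right_mono; linarith)+
  then show "0 \<le> t - of_int \<lfloor>t / T\<rfloor> * T" "t - of_int \<lfloor>t / T\<rfloor> * T < T"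
    using assms by (auto simp: algebra_simps)
qed

lemma on_circle_eqI:
  assumes "on_circle c" "on_circle d" "\<And>t. 0 \<le> t \<Longrightarrow> t < 2 * pi \<Longrightarrow> c t = d t"
  shows "c = d"
proof
  fix t
  obtain s m where "t = s + of_int m * (2 * pi)" "0 \<le> s" "s < 2 * pi"
    using floor_period[of "2 * pi" t] by auto
  then show "c t = d t"
    using on_circle_int_shift[OF assms(1)] on_circle_int_shift[OF assms(2)] assms(3) by metis
qed

lemma quasi_periodic_continuous:
  fixes f :: "real \<Rightarrow> 'a::real_normed_vector"
  assumes T: "T > 0" and cont: "continuous_on {0..T} f" and per: "\<And>t. f (t + T) = f t + w"
  shows "continuous_on UNIV f"
proof -
  have piece: "continuous_on {of_int m * T..(of_int m + 1) * T} f" for m :: int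
  proof -
    have "continuous_on {of_int m * T..(of_int m + 1) * T} (\<lambda>t. f (t - of_int m * T) + of_int m *\<^sub>R w)"
      by (intro continuous_intros continuous_on_compose2[OF cont]) (auto simp: algebra_simps)
    moreover have "f (t - of_int m * T) + of_int m *\<^sub>R w = f t" for t
      using quasi_periodic_imp_int_shift[of f T w, OF per, of "t - of_int m * T" m] by simp
    ultimately show ?thesis by simp
  qed
  have "isCont f t" for t
  proof -
    obtain s and m :: int where s: "t = s + of_int m * T" "0 \<le> s" "s < T"
      using floor_period[OF T] by blast
    have "continuous_on ({of_int (m - 1) * T..(of_int (m - 1) + 1) * T} \<union> {of_int m * T..(of_int m + 1) * T}) f"
      by (intro continuous_on_closed_Un piece) auto
    also have "{of_int (m - 1) * T..(of_int (m - 1) + 1) * T} \<union> {of_int m * T..(of_int m + 1) * T}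
      = {(of_int m - 1) * T..(of_int m + 1) * T}"
      using T ivl_disj_un_two_touch(4)[of "(of_int m - 1) * T" "of_int m * T" "(of_int m + 1) * T"]
      by simp
    finally have "continuous_on {(of_int m - 1) * T<..<(of_int m + 1) * T} f"
      by (rule continuous_on_subset) auto
    moreover have "t \<in> {(of_int m - 1) * T<..<(of_int m + 1) * T}"
      using s T by (auto simp: algebra_simps)
    ultimately show ?thesis
      by (simp add: continuous_on_eq_continuous_at)
  qed
  then show ?thesis by (simp add: continuous_at_imp_continuous_on)
qed

lemma quasi_periodic_extension:
  fixes F :: "real \<Rightarrow> 'a::real_normed_vector"
  assumes T: "T > 0" and cont: "continuous_on {0..T} F"
  obtains f where "continuous_on UNIV f" "\<And>t. f (t + T) = f t + (F T - F 0)"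
    "\<And>t. t \<in> {0..T} \<Longrightarrow> f t = F t"
proof -
  define f where "f t = F (t - of_int \<lfloor>t / T\<rfloor> * T) + of_int \<lfloor>t / T\<rfloor> *\<^sub>R (F T - F 0)" for t
  have per: "f (t + T) = f t + (F T - F 0)" for t
  proof -
    have "(t + T) / T = t / T + 1" using T by (simp add: field_simps)
    then show ?thesis by (simp add: f_def algebra_simps)
  qed
  have eq: "f t = F t" if "t \<in> {0..T}" for t
  proof (cases "t = T")
    case True
    then show ?thesis using T by (simp add: f_def)
  next
    case False
    then have "\<lfloor>t / T\<rfloor> = 0" using that T by (simp add: floor_eq_iff)
    then show ?thesis by (simp add: f_def)
  qed
  have "continuous_on {0..T} f"
    by (rule continuous_on_eq[OF cont]) (simp add: eq)
  then have "continuous_on UNIV f"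
    by (rule quasi_periodic_continuous[of T f "F T - F 0", OF T _ per])
  then show ?thesis using that per eq by blast
qed

lemma polygon_exists:
  fixes p :: "'a::real_normed_vector" and u :: "nat \<Rightarrow> 'a"
  assumes k: "k > 0"
  obtains C where "continuous_on UNIV C" "\<And>t. C (t + 2 * pi) = C t + (\<Sum>j<k. u j)"
    "\<And>i r. i < k \<Longrightarrow> r \<in> {0..2 * pi / real k} \<Longrightarrow>
       C (2 * pi * real i / real k + r) = p + (\<Sum>j<i. u j) + (r / (2 * pi / real k)) *\<^sub>R u i"
proof -
  define ramp where "ramp x = max 0 (min 1 x)" for x :: real
  define F where "F t = p + (\<Sum>j<k. ramp (t * real k / (2 * pi) - real j) *\<^sub>R u j)" for t
  have F: "F (2 * pi * real i / real k + r) = p + (\<Sum>j<i. u j) + (r / (2 * pi / real k)) *\<^sub>R u i"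
    if i: "i < k" and r: "r \<in> {0..2 * pi / real k}" for i r
  proof -
    define x where "x = r / (2 * pi / real k)"
    have x: "0 \<le> x" "x \<le> 1" using r k by (auto simp: x_def field_simps)
    have tx: "(2 * pi * real i / real k + r) * real k / (2 * pi) = real i + x"
      using k by (simp add: x_def field_simps)
    have "(\<Sum>j<k. ramp (real i + x - real j) *\<^sub>R u j) =
        (\<Sum>j<k. if j < i then u j else if j = i then x *\<^sub>R u i else 0)"
    proof (rule sum.cong)
      fix j
      have "j < i \<Longrightarrow> real j + 1 \<le> real i" "i < j \<Longrightarrow> real i + 1 \<le> real j" by linarith+
      then show "ramp (real i + x - real j) *\<^sub>R u j =
          (if j < i then u j else if j = i then x *\<^sub>R u i else 0)"
        using x by (cases "j < i"; cases "i < j") (auto simp: ramp_def)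
    qed simp
    also have "\<dots> = (\<Sum>j<Suc i. if j < i then u j else if j = i then x *\<^sub>R u i else 0)"
      using i by (intro sum.mono_neutral_right) auto
    also have "\<dots> = (\<Sum>j<i. u j) + x *\<^sub>R u i" by simp
    finally show ?thesis by (simp add: F_def tx x_def)
  qed
  have "continuous_on {0..2 * pi} F"
    unfolding F_def ramp_def by (intro continuous_intros) auto
  then obtain C where C: "continuous_on UNIV C" "\<And>t. C (t + 2 * pi) = C t + (F (2 * pi) - F 0)"
    "\<And>t. t \<in> {0..2 * pi} \<Longrightarrow> C t = F t"
    using quasi_periodic_extension[of "2 * pi" F] by auto
  have "2 * pi * real (k - 1) / real k + 2 * pi / real k = 2 * pi"
    using k by (simp add: field_simps of_nat_diff)
  moreover have "(\<Sum>j<k. u j) = (\<Sum>j<k - 1. u j) + u (k - 1)"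
    using sum.lessThan_Suc[of u "k - 1"] k by simp
  ultimately have "F (2 * pi) = p + (\<Sum>j<k. u j)"
    using F[of "k - 1" "2 * pi / real k"] k by (simp add: add.assoc)
  then have "F (2 * pi) - F 0 = (\<Sum>j<k. u j)"
    using F[of 0 0] k by simp
  moreover have "2 * pi * real i / real k + r \<in> {0..2 * pi}"
    if i: "i < k" and r: "r \<in> {0..2 * pi / real k}" for i r
  proof -
    have "real i + 1 \<le> real k" using i by linarith
    then have "2 * pi * (real i + 1) \<le> 2 * pi * real k" by simp
    then have "2 * pi * real i / real k + 2 * pi / real k \<le> 2 * pi"
      using k by (simp add: field_simps)
    then show ?thesis using r by auto
  qed
  ultimately show ?thesis using that[of C] C F by simp
qed

lemma circle_arc_index:
  assumes k: "k > 0" and t: "0 \<le> t" "t < 2 * pi"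
  obtains i r where "i < k" "r \<in> {0..<2 * pi / real k}" "t = 2 * pi * real i / real k + r"
proof -
  define T where "T = 2 * pi / real k"
  have T: "T > 0" using k by (simp add: T_def)
  obtain r and m :: int where m: "t = r + of_int m * T" "0 \<le> r" "r < T"
    using floor_period[OF T] by blast
  have "0 < (of_int m + 1) * T" using m t by (simp add: algebra_simps)
  then have "m \<ge> 0" using T by (simp add: zero_less_mult_iff)
  have "of_int m * T < 2 * pi" using m t by linarith
  then have "of_int m < real k" using k by (simp add: T_def field_simps)
  then have "nat m < k" using \<open>m \<ge> 0\<close> by linarith
  then show ?thesis
    using that[of "nat m" r] m \<open>m \<ge> 0\<close> by (simp add: T_def)
qed

lemma cyclic_displacements:
  assumes k: "k > 0" and step: "\<And>i. i < k \<Longrightarrow> torus_proj L (q i + u i) = torus_proj L (q (Suc i mod k))"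
  shows "i \<le> k \<Longrightarrow> torus_proj L (q 0 + (\<Sum>j<i. u j)) = torus_proj L (q (i mod k))"
proof (induction i)
  case (Suc i)
  then have "torus_proj L (q 0 + (\<Sum>j<i. u j)) = torus_proj L (q i)" by simp
  then have "torus_proj L (q 0 + (\<Sum>j<i. u j) + u i) = torus_proj L (q i + u i)"
    by (rule torus_proj_add)
  then show ?case using step[of i] Suc.prems by (simp add: algebra_simps)
qed simp

lemma polygon_on_circle:
  assumes k: "k > 0" and step: "\<And>i. i < k \<Longrightarrow> torus_proj L (q i + u i) = torus_proj L (q (Suc i mod k))"
    and C: "\<And>t. C (t + 2 * pi) = C t + (\<Sum>j<k. u j)"
  shows "on_circle (\<lambda>t. torus_proj L (C t))"
  unfolding on_circle_def
proof
  fix t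
  have "torus_proj L (q 0 + (\<Sum>j<k. u j)) = torus_proj L (q 0)"
    using cyclic_displacements[of k L q u k] k step by simp
  from torus_proj_add[OF this, of "C t - q 0"]
  show "torus_proj L (C (t + 2 * pi)) = torus_proj L (C t)"
    unfolding C by (simp add: algebra_simps)
qed

lemma reconnects_exist:
  fixes L :: "real ^ 'n"
  assumes L: "\<And>i. L $ i > 0" and k: "k > 0" and y: "\<And>i. i < k \<Longrightarrow> y i = torus_proj L (q i)"
  shows "\<exists>c. reconnects L k y c"
proof -
  have "\<exists>u. reduced L u \<and> torus_proj L (q i + u) = torus_proj L (q (Suc i mod k))" for i
    using reduced_displacement_exists[OF L] by metis
  then obtain u where u: "\<And>i. reduced L (u i)"
    "\<And>i. torus_proj L (q i + u i) = torus_proj L (q (Suc i mod k))" by metis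
  obtain C where C: "continuous_on UNIV C" "\<And>t. C (t + 2 * pi) = C t + (\<Sum>j<k. u j)"
    "\<And>i r. i < k \<Longrightarrow> r \<in> {0..2 * pi / real k} \<Longrightarrow>
       C (2 * pi * real i / real k + r) = q 0 + (\<Sum>j<i. u j) + (r / (2 * pi / real k)) *\<^sub>R u i"
    by (rule polygon_exists[OF k, of u "q 0"]) blast
  have "reconnects L k y (\<lambda>t. torus_proj L (C t))"
    unfolding reconnects_def
  proof (intro conjI allI impI)
    show "on_circle (\<lambda>t. torus_proj L (C t))"
      by (rule polygon_on_circle[of k L q u C, OF k u(2) C(2)])
    fix i assume i: "i < k"
    obtain e where e: "norm (u i) *\<^sub>R e = u i"
      "min_geodesic L (torus_proj L (q i)) (torus_proj L (q i + u i)) (\<lambda>t. torus_proj L (q i + t *\<^sub>R e))"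
      using min_geodesic_exists[OF L u(1)] by blast
    have yy: "y i = torus_proj L (q i)" "y (Suc i mod k) = torus_proj L (q i + u i)"
      using y[OF i] y[of "Suc i mod k"] k u(2) by auto
    have d: "torus_dist L (y i) (y (Suc i mod k)) = norm (u i)"
      unfolding yy by (rule torus_dist_reduced[OF L u(1)])
    have "torus_proj L (C (2 * pi * real i / real k + r)) =
        torus_proj L (q i + (norm (u i) * (r / (2 * pi / real k))) *\<^sub>R e)"
      if r: "r \<in> {0..2 * pi / real k}" for r
    proof -
      let ?s = "r / (2 * pi / real k)"
      have "torus_proj L (q 0 + (\<Sum>j<i. u j)) = torus_proj L (q i)"
        using cyclic_displacements[of k L q u i, OF k u(2)] i by simp
      then have "torus_proj L (C (2 * pi * real i / real k + r)) = torus_proj L (q i + ?s *\<^sub>R u i)"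
        unfolding C(3)[OF i r] by (rule torus_proj_add)
      also have "?s *\<^sub>R u i = ?s *\<^sub>R (norm (u i) *\<^sub>R e)" by (simp only: e(1))
      also have "\<dots> = (norm (u i) * ?s) *\<^sub>R e" by (simp only: scaleR_scaleR mult.commute)
      finally show ?thesis .
    qed
    moreover have "min_geodesic L (y i) (y (Suc i mod k)) (\<lambda>t. torus_proj L (q i + t *\<^sub>R e))"
      unfolding yy by (rule e(2))
    ultimately show "\<exists>\<eta>. min_geodesic L (y i) (y (Suc i mod k)) \<eta> \<and>
        (\<forall>r\<in>{0..2 * pi / real k}. torus_proj L (C (2 * pi * real i / real k + r)) =
           \<eta> (torus_dist L (y i) (y (Suc i mod k)) * (r / (2 * pi / real k))))"
      unfolding d by (intro exI[of _ "\<lambda>t. torus_proj L (q i + t *\<^sub>R e)"] conjI ballI)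
  qed
  then show ?thesis by blast
qed

lemma reconnects_lift:
  fixes L :: "real ^ 'n"
  assumes L: "\<And>i. L $ i > 0" and k: "k > 0" and c: "reconnects L k y c"
  obtains C p u where "is_lift L c C" "\<And>t. C (t + 2 * pi) = C t + (\<Sum>j<k. u j)"
    "\<And>i r. i < k \<Longrightarrow> r \<in> {0..2 * pi / real k} \<Longrightarrow>
       C (2 * pi * real i / real k + r) = p + (\<Sum>j<i. u j) + (r / (2 * pi / real k)) *\<^sub>R u i"
    "\<And>i. i < k \<Longrightarrow> reduced L (u i)"
proof -
  define d where "d i = torus_dist L (y i) (y (Suc i mod k))" for i
  have "\<exists>q e. torus_proj L q = y i \<and> torus_proj L (q + d i *\<^sub>R e) = y (Suc i mod k) \<and>
      reduced L (d i *\<^sub>R e) \<and> (\<forall>r\<in>{0..2 * pi / real k}. c (2 * pi * real i / real k + r) =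
        torus_proj L (q + (d i * (r / (2 * pi / real k))) *\<^sub>R e))" if i: "i < k" for i
  proof -
    obtain \<eta> where \<eta>: "min_geodesic L (y i) (y (Suc i mod k)) \<eta>"
      "\<And>r. r \<in> {0..2 * pi / real k} \<Longrightarrow> c (2 * pi * real i / real k + r) = \<eta> (d i * (r / (2 * pi / real k)))"
      using c i unfolding reconnects_def d_def by blast
    show ?thesis
      by (rule min_geodesicE[OF L \<eta>(1)]) (use \<eta>(2) in \<open>auto simp: d_def intro!: exI\<close>)
  qed
  then obtain q e where qe: "\<And>i. i < k \<Longrightarrow> torus_proj L (q i) = y i"
    "\<And>i. i < k \<Longrightarrow> torus_proj L (q i + d i *\<^sub>R e i) = y (Suc i mod k)"
    "\<And>i. i < k \<Longrightarrow> reduced L (d i *\<^sub>R e i)"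
    "\<And>i r. i < k \<Longrightarrow> r \<in> {0..2 * pi / real k} \<Longrightarrow> c (2 * pi * real i / real k + r) =
        torus_proj L (q i + (d i * (r / (2 * pi / real k))) *\<^sub>R e i)" by metis
  define u where "u i = d i *\<^sub>R e i" for i
  have step: "torus_proj L (q i + u i) = torus_proj L (q (Suc i mod k))" if "i < k" for i
    using qe(1)[of "Suc i mod k"] qe(2)[OF that] k by (simp add: u_def)
  obtain C where C: "continuous_on UNIV C" "\<And>t. C (t + 2 * pi) = C t + (\<Sum>j<k. u j)"
    "\<And>i r. i < k \<Longrightarrow> r \<in> {0..2 * pi / real k} \<Longrightarrow>
       C (2 * pi * real i / real k + r) = q 0 + (\<Sum>j<i. u j) + (r / (2 * pi / real k)) *\<^sub>R u i"
    by (rule polygon_exists[OF k, of u "q 0"]) blast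
  have "c = (\<lambda>t. torus_proj L (C t))"
  proof (rule on_circle_eqI)
    show "on_circle c" using c by (simp add: reconnects_def)
    show "on_circle (\<lambda>t. torus_proj L (C t))"
      by (rule polygon_on_circle[of k L q u C, OF k step C(2)])
    fix t :: real assume "0 \<le> t" "t < 2 * pi"
    then obtain i r where "i < k" "r \<in> {0..<2 * pi / real k}" "t = 2 * pi * real i / real k + r"
      by (rule circle_arc_index[OF k])
    then have ir: "i < k" "r \<in> {0..2 * pi / real k}" "t = 2 * pi * real i / real k + r" by auto
    have "torus_proj L (q 0 + (\<Sum>j<i. u j)) = torus_proj L (q i)"
      using cyclic_displacements[of k L q u i, OF k step] ir(1) by simp
    then have "torus_proj L (C t) = torus_proj L (q i + (r / (2 * pi / real k)) *\<^sub>R u i)"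
      unfolding ir(3) C(3)[OF ir(1,2)] by (rule torus_proj_add)
    also have "\<dots> = c t"
      unfolding ir(3) qe(4)[OF ir(1,2)] u_def by (simp add: mult.commute)
    finally show "c t = torus_proj L (C t)" by simp
  qed
  then have "is_lift L c C" using C(1) by (simp add: is_lift_def)
  then show ?thesis
    by (rule that[OF _ C(2) C(3)]) (use qe(3) in \<open>auto simp: u_def\<close>)
qed

lemma reduced_sum_bound:
  fixes u :: "nat \<Rightarrow> real ^ 'n"
  assumes k: "k > 0" and u: "\<And>i. i < k \<Longrightarrow> reduced L (u i)"
  shows "reduced L ((1 / real k) *\<^sub>R (\<Sum>j<k. u j))"
  unfolding reduced_def
proof
  fix i
  have "\<bar>(\<Sum>j<k. u j $ i)\<bar> \<le> (\<Sum>j<k. \<bar>u j $ i\<bar>)" by (rule sum_abs)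
  also have "\<dots> \<le> (\<Sum>j<k. L $ i / 2)"
    using u by (intro sum_mono) (auto simp: reduced_def)
  finally show "\<bar>((1 / real k) *\<^sub>R (\<Sum>j<k. u j)) $ i\<bar> \<le> L $ i / 2"
    using k by (simp add: abs_mult field_simps)
qed

lemma restart_curve_exists:
  fixes L :: "real ^ 'n"
  assumes L: "\<And>i. L $ i > 0" and k: "k > 0" and g: "geodesic L g"
  shows "\<exists>c. restart_curve L g k h c"
proof -
  obtain p v where gp: "g = (\<lambda>t. torus_proj L (p + t *\<^sub>R v))"
    using g unfolding geodesic_iff by blast
  obtain x where x: "restart_points L g k x"
    using restart_points_exist[OF L g] by blast
  then obtain a b where ab: "x 0 = g a"
    "\<And>i. i \<in> {1..<k} \<Longrightarrow> x i = g (b + (real i - 1) * (a + 2 * pi - b) / (real k - 1))"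
    unfolding restart_points_def by blast
  have "\<exists>q. x i = torus_proj L q" if "i < k" for i
  proof (cases "i = 0")
    case True
    then show ?thesis using ab(1) gp by auto
  next
    case False
    then show ?thesis using ab(2)[of i] that gp by auto
  qed
  then obtain q where q: "\<And>i. i < k \<Longrightarrow> x i = torus_proj L (q i)" by metis
  obtain w where w: "gradient_like L k x w"
    using gradient_like_exists[of L k x q, OF L k q] by blast
  have "torus_exp (x i) (h *\<^sub>R (- w i)) = torus_proj L (q i + h *\<^sub>R (- w i))" if "i < k" for i
    unfolding q[OF that] by (rule torus_exp_proj)
  then obtain c where "reconnects L k (\<lambda>i. torus_exp (x i) (h *\<^sub>R (- w i))) c"
    using reconnects_exist[of L k "\<lambda>i. torus_exp (x i) (h *\<^sub>R (- w i))" "\<lambda>i. q i + h *\<^sub>R (- w i)", OF L k]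
    by blast
  then show ?thesis using x w unfolding restart_curve_def by blast
qed

section \<open>Limits of the gradient flow are geodesics\<close>

lemma loop_lift_piecewise_smooth:
  fixes L :: "real ^ 'n"
  assumes L: "\<And>i. L $ i > 0" and c: "loop L c" and C: "is_lift L c C"
  shows "piecewise_smooth 0 (2 * pi) C"
proof -
  obtain D where D: "is_lift L c D" "piecewise_smooth 0 (2 * pi) D"
    using c unfolding loop_def piecewise_smooth_curve_def by blast
  obtain w where w: "\<And>t. C t = D t + w"
    using lifts_differ_by_constant[OF L D(1) C] by blast
  have "C = (\<lambda>t. D t + w)" by (rule ext) (rule w)
  then show ?thesis by (simp add: piecewise_smooth_add D(2) piecewise_smooth_const)
qed

lemma loop_field_continuous:
  assumes "loop_field X"
  shows "continuous_on UNIV X"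
  by (rule quasi_periodic_continuous[of "2 * pi" X 0])
    (use assms in \<open>auto simp: loop_field_def on_circle_def piecewise_smooth_def\<close>)

lemma morse_energy_derivative:
  fixes L :: "real ^ 'n"
  assumes L: "\<And>i. L $ i > 0" and c: "loop L c" and C: "is_lift L c C" and X: "loop_field X"
  shows "((\<lambda>e. morse_energy L (\<lambda>t. torus_exp (c t) (e *\<^sub>R X t))) has_real_derivative
    2 * l2_inner 0 (2 * pi) (\<lambda>t. vector_derivative C (at t)) (\<lambda>t. vector_derivative X (at t))) (at 0)"
proof -
  let ?dC = "\<lambda>t. vector_derivative C (at t)" and ?dX = "\<lambda>t. vector_derivative X (at t)"
  have sC: "piecewise_smooth 0 (2 * pi) C" by (rule loop_lift_piecewise_smooth[OF L c C])
  have sX: "piecewise_smooth 0 (2 * pi) X" using X by (simp add: loop_field_def)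
  note dC = piecewise_continuous_vector_derivative[OF sC]
  note dX = piecewise_continuous_vector_derivative[OF sX]
  have eq: "morse_energy L (\<lambda>t. torus_exp (c t) (e *\<^sub>R X t)) =
      l2_inner 0 (2 * pi) ?dC ?dC + 2 * e * l2_inner 0 (2 * pi) ?dC ?dX + e\<^sup>2 * l2_inner 0 (2 * pi) ?dX ?dX" for e
  proof -
    let ?D = "\<lambda>t. 1 *\<^sub>R C t + e *\<^sub>R X t"
    have "continuous_on UNIV C" using C by (simp add: is_lift_def)
    then have "continuous_on UNIV ?D"
      by (intro continuous_intros loop_field_continuous[OF X])
    moreover have "torus_exp (c t) (e *\<^sub>R X t) = torus_proj L (?D t)" for t
      using C by (simp add: is_lift_def torus_exp_proj)
    ultimately have D: "is_lift L (\<lambda>t. torus_exp (c t) (e *\<^sub>R X t)) ?D"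
      by (simp add: is_lift_def)
    obtain N where N: "finite N" "\<And>t. t \<in> {0<..<2 * pi} - N \<Longrightarrow>
      vector_derivative ?D (at t) = 1 *\<^sub>R ?dC t + e *\<^sub>R ?dX t"
      by (rule vector_derivative_comb[OF sC sX, of 1 e]) blast
    have "morse_energy L (\<lambda>t. torus_exp (c t) (e *\<^sub>R X t)) =
        integral {0..2 * pi} (\<lambda>t. (norm (vector_derivative ?D (at t)))\<^sup>2)"
      by (simp only: morse_energy_def velocity_lift[OF L D])
    also have "\<dots> = l2_inner 0 (2 * pi) (\<lambda>t. 1 *\<^sub>R ?dC t + e *\<^sub>R ?dX t) (\<lambda>t. 1 *\<^sub>R ?dC t + e *\<^sub>R ?dX t)"
      unfolding l2_inner_def power2_norm_eq_inner
      by (rule integral_spike_interior[OF N(1)]) (simp only: N(2))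
    also have "\<dots> = l2_inner 0 (2 * pi) ?dC ?dC + 2 * e * l2_inner 0 (2 * pi) ?dC ?dX + e\<^sup>2 * l2_inner 0 (2 * pi) ?dX ?dX"
      unfolding l2_inner_comb_self[OF dC dX] by simp
    finally show ?thesis .
  qed
  show ?thesis unfolding eq by (auto intro!: derivative_eq_intros)
qed

lemma energy_gradient_inner:
  fixes L :: "real ^ 'n"
  assumes L: "\<And>i. L $ i > 0" and c: "loop L c" and C: "is_lift L c C" and \<xi>: "energy_gradient L c \<xi>"
    and X: "loop_field X"
  shows "h1_inner \<xi> X =
    2 * l2_inner 0 (2 * pi) (\<lambda>t. vector_derivative C (at t)) (\<lambda>t. vector_derivative X (at t))"
proof -
  have "((\<lambda>e. morse_energy L (\<lambda>t. torus_exp (c t) (e *\<^sub>R X t))) has_real_derivative h1_inner \<xi> X) (at 0)"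
    using \<xi> X by (simp add: energy_gradient_def)
  from DERIV_unique[OF this morse_energy_derivative[OF L c C X]] show ?thesis .
qed

lemma derivative_limit_zero:
  fixes \<phi> \<psi> :: "real \<Rightarrow> real"
  assumes deriv: "\<And>s. s \<ge> 0 \<Longrightarrow> (\<phi> has_real_derivative \<psi> s) (at s within {0..})"
    and \<phi>: "(\<phi> \<longlongrightarrow> l) at_top" and \<psi>: "(\<psi> \<longlongrightarrow> m) at_top"
  shows "m = 0"
proof -
  have "\<exists>z. s < z \<and> \<phi> (s + 1) - \<phi> s = \<psi> z" if s: "s > 0" for s
  proof -
    have "(\<phi> has_real_derivative \<psi> x) (at x)" if "s \<le> x" "x \<le> s + 1" for x
    proof -
      have "at x within {0..} = at x"
        using that s by (intro at_within_interior) simp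
      then show ?thesis using deriv[of x] that s by simp
    qed
    from MVT2[of s "s + 1" \<phi> \<psi>, OF _ this] show ?thesis by auto
  qed
  then obtain z where z: "\<And>s. s > 0 \<Longrightarrow> s < z s" "\<And>s. s > 0 \<Longrightarrow> \<phi> (s + 1) - \<phi> s = \<psi> (z s)"
    by metis
  have "filterlim z at_top at_top"
    by (rule filterlim_at_top_mono[OF filterlim_ident])
      (use z(1) in \<open>auto intro!: eventually_mono[OF eventually_gt_at_top[of 0]] less_imp_le\<close>)
  then have "((\<lambda>s. \<psi> (z s)) \<longlongrightarrow> m) at_top"
    by (rule filterlim_compose[OF \<psi>])
  moreover have "((\<lambda>s. \<psi> (z s)) \<longlongrightarrow> 0) at_top"
  proof -
    have "filterlim (\<lambda>s::real. s + 1) at_top at_top"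
      by (rule filterlim_at_top_mono[OF filterlim_ident]) auto
    then have "((\<lambda>s. \<phi> (s + 1) - \<phi> s) \<longlongrightarrow> l - l) at_top"
      by (intro tendsto_diff filterlim_compose[OF \<phi>] \<phi>)
    moreover have "eventually (\<lambda>s. \<phi> (s + 1) - \<phi> s = \<psi> (z s)) at_top"
      using z(2) by (auto intro!: eventually_mono[OF eventually_gt_at_top[of 0]])
    ultimately show ?thesis
      using tendsto_cong by force
  qed
  ultimately show ?thesis
    using tendsto_unique[OF trivial_limit_at_top_linorder] by blast
qed

lemma flow_limit_geodesic:
  fixes L :: "real ^ 'n"
  assumes L: "\<And>i. L $ i > 0" and fl: "flow_limit L c \<sigma>" and C: "is_lift L c C"
  obtains p where "\<sigma> = (\<lambda>t. torus_proj L (p + t *\<^sub>R ((1 / (2 * pi)) *\<^sub>R (C (2 * pi) - C 0))))"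
    "on_circle \<sigma>"
proof -
  let ?ev = "\<lambda>s. eventually (\<lambda>r. r \<ge> 0 \<and> r \<noteq> s) (at s within {0..})"
  obtain u U' S where u: "neg_gradient_flow L u" "u 0 = c" "loop L \<sigma>"
    "\<And>s. s \<ge> 0 \<Longrightarrow> is_lift L (u s) (U' s)" "is_lift L \<sigma> S"
    "((\<lambda>s. h1_norm (\<lambda>t. U' s t - S t)) \<longlongrightarrow> 0) at_top"
    using fl unfolding flow_limit_def loop_tendsto_def by auto
  obtain U \<Xi> where U: "\<And>s. s \<ge> 0 \<Longrightarrow> loop L (u s)" "\<And>s. s \<ge> 0 \<Longrightarrow> is_lift L (u s) (U s)"
    "\<And>s. s \<ge> 0 \<Longrightarrow> energy_gradient L (u s) (\<Xi> s)"
    "\<And>s. s \<ge> 0 \<Longrightarrow>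
      ((\<lambda>r. h1_norm (\<lambda>t. (U r t - U s t) /\<^sub>R (r - s) - (- \<Xi> s t))) \<longlongrightarrow> 0) (at s within {0..})"
    using u(1) unfolding neg_gradient_flow_def by blast
  have sU: "piecewise_smooth 0 (2 * pi) (U s)" if "s \<ge> 0" for s
    by (rule loop_lift_piecewise_smooth[OF L U(1)[OF that] U(2)[OF that]])
  have sS: "piecewise_smooth 0 (2 * pi) S"
    by (rule loop_lift_piecewise_smooth[OF L u(3,5)])
  have f\<Xi>: "loop_field (\<Xi> s)" if "s \<ge> 0" for s
    using U(3)[OF that] by (simp add: energy_gradient_def)
  then have s\<Xi>: "piecewise_smooth 0 (2 * pi) (\<Xi> s)" if "s \<ge> 0" for s
    using that by (simp add: loop_field_def)
  have ev: "?ev s" for s :: real by (auto simp: eventually_at_filter)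
  have diffU: "\<exists>w. \<forall>t. U' s t = U s t + w" if "s \<ge> 0" for s
    by (rule lifts_differ_by_constant[OF L U(2)[OF that] u(4)[OF that]])
  define Z where "Z s r = (\<lambda>t. (1 / (r - s)) *\<^sub>R (1 *\<^sub>R U r t + (-1) *\<^sub>R U s t) + 1 *\<^sub>R \<Xi> s t)" for s r
  have Z: "((\<lambda>r. h1_norm (Z s r)) \<longlongrightarrow> 0) (at s within {0..})" if "s \<ge> 0" for s
    using U(4)[OF that] by (simp add: Z_def inverse_eq_divide)
  have sZ: "piecewise_smooth 0 (2 * pi) (Z s r)" if "s \<ge> 0" "r \<ge> 0" for s r
    unfolding Z_def using that by (intro piecewise_smooth_comb sU s\<Xi>)
  define W where "W s = U s (2 * pi) - U s 0" for s
  have W: "W s = W 0" if "s \<ge> 0" for s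
  proof -
    have "W s $ i = W 0 $ i" for i
    proof -
      have "((\<lambda>s. W s $ i) has_field_derivative 0) (at s within {0..})" if s: "s \<ge> 0" for s
        unfolding has_field_derivative_iff
      proof (rule Lim_null_comparison)
        show "((\<lambda>r. sqrt (2 * pi) * h1_norm (Z s r)) \<longlongrightarrow> 0) (at s within {0..})"
          using tendsto_mult_left[OF Z[OF s], of "sqrt (2 * pi)"] by simp
        show "eventually (\<lambda>r. norm ((W r $ i - W s $ i) / (r - s)) \<le> sqrt (2 * pi) * h1_norm (Z s r)) (at s within {0..})"
          using ev
        proof eventually_elim
          case (elim r)
          have "\<Xi> s (2 * pi) = \<Xi> s 0"
            using f\<Xi>[OF s] unfolding loop_field_def on_circle_def by (metis add_0)
          then have "Z s r (2 * pi) - Z s r 0 = (1 / (r - s)) *\<^sub>R (W r - W s)"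
            by (simp add: Z_def W_def algebra_simps)
          then have "(W r $ i - W s $ i) / (r - s) = (Z s r (2 * pi) - Z s r 0) $ i" by simp
          also have "norm \<dots> \<le> norm (Z s r (2 * pi) - Z s r 0)" by (rule Finite_Cartesian_Product.norm_nth_le)
          also have "\<dots> \<le> sqrt (2 * pi) * h1_norm (Z s r)"
            by (rule displacement_le_h1) (use s elim sZ in auto)
          finally show ?case .
        qed
      qed
      then obtain c where "\<And>s. s \<in> {0..} \<Longrightarrow> W s $ i = c"
        using has_field_derivative_zero_constant[of "{0::real..}" "\<lambda>s. W s $ i"] by auto
      then show ?thesis using that by simp
    qed
    then show ?thesis by (simp add: vec_eq_iff)
  qed
  define D where "D s = (\<lambda>t. 1 *\<^sub>R U' s t + (-1) *\<^sub>R S t)" for s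
  have D: "((\<lambda>s. h1_norm (D s)) \<longlongrightarrow> 0) at_top"
    using u(6) by (simp add: D_def)
  have sU': "piecewise_smooth 0 (2 * pi) (U' s)" if "s \<ge> 0" for s
    by (rule loop_lift_piecewise_smooth[OF L U(1)[OF that] u(4)[OF that]])
  have sD: "piecewise_smooth 0 (2 * pi) (D s)" if "s \<ge> 0" for s
    unfolding D_def by (intro piecewise_smooth_comb sU' sS that)
  have WS: "S (2 * pi) - S 0 = W 0"
  proof -
    have le: "norm (W 0 - (S (2 * pi) - S 0)) \<le> sqrt (2 * pi) * h1_norm (D s)" if "s \<ge> 0" for s
    proof -
      obtain w where "\<And>t. U' s t = U s t + w" using diffU[OF \<open>s \<ge> 0\<close>] by blast
      then have "D s (2 * pi) - D s 0 = W s - (S (2 * pi) - S 0)"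
        by (simp add: D_def W_def)
      then show ?thesis using displacement_le_h1[OF sD[OF that]] W[OF that] by simp
    qed
    have "((\<lambda>s. sqrt (2 * pi) * h1_norm (D s)) \<longlongrightarrow> 0) at_top"
      using tendsto_mult_left[OF D, of "sqrt (2 * pi)"] by simp
    then have "norm (W 0 - (S (2 * pi) - S 0)) \<le> 0"
      by (rule tendsto_lowerbound)
        (use le in \<open>auto intro!: eventually_mono[OF eventually_ge_at_top[of 0]]\<close>)
    then show ?thesis by simp
  qed
  define v where "v = (1 / (2 * pi)) *\<^sub>R W 0"
  define \<mu> where "\<mu> = (1 / (2 * pi)) *\<^sub>R integral {0..2 * pi} (\<lambda>t. S t - t *\<^sub>R v)"
  define X where "X t = 1 *\<^sub>R S t + (-1) *\<^sub>R (\<mu> + t *\<^sub>R v)" for t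
  have perS: "S (t + 2 * pi) = S t + W 0" for t
    using lift_quasi_periodic[OF L _ u(5)] u(3) WS by (simp add: loop_def)
  have "(2 * pi) *\<^sub>R v = W 0" by (simp add: v_def)
  then have perX: "X (t + 2 * pi) = X t" for t
    unfolding X_def perS scaleR_add_left by simp
  have sX: "piecewise_smooth 0 (2 * pi) X"
    unfolding X_def[abs_def] by (intro piecewise_smooth_comb sS piecewise_smooth_affine)
  have fX: "loop_field X" using sX perX by (simp add: loop_field_def on_circle_def)
  let ?dX = "\<lambda>t. vector_derivative X (at t)"
  note dX = piecewise_continuous_vector_derivative[OF sX]
  have "continuous_on {0..2 * pi} (\<lambda>t. S t - t *\<^sub>R v)"
    using sS by (auto simp: piecewise_smooth_def intro!: continuous_intros)
  then have "((\<lambda>t. S t - t *\<^sub>R v) has_integral (2 * pi) *\<^sub>R \<mu>) {0..2 * pi}"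
    using integrable_integral[OF integrable_continuous_interval] by (simp add: \<mu>_def)
  moreover have "((\<lambda>t. \<mu>) has_integral (2 * pi) *\<^sub>R \<mu>) {0..2 * pi}"
    using has_integral_const_real[of \<mu> 0 "2 * pi"] by simp
  ultimately have *: "((\<lambda>t. (S t - t *\<^sub>R v) - \<mu>) has_integral (2 * pi) *\<^sub>R \<mu> - (2 * pi) *\<^sub>R \<mu>) {0..2 * pi}"
    by (rule has_integral_diff)
  have mean: "(X has_integral 0) {0..2 * pi}"
  proof -
    have "X = (\<lambda>t. (S t - t *\<^sub>R v) - \<mu>)" by (auto simp: X_def)
    then show ?thesis using * by simp
  qed
  have const: "h1_inner (\<lambda>t. w) X = 0" for w
  proof -
    have "l2_inner 0 (2 * pi) (\<lambda>t. w) X = 0"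
      using has_integral_linear[OF mean bounded_linear_inner_right[of w]]
      by (simp add: l2_inner_def o_def integral_unique)
    then show ?thesis
      by (simp add: h1_inner_l2[OF piecewise_smooth_const sX] l2_inner_def)
  qed
  define \<phi> where "\<phi> s = h1_inner (U s) X" for s
  define \<psi> where "\<psi> s = - (2 * l2_inner 0 (2 * pi) (\<lambda>t. vector_derivative (U s) (at t)) ?dX)" for s
  have "(\<phi> has_real_derivative \<psi> s) (at s within {0..})" if s: "s \<ge> 0" for s
  proof -
    have \<psi>: "h1_inner (\<Xi> s) X = - \<psi> s"
      using energy_gradient_inner[OF L U(1-3)[OF s] fX] by (simp add: \<psi>_def)
    have "((\<lambda>r. (\<phi> r - \<phi> s) / (r - s) - \<psi> s) \<longlongrightarrow> 0) (at s within {0..})"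
    proof (rule Lim_null_comparison)
      show "((\<lambda>r. 2 * h1_norm (Z s r) * h1_norm X) \<longlongrightarrow> 0) (at s within {0..})"
        using tendsto_mult_left[OF Z[OF s], of "2 * h1_norm X"] by (simp add: mult_ac)
      show "eventually (\<lambda>r. norm ((\<phi> r - \<phi> s) / (r - s) - \<psi> s) \<le> 2 * h1_norm (Z s r) * h1_norm X) (at s within {0..})"
        using ev
      proof eventually_elim
        case (elim r)
        then have r: "r \<ge> 0" by simp
        have "h1_inner (Z s r) X =
            1 / (r - s) * h1_inner (\<lambda>t. 1 *\<^sub>R U r t + (-1) *\<^sub>R U s t) X + 1 * h1_inner (\<Xi> s) X"
          unfolding Z_def
          by (rule h1_inner_comb_left[OF piecewise_smooth_comb[OF sU[OF r] sU[OF s]] s\<Xi>[OF s] sX])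
        also have "h1_inner (\<lambda>t. 1 *\<^sub>R U r t + (-1) *\<^sub>R U s t) X = 1 * \<phi> r + (-1) * \<phi> s"
          unfolding \<phi>_def by (rule h1_inner_comb_left[OF sU[OF r] sU[OF s] sX])
        finally have "(\<phi> r - \<phi> s) / (r - s) - \<psi> s = h1_inner (Z s r) X"
          by (simp add: \<psi>)
        then show ?case using h1_inner_le_h1_norm[OF sZ[OF s r] sX] by simp
      qed
    qed
    then show ?thesis
      unfolding has_field_derivative_iff using LIM_zero_iff by blast
  qed
  moreover have "(\<phi> \<longlongrightarrow> h1_inner S X) at_top"
  proof -
    have "((\<lambda>s. \<phi> s - h1_inner S X) \<longlongrightarrow> 0) at_top"
    proof (rule Lim_null_comparison)
      show "((\<lambda>s. 2 * h1_norm (D s) * h1_norm X) \<longlongrightarrow> 0) at_top"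
        using tendsto_mult_left[OF D, of "2 * h1_norm X"] by (simp add: mult_ac)
      show "eventually (\<lambda>s. norm (\<phi> s - h1_inner S X) \<le> 2 * h1_norm (D s) * h1_norm X) at_top"
        using eventually_ge_at_top[of 0]
      proof eventually_elim
        case (elim s)
        obtain w where w: "\<And>t. U' s t = U s t + w" using diffU[OF elim] by blast
        then have "U' s = (\<lambda>t. 1 *\<^sub>R U s t + 1 *\<^sub>R w)" by auto
        then have "h1_inner (U' s) X = \<phi> s"
          using h1_inner_comb_left[OF sU[OF elim] piecewise_smooth_const sX, of 1 1 w]
          by (simp add: const \<phi>_def)
        moreover have "h1_inner (D s) X = 1 * h1_inner (U' s) X + (-1) * h1_inner S X"
          unfolding D_def by (rule h1_inner_comb_left[OF sU'[OF elim] sS sX])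
        ultimately show ?case using h1_inner_le_h1_norm[OF sD[OF elim] sX] by simp
      qed
    qed
    then show ?thesis using LIM_zero_iff by blast
  qed
  moreover have "(\<psi> \<longlongrightarrow> - (2 * l2_inner 0 (2 * pi) (\<lambda>t. vector_derivative S (at t)) ?dX)) at_top"
  proof -
    have "((\<lambda>s. \<psi> s - - (2 * l2_inner 0 (2 * pi) (\<lambda>t. vector_derivative S (at t)) ?dX)) \<longlongrightarrow> 0) at_top"
    proof (rule Lim_null_comparison)
      show "((\<lambda>s. 2 * (h1_norm (D s) * h1_norm X)) \<longlongrightarrow> 0) at_top"
        using tendsto_mult_left[OF D, of "2 * h1_norm X"] by (simp add: mult_ac)
      show "eventually (\<lambda>s. norm (\<psi> s - - (2 * l2_inner 0 (2 * pi) (\<lambda>t. vector_derivative S (at t)) ?dX))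
          \<le> 2 * (h1_norm (D s) * h1_norm X)) at_top"
        using eventually_ge_at_top[of 0]
      proof eventually_elim
        case (elim s)
        obtain w where w: "\<And>t. U' s t = U s t + w" using diffU[OF elim] by blast
        then have "U' s = (\<lambda>t. U s t + w)" by auto
        then have "\<psi> s = - (2 * l2_inner 0 (2 * pi) (\<lambda>t. vector_derivative (U' s) (at t)) ?dX)"
          by (simp add: \<psi>_def vector_derivative_add_const)
        moreover have "l2_inner 0 (2 * pi) (\<lambda>t. vector_derivative (D s) (at t)) ?dX =
            1 * l2_inner 0 (2 * pi) (\<lambda>t. vector_derivative (U' s) (at t)) ?dX +
            (-1) * l2_inner 0 (2 * pi) (\<lambda>t. vector_derivative S (at t)) ?dX"
          unfolding D_def by (rule l2_inner_derivative_comb_left[OF sU'[OF elim] sS dX])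
        ultimately show ?case
          using l2_inner_le_h1_norm(2)[OF sD[OF elim] sX] by simp
      qed
    qed
    then show ?thesis using LIM_zero_iff by blast
  qed
  ultimately have "- (2 * l2_inner 0 (2 * pi) (\<lambda>t. vector_derivative S (at t)) ?dX) = 0"
    by (rule derivative_limit_zero)
  then have SX: "l2_inner 0 (2 * pi) (\<lambda>t. vector_derivative S (at t)) ?dX = 0" by simp
  have "X (2 * pi) = X 0" using perX[of 0] by simp
  then have "((\<lambda>t. ?dX t \<bullet> v) has_integral 0) {0..2 * pi}"
    using has_integral_linear[OF piecewise_smooth_has_integral[OF sX] bounded_linear_inner_left[of v]]
    by (simp add: o_def)
  then have "l2_inner 0 (2 * pi) (\<lambda>t. vector_derivative (\<lambda>t. \<mu> + t *\<^sub>R v) (at t)) ?dX = 0"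
    unfolding vector_derivative_affine by (subst l2_inner_commute) (simp add: l2_inner_def integral_unique)
  then have XX: "l2_inner 0 (2 * pi) ?dX ?dX = 0"
    using l2_inner_derivative_comb_left[OF sS piecewise_smooth_affine dX, of 1 "-1" \<mu> v] SX
    unfolding X_def[abs_def] by simp
  have X0: "X t = X 0" if t: "t \<in> {0..2 * pi}" for t
  proof -
    have "l2_inner 0 t ?dX ?dX \<le> l2_inner 0 (2 * pi) ?dX ?dX"
      unfolding l2_inner_def
    proof (rule integral_subset_le)
      show "(\<lambda>t. ?dX t \<bullet> ?dX t) integrable_on {0..2 * pi}"
        by (rule piecewise_continuous_inner_integrable[OF dX dX])
      have *: "piecewise_continuous 0 t ?dX"
        by (rule piecewise_continuous_subinterval[OF dX]) (use t in auto)
      show "(\<lambda>t. ?dX t \<bullet> ?dX t) integrable_on {0..t}"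
        by (rule piecewise_continuous_inner_integrable[OF * *])
    qed (use t in auto)
    then have "l2_inner 0 t ?dX ?dX = 0"
      using XX l2_inner_self_nonneg[of 0 t ?dX] by linarith
    moreover have "piecewise_smooth 0 t X"
      using sX t unfolding piecewise_smooth_gap by (meson atLeastAtMost_iff continuous_on_subset atLeastatMost_subset_iff gap_widen order_refl)
    ultimately show ?thesis using displacement_le_l2[of 0 t X] t by simp
  qed
  have Xc: "X t = X 0" for t
  proof -
    obtain s and m :: int where "t = s + of_int m * (2 * pi)" "0 \<le> s" "s < 2 * pi"
      using floor_period[of "2 * pi" t] by auto
    then show ?thesis using quasi_periodic_imp_int_shift[of X "2 * pi" 0 s m] perX X0[of s] by simp
  qed
  have "S t = (X 0 + \<mu>) + t *\<^sub>R v" for t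
  proof -
    have "S t = X t + (\<mu> + t *\<^sub>R v)" by (simp add: X_def)
    then show ?thesis unfolding Xc[of t] by (simp add: add.assoc)
  qed
  then have "\<sigma> = (\<lambda>t. torus_proj L ((X 0 + \<mu>) + t *\<^sub>R v))"
    using u(5) by (auto simp: is_lift_def)
  moreover have "W 0 = C (2 * pi) - C 0"
  proof -
    have "is_lift L c (U 0)" using U(2)[of 0] u(2) by simp
    then obtain w where "\<And>t. U 0 t = C t + w"
      using lifts_differ_by_constant[OF L C] by blast
    then show ?thesis by (simp add: W_def)
  qed
  ultimately show ?thesis
    using that[of "X 0 + \<mu>"] u(3) by (simp add: v_def loop_def)
qed

section \<open>Inverting \<open>1 - \<partial>\<^sup>2\<close> on periodic functions\<close>

definition mean_zero_periodic :: "(real \<Rightarrow> 'a::euclidean_space) \<Rightarrow> real \<Rightarrow> bool" where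
  "mean_zero_periodic f M \<longleftrightarrow> continuous_on UNIV f \<and> (\<forall>t. f (t + 2 * pi) = f t) \<and>
     (\<forall>t. integral {t - 2 * pi..t} f = 0) \<and> (\<forall>t. norm (f t) \<le> M)"

definition contraction_rate :: real where
  "contraction_rate = 1 - 2 * pi * exp (- 2 * pi) / (1 - exp (- 2 * pi))"

lemma contraction_rate: "0 \<le> contraction_rate" "contraction_rate < 1"
proof -
  have "1 + 2 * pi \<le> exp (2 * pi)" by (rule exp_ge_add_one_self)
  then have "(1 + 2 * pi) * exp (- 2 * pi) \<le> exp (2 * pi) * exp (- 2 * pi)"
    by (rule mult_right_mono) simp
  also have "\<dots> = 1" by (simp add: exp_minus)
  finally have *: "2 * pi * exp (- 2 * pi) \<le> 1 - exp (- 2 * pi)"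
    by (simp add: algebra_simps)
  have "exp (- 2 * pi) < 1" by simp
  then show "0 \<le> contraction_rate" "contraction_rate < 1"
    using * by (auto simp: contraction_rate_def field_simps)
qed

lemma sliding_integral_derivative:
  fixes h :: "real \<Rightarrow> 'a::euclidean_space"
  assumes h: "continuous_on UNIV h" and T: "T \<ge> 0"
  shows "((\<lambda>t. integral {t - T..t} h) has_vector_derivative (h x - h (x - T))) (at x)"
proof -
  define c where "c = x - T - 1"
  define H where "H t = integral {c..t} h" for t
  have dH: "(H has_vector_derivative h t) (at t)" if "t > c" for t
  proof -
    have "(H has_vector_derivative h t) (at t within {c..t + 1})"
      unfolding H_def
      by (rule integral_has_vector_derivative) (use h that in \<open>auto intro: continuous_on_subset\<close>)
    moreover have "at t within {c..t + 1} = at t"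
      by (rule at_within_interior) (use that in simp)
    ultimately show ?thesis by simp
  qed
  have "((\<lambda>t. H t - H (t - T)) has_vector_derivative (h x - h (x - T))) (at x)"
  proof (intro has_vector_derivative_diff)
    show "(H has_vector_derivative h x) (at x)" using T by (intro dH) (simp add: c_def)
    have "(H has_vector_derivative h (x - T)) (at (x - T))" by (intro dH) (simp add: c_def)
    then have "((H \<circ> (\<lambda>t. t - T)) has_vector_derivative 1 *\<^sub>R h (x - T)) (at x)"
      by (intro vector_diff_chain_at) (auto intro!: derivative_eq_intros)
    then show "((\<lambda>t. H (t - T)) has_vector_derivative h (x - T)) (at x)" by (simp add: o_def)
  qed
  then show ?thesis
  proof (rule has_vector_derivative_transform_within_open)
    show "open {c + T<..}" "x \<in> {c + T<..}" by (auto simp: c_def)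
    fix y assume "y \<in> {c + T<..}"
    then have "integral {c..y - T} h + integral {y - T..y} h = integral {c..y} h"
      using T h by (intro Henstock_Kurzweil_Integration.integral_combine integrable_continuous_interval)
        (auto intro: continuous_on_subset)
    then show "H y - H (y - T) = integral {y - T..y} h"
      unfolding H_def by (metis add_diff_cancel_left')
  qed
qed

text \<open>The inverse of \<open>1 + \<partial>\<close>; reflection turns it into the inverse of \<open>1 - \<partial>\<close>.\<close>

definition green_half :: "(real \<Rightarrow> 'a::euclidean_space) \<Rightarrow> real \<Rightarrow> 'a" where
  "green_half f t = (exp (- t) / (1 - exp (- 2 * pi))) *\<^sub>R
     integral {t - 2 * pi..t} (\<lambda>s. exp s *\<^sub>R f s)"

lemma green_half_derivative:
  assumes f: "mean_zero_periodic f M"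
  shows "(green_half f has_vector_derivative (f t - green_half f t)) (at t)"
proof -
  let ?E = "exp (- 2 * pi)"
  let ?I = "\<lambda>t. integral {t - 2 * pi..t} (\<lambda>s. exp s *\<^sub>R f s)"
  have c: "continuous_on UNIV f" using f by (simp add: mean_zero_periodic_def)
  have E: "?E < 1" by simp
  have "f (t - 2 * pi + 2 * pi) = f (t - 2 * pi)"
    using f unfolding mean_zero_periodic_def by blast
  then have per: "f (t - 2 * pi) = f t" by simp
  have "(?I has_vector_derivative (exp t *\<^sub>R f t - exp (t - 2 * pi) *\<^sub>R f (t - 2 * pi))) (at t)"
    by (rule sliding_integral_derivative) (auto intro!: continuous_intros c)
  moreover have "exp (t - 2 * pi) = exp t * ?E" by (simp add: exp_diff exp_minus field_simps)
  ultimately have "(?I has_vector_derivative (exp t * (1 - ?E)) *\<^sub>R f t) (at t)"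
    unfolding per by (simp add: algebra_simps)
  moreover have "((\<lambda>t. exp (- t) / (1 - ?E)) has_real_derivative - (exp (- t) / (1 - ?E))) (at t)"
    using E by (auto intro!: derivative_eq_intros)
  ultimately have "((\<lambda>t. (exp (- t) / (1 - ?E)) *\<^sub>R ?I t) has_vector_derivative
      (exp (- t) / (1 - ?E)) *\<^sub>R ((exp t * (1 - ?E)) *\<^sub>R f t) + (- (exp (- t) / (1 - ?E))) *\<^sub>R ?I t) (at t)"
    by (intro has_vector_derivative_scaleR)
  moreover have "(exp (- t) / (1 - ?E)) *\<^sub>R ((exp t * (1 - ?E)) *\<^sub>R f t) = f t"
    using E by (simp add: exp_minus)
  ultimately show ?thesis
    unfolding green_half_def[abs_def] by simp
qed

lemma green_half_periodic:
  assumes f: "mean_zero_periodic f M"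
  shows "green_half f (t + 2 * pi) = green_half f t"
proof -
  let ?h = "\<lambda>s. exp s *\<^sub>R f s"
  have c: "continuous_on UNIV f" and per: "\<And>t. f (t + 2 * pi) = f t"
    using f unfolding mean_zero_periodic_def by blast+
  have "integral {t - 2 * pi + 2 * pi..t + 2 * pi} ?h =
      integral {t - 2 * pi..t} (?h \<circ> (\<lambda>x. x + 2 * pi))"
    by (rule integral_shift[symmetric]) (auto intro!: continuous_intros continuous_on_subset[OF c])
  also have "?h \<circ> (\<lambda>x. x + 2 * pi) = (\<lambda>x. exp (2 * pi) *\<^sub>R ?h x)"
    by (rule ext) (simp only: o_def per exp_add scaleR_scaleR mult.commute[of "exp (2 * pi)"])
  also have "integral {t - 2 * pi..t} \<dots> = exp (2 * pi) *\<^sub>R integral {t - 2 * pi..t} ?h"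
    by (rule integral_cmul)
  finally have "integral {t..t + 2 * pi} ?h = exp (2 * pi) *\<^sub>R integral {t - 2 * pi..t} ?h" by simp
  moreover have "exp (- (t + 2 * pi)) * exp (2 * pi) = exp (- t)"
    by (simp add: exp_add[symmetric])
  ultimately show ?thesis by (simp add: green_half_def)
qed

text \<open>
  The kernel of the half-inverse is bounded below by a positive constant, and a constant kernel
  annihilates functions of mean zero; subtracting it gives the contraction.
\<close>

lemma green_half_contraction:
  assumes f: "mean_zero_periodic f M"
  shows "norm (green_half f t) \<le> contraction_rate * M"
proof -
  let ?E = "exp (- 2 * pi)" and ?J = "{t - 2 * pi..t}"
  have E: "?E < 1" by simp
  have c: "continuous_on ?J f" and mean: "integral ?J f = 0" and bd: "\<And>t. norm (f t) \<le> M"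
    using f by (auto simp: mean_zero_periodic_def intro: continuous_on_subset)
  have M: "M \<ge> 0" using bd[of 0] norm_ge_zero order_trans by blast
  have e: "(exp has_integral exp t - exp (t - 2 * pi)) ?J"
    by (rule fundamental_theorem_of_calculus)
      (auto intro!: derivative_eq_intros simp: has_real_derivative_iff_has_vector_derivative[symmetric])
  have "((\<lambda>s. M * (exp s - exp (t - 2 * pi))) has_integral
      M * ((exp t - exp (t - 2 * pi)) - (2 * pi) * exp (t - 2 * pi))) ?J"
    using has_integral_const_real[of "exp (t - 2 * pi)" "t - 2 * pi" t]
    by (intro has_integral_mult_right has_integral_diff e) simp
  moreover have "exp (t - 2 * pi) = exp t * ?E" by (simp add: exp_diff exp_minus field_simps)
  ultimately have gi: "((\<lambda>s. M * (exp s - exp (t - 2 * pi))) has_integral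
      M * exp t * (1 - ?E - 2 * pi * ?E)) ?J"
    by (simp add: algebra_simps)
  have i1: "(\<lambda>s. exp s *\<^sub>R f s) integrable_on ?J" "f integrable_on ?J"
    by (auto intro!: integrable_continuous_interval continuous_intros c)
  have "integral ?J (\<lambda>s. exp s *\<^sub>R f s) = integral ?J (\<lambda>s. exp s *\<^sub>R f s) - exp (t - 2 * pi) *\<^sub>R integral ?J f"
    by (simp add: mean)
  also have "\<dots> = integral ?J (\<lambda>s. exp s *\<^sub>R f s - exp (t - 2 * pi) *\<^sub>R f s)"
    using i1 by (simp add: Henstock_Kurzweil_Integration.integral_diff integrable_cmul)
  also have "norm \<dots> \<le> integral ?J (\<lambda>s. M * (exp s - exp (t - 2 * pi)))"
  proof (rule Henstock_Kurzweil_Integration.integral_norm_bound_integral)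
    show "(\<lambda>s. exp s *\<^sub>R f s - exp (t - 2 * pi) *\<^sub>R f s) integrable_on ?J"
      using i1 by (intro integrable_diff integrable_cmul)
    show "(\<lambda>s. M * (exp s - exp (t - 2 * pi))) integrable_on ?J"
      using gi by blast
    fix s assume s: "s \<in> ?J"
    have "exp s *\<^sub>R f s - exp (t - 2 * pi) *\<^sub>R f s = (exp s - exp (t - 2 * pi)) *\<^sub>R f s"
      by (simp add: scaleR_diff_left)
    also have "norm \<dots> = (exp s - exp (t - 2 * pi)) * norm (f s)" using s by simp
    also have "\<dots> \<le> (exp s - exp (t - 2 * pi)) * M"
      using s bd by (intro mult_left_mono) auto
    finally show "norm (exp s *\<^sub>R f s - exp (t - 2 * pi) *\<^sub>R f s) \<le> M * (exp s - exp (t - 2 * pi))"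
      by (simp add: mult.commute)
  qed
  also have "\<dots> = M * exp t * (1 - ?E - 2 * pi * ?E)"
    using gi by (rule integral_unique)
  finally have "norm (integral ?J (\<lambda>s. exp s *\<^sub>R f s)) \<le> M * exp t * (1 - ?E - 2 * pi * ?E)" .
  then have "exp (- t) / (1 - ?E) * norm (integral ?J (\<lambda>s. exp s *\<^sub>R f s)) \<le>
      exp (- t) / (1 - ?E) * (M * exp t * (1 - ?E - 2 * pi * ?E))"
    using E by (intro mult_left_mono) auto
  also have "exp (- t) / (1 - ?E) * (M * exp t * (1 - ?E - 2 * pi * ?E)) = contraction_rate * M"
  proof -
    have "exp (- t) * exp t = 1" by (simp add: exp_minus)
    then have "exp (- t) / (1 - ?E) * (M * exp t * (1 - ?E - 2 * pi * ?E)) = M * ((1 - ?E - 2 * pi * ?E) / (1 - ?E))"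
      by (simp add: mult_ac)
    also have "(1 - ?E - 2 * pi * ?E) / (1 - ?E) = contraction_rate"
      using E by (simp add: contraction_rate_def diff_divide_distrib)
    finally show ?thesis by (simp add: mult.commute)
  qed
  finally show ?thesis
    using E by (simp add: green_half_def)
qed

lemma mean_zero_periodic_green_half:
  assumes f: "mean_zero_periodic f M"
  shows "mean_zero_periodic (green_half f) (contraction_rate * M)"
proof -
  note d = green_half_derivative[OF f]
  have c: "continuous_on UNIV f" and mean: "\<And>t. integral {t - 2 * pi..t} f = 0"
    using f by (auto simp: mean_zero_periodic_def)
  have cg: "continuous_on UNIV (green_half f)"
    using has_vector_derivative_continuous[OF d] by (simp add: continuous_at_imp_continuous_on)
  have "integral {t - 2 * pi..t} (green_half f) = 0" for t
  proof -
    have "((\<lambda>s. f s - green_half f s) has_integral (green_half f t - green_half f (t - 2 * pi))) {t - 2 * pi..t}"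
      by (rule fundamental_theorem_of_calculus) (auto intro!: has_vector_derivative_at_within d)
    moreover have "green_half f (t - 2 * pi) = green_half f t"
      using green_half_periodic[OF f, of "t - 2 * pi"] by simp
    ultimately have "integral {t - 2 * pi..t} (\<lambda>s. f s - green_half f s) = 0"
      by (simp add: integral_unique)
    moreover have "f integrable_on {t - 2 * pi..t}" "green_half f integrable_on {t - 2 * pi..t}"
      by (auto intro!: integrable_continuous_interval continuous_on_subset[OF c] continuous_on_subset[OF cg])
    ultimately show ?thesis
      using mean[of t] by (simp add: Henstock_Kurzweil_Integration.integral_diff)
  qed
  then show ?thesis
    unfolding mean_zero_periodic_def
    using cg green_half_periodic[OF f] green_half_contraction[OF f] by blast
qed

lemma mean_zero_periodic_reflect:
  assumes f: "mean_zero_periodic f M"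
  shows "mean_zero_periodic (\<lambda>t. f (- t)) M"
  unfolding mean_zero_periodic_def
proof (intro conjI allI)
  have c: "continuous_on UNIV f" using f by (simp add: mean_zero_periodic_def)
  show "continuous_on UNIV (\<lambda>t. f (- t))"
    by (rule continuous_on_compose2[OF c]) (auto intro!: continuous_intros)
  fix t
  have "f (- (t + 2 * pi) + 2 * pi) = f (- (t + 2 * pi))"
    using f unfolding mean_zero_periodic_def by blast
  then show "f (- (t + 2 * pi)) = f (- t)" by simp
  have "integral {- t..- (t - 2 * pi)} f = integral {t - 2 * pi..t} (\<lambda>t. f (- t))"
    using Henstock_Kurzweil_Integration.integral_reflect_real[of "t" "t - 2 * pi" "\<lambda>x. f (- x)"] by simp
  moreover have "integral {(2 * pi - t) - 2 * pi..2 * pi - t} f = 0"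
    using f unfolding mean_zero_periodic_def by blast
  ultimately show "integral {t - 2 * pi..t} (\<lambda>t. f (- t)) = 0" by simp
  show "norm (f (- t)) \<le> M" using f unfolding mean_zero_periodic_def by blast
qed

lemma mean_zero_periodic_comb:
  assumes f: "mean_zero_periodic f M" and g: "mean_zero_periodic g N"
  shows "mean_zero_periodic (\<lambda>t. r *\<^sub>R f t + s *\<^sub>R g t) (\<bar>r\<bar> * M + \<bar>s\<bar> * N)"
  unfolding mean_zero_periodic_def
proof (intro conjI allI)
  have c: "continuous_on UNIV f" "continuous_on UNIV g"
    using f g by (auto simp: mean_zero_periodic_def)
  show "continuous_on UNIV (\<lambda>t. r *\<^sub>R f t + s *\<^sub>R g t)" by (intro continuous_intros c)
  fix t
  show "r *\<^sub>R f (t + 2 * pi) + s *\<^sub>R g (t + 2 * pi) = r *\<^sub>R f t + s *\<^sub>R g t"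
    using f g by (simp add: mean_zero_periodic_def)
  have "f integrable_on {t - 2 * pi..t}" "g integrable_on {t - 2 * pi..t}"
    using c by (auto intro!: integrable_continuous_interval intro: continuous_on_subset)
  then have "((\<lambda>t. r *\<^sub>R f t + s *\<^sub>R g t) has_integral
      r *\<^sub>R integral {t - 2 * pi..t} f + s *\<^sub>R integral {t - 2 * pi..t} g) {t - 2 * pi..t}"
    by (intro has_integral_add has_integral_cmul) auto
  then show "integral {t - 2 * pi..t} (\<lambda>t. r *\<^sub>R f t + s *\<^sub>R g t) = 0"
    using f g by (simp add: integral_unique mean_zero_periodic_def)
  have "norm (r *\<^sub>R f t + s *\<^sub>R g t) \<le> \<bar>r\<bar> * norm (f t) + \<bar>s\<bar> * norm (g t)"
    using norm_triangle_ineq[of "r *\<^sub>R f t" "s *\<^sub>R g t"] by simp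
  also have "\<dots> \<le> \<bar>r\<bar> * M + \<bar>s\<bar> * N"
    using f g by (intro add_mono mult_left_mono) (auto simp: mean_zero_periodic_def)
  finally show "norm (r *\<^sub>R f t + s *\<^sub>R g t) \<le> \<bar>r\<bar> * M + \<bar>s\<bar> * N" .
qed

definition green :: "(real \<Rightarrow> 'a::euclidean_space) \<Rightarrow> real \<Rightarrow> 'a" where
  "green f t = (1 / 2) *\<^sub>R green_half f t + (1 / 2) *\<^sub>R green_half (\<lambda>s. f (- s)) (- t)"

definition green_deriv :: "(real \<Rightarrow> 'a::euclidean_space) \<Rightarrow> real \<Rightarrow> 'a" where
  "green_deriv f t = (- (1 / 2)) *\<^sub>R green_half f t + (1 / 2) *\<^sub>R green_half (\<lambda>s. f (- s)) (- t)"

lemma mean_zero_periodic_green: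
  assumes f: "mean_zero_periodic f M"
  shows "mean_zero_periodic (green f) (contraction_rate * M)"
    and "mean_zero_periodic (green_deriv f) (contraction_rate * M)"
proof -
  note a = mean_zero_periodic_green_half[OF f]
  note b = mean_zero_periodic_reflect[OF mean_zero_periodic_green_half[OF mean_zero_periodic_reflect[OF f]]]
  have half: "\<bar>1 / 2\<bar> * (contraction_rate * M) + \<bar>1 / 2\<bar> * (contraction_rate * M) = contraction_rate * M"
    "\<bar>- (1 / 2)\<bar> * (contraction_rate * M) + \<bar>1 / 2\<bar> * (contraction_rate * M) = contraction_rate * M"
    by simp_all
  show "mean_zero_periodic (green f) (contraction_rate * M)"
    using mean_zero_periodic_comb[OF a b, of "1 / 2" "1 / 2"]
    unfolding green_def[abs_def] half .
  show "mean_zero_periodic (green_deriv f) (contraction_rate * M)"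
    using mean_zero_periodic_comb[OF a b, of "- (1 / 2)" "1 / 2"]
    unfolding green_deriv_def[abs_def] half .
qed

lemma green_derivative:
  assumes f: "mean_zero_periodic f M"
  shows "(green f has_vector_derivative green_deriv f t) (at t)"
    and "(green_deriv f has_vector_derivative green f t - f t) (at t)"
proof -
  let ?B = "\<lambda>t. green_half (\<lambda>s. f (- s)) (- t)"
  note a = green_half_derivative[OF f, of t]
  have "((green_half (\<lambda>s. f (- s)) \<circ> uminus) has_vector_derivative (- 1) *\<^sub>R (f (- (- t)) - ?B t)) (at t)"
    by (intro vector_diff_chain_at green_half_derivative[OF mean_zero_periodic_reflect[OF f]])
      (auto intro!: derivative_eq_intros)
  then have b: "(?B has_vector_derivative ?B t - f t) (at t)" by (simp add: o_def)
  note sc = bounded_linear.has_vector_derivative[OF bounded_linear_scaleR_right]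
  have "(green f has_vector_derivative (1 / 2) *\<^sub>R (f t - green_half f t) + (1 / 2) *\<^sub>R (?B t - f t)) (at t)"
    unfolding green_def[abs_def] by (intro has_vector_derivative_add sc a b)
  then show "(green f has_vector_derivative green_deriv f t) (at t)"
    by (simp add: green_deriv_def scaleR_diff_right)
  have "(green_deriv f has_vector_derivative (- (1 / 2)) *\<^sub>R (f t - green_half f t) + (1 / 2) *\<^sub>R (?B t - f t)) (at t)"
    unfolding green_deriv_def[abs_def] by (intro has_vector_derivative_add sc a b)
  moreover have "(- (1 / 2)) *\<^sub>R (f t - green_half f t) + (1 / 2) *\<^sub>R (?B t - f t) = green f t - f t"
  proof -
    have "- ((1 / 2) *\<^sub>R f t) - (1 / 2) *\<^sub>R f t = (- (1 / 2) - 1 / 2) *\<^sub>R f t"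
      by (simp only: scaleR_diff_left scaleR_minus_left)
    then have "- ((1 / 2) *\<^sub>R f t) - (1 / 2) *\<^sub>R f t = - f t" by simp
    then show ?thesis by (simp add: green_def scaleR_diff_right)
  qed
  ultimately show "(green_deriv f has_vector_derivative green f t - f t) (at t)" by simp
qed

lemma has_vector_derivative_suminf:
  fixes f f' :: "nat \<Rightarrow> real \<Rightarrow> 'a::banach"
  assumes S: "convex S" and f: "\<And>n x. x \<in> S \<Longrightarrow> (f n has_vector_derivative f' n x) (at x within S)"
    and b: "\<And>n x. x \<in> S \<Longrightarrow> norm (f' n x) \<le> b n" "summable b"
    and s: "\<And>x. x \<in> S \<Longrightarrow> summable (\<lambda>n. f n x)" and x: "x \<in> S"
  shows "((\<lambda>x. \<Sum>n. f n x) has_vector_derivative (\<Sum>n. f' n x)) (at x within S)"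
proof -
  have ul: "uniform_limit S (\<lambda>n x. \<Sum>i<n. f' i x) (\<lambda>x. \<Sum>i. f' i x) sequentially"
    using b by (intro Weierstrass_m_test) auto
  have ev: "\<forall>\<^sub>F n in sequentially. \<forall>x\<in>S. \<forall>h. norm ((\<Sum>i<n. h *\<^sub>R f' i x) - h *\<^sub>R (\<Sum>i. f' i x)) \<le> e * norm h"
    if "e > 0" for e
    using uniform_limitD[OF ul that]
  proof eventually_elim
    case (elim n)
    show ?case
    proof (intro ballI allI)
      fix x h assume "x \<in> S"
      then have "norm ((\<Sum>i<n. f' i x) - (\<Sum>i. f' i x)) \<le> e"
        using elim by (auto simp: dist_norm less_imp_le)
      then have "\<bar>h\<bar> * norm ((\<Sum>i<n. f' i x) - (\<Sum>i. f' i x)) \<le> \<bar>h\<bar> * e"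
        by (rule mult_left_mono) simp
      moreover have "(\<Sum>i<n. h *\<^sub>R f' i x) - h *\<^sub>R (\<Sum>i. f' i x) = h *\<^sub>R ((\<Sum>i<n. f' i x) - (\<Sum>i. f' i x))"
        by (simp add: scaleR_sum_right scaleR_diff_right)
      ultimately show "norm ((\<Sum>i<n. h *\<^sub>R f' i x) - h *\<^sub>R (\<Sum>i. f' i x)) \<le> e * norm h"
        by (simp add: mult.commute)
    qed
  qed
  have "\<exists>g. \<forall>x\<in>S. (\<lambda>n. f n x) sums g x \<and> (g has_derivative (\<lambda>h. h *\<^sub>R (\<Sum>n. f' n x))) (at x within S)"
    by (rule has_derivative_series[where f = f and f' = "\<lambda>n x h. h *\<^sub>R f' n x"
          and g' = "\<lambda>x h. h *\<^sub>R (\<Sum>n. f' n x)", OF S _ ev x summable_sums[OF s[OF x]]])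
      (use f in \<open>auto simp: has_vector_derivative_def\<close>)
  then obtain g where g: "\<And>x. x \<in> S \<Longrightarrow> (\<lambda>n. f n x) sums g x"
    "\<And>x. x \<in> S \<Longrightarrow> (g has_vector_derivative (\<Sum>n. f' n x)) (at x within S)"
    unfolding has_vector_derivative_def by blast
  show ?thesis
    by (rule has_vector_derivative_transform[OF x _ g(2)[OF x]]) (use g(1) in \<open>auto simp: sums_iff\<close>)
qed

section \<open>Power series in the inverse of \<open>1 - \<partial>\<^sup>2\<close>\<close>

lemma l2_inner_self_le:
  fixes f :: "real \<Rightarrow> 'a::euclidean_space"
  assumes f: "piecewise_continuous a b f" and ab: "a \<le> b" and N: "finite N"
    and le: "\<And>t. t \<in> {a<..<b} - N \<Longrightarrow> norm (f t) \<le> K"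
  shows "l2_inner a b f f \<le> (b - a) * K\<^sup>2"
proof -
  define g where "g t = (if t \<in> {a<..<b} - N then f t \<bullet> f t else 0)" for t
  have i: "(\<lambda>t. f t \<bullet> f t) integrable_on {a..b}"
    by (rule piecewise_continuous_inner_integrable[OF f f])
  have gi: "g integrable_on {a..b}"
    by (rule integrable_spike_finite[OF _ _ i, of "insert a (insert b N)"]) (use N in \<open>auto simp: g_def\<close>)
  have "l2_inner a b f f = integral {a..b} g"
    unfolding l2_inner_def by (rule integral_spike_interior[OF N]) (simp add: g_def)
  also have "\<dots> \<le> integral {a..b} (\<lambda>t. K\<^sup>2)"
  proof (rule integral_le[OF gi])
    fix t
    show "g t \<le> K\<^sup>2"
    proof (cases "t \<in> {a<..<b} - N")
      case True
      then have "(norm (f t))\<^sup>2 \<le> K\<^sup>2" by (intro power_mono le) auto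
      then show ?thesis using True by (simp add: g_def power2_norm_eq_inner)
    next
      case False
      then show ?thesis unfolding g_def if_not_P[OF False] by simp
    qed
  qed auto
  also have "\<dots> = (b - a) * K\<^sup>2" using ab by simp
  finally show ?thesis .
qed

locale green_iterates =
  fixes \<phi> \<psi> :: "nat \<Rightarrow> real \<Rightarrow> real ^ 'n" and q M :: real and P :: "real set"
  assumes q: "0 \<le> q" "q < 1"
    and cont: "continuous_on UNIV (\<phi> 0)"
    and per: "\<And>n t. \<phi> n (t + 2 * pi) = \<phi> n t"
    and per': "\<And>n t. \<psi> (Suc n) (t + 2 * pi) = \<psi> (Suc n) t"
    and d\<phi>: "\<And>n t. (\<phi> (Suc n) has_vector_derivative \<psi> (Suc n) t) (at t)"
    and d\<psi>: "\<And>n t. (\<psi> (Suc n) has_vector_derivative \<phi> (Suc n) t - \<phi> n t) (at t)"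
    and bound: "\<And>n t. norm (\<phi> n t) \<le> M * q ^ n"
    and bound': "\<And>n t. norm (\<psi> (Suc n) t) \<le> M * q ^ Suc n"
    and finite_P: "finite P"
    and affine: "\<And>a b. gap P 0 (2 * pi) a b \<Longrightarrow>
      \<exists>e. norm e \<le> M \<and> (\<forall>t\<in>{a..b}. (\<phi> 0 has_vector_derivative e) (at t within {a..b}))"
begin

definition bounded_seq :: "(nat \<Rightarrow> real) \<Rightarrow> bool" where
  "bounded_seq a \<longleftrightarrow> (\<exists>B. \<forall>n. \<bar>a n\<bar> \<le> B)"

definition tail :: "(nat \<Rightarrow> real) \<Rightarrow> real \<Rightarrow> real ^ 'n" where
  "tail a t = (\<Sum>n. a (Suc n) *\<^sub>R \<phi> (Suc n) t)"

definition tail_deriv :: "(nat \<Rightarrow> real) \<Rightarrow> real \<Rightarrow> real ^ 'n" where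
  "tail_deriv a t = (\<Sum>n. a (Suc n) *\<^sub>R \<psi> (Suc n) t)"

definition series :: "(nat \<Rightarrow> real) \<Rightarrow> real \<Rightarrow> real ^ 'n" where
  "series a t = a 0 *\<^sub>R \<phi> 0 t + tail a t"

text \<open>
  The second derivative of a series is a series again: the iterates satisfy
  \<open>\<phi>\<^sub>n\<^sub>+\<^sub>1'' = \<phi>\<^sub>n\<^sub>+\<^sub>1 - \<phi>\<^sub>n\<close>, and \<open>\<phi>\<^sub>0\<close> is affine between break points.
\<close>

definition shift2 :: "(nat \<Rightarrow> real) \<Rightarrow> nat \<Rightarrow> real" where
  "shift2 a n = (if n = 0 then 0 else a n) - a (Suc n)"

lemma M_nonneg: "M \<ge> 0"
  using order_trans[OF norm_ge_zero bound[of 0 0]] by simp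

lemma bounded_seq_summable:
  assumes "bounded_seq a"
  shows "summable (\<lambda>n. \<bar>a n\<bar> * q ^ n)"
proof -
  obtain B where B: "\<And>n. \<bar>a n\<bar> \<le> B" using assms by (auto simp: bounded_seq_def)
  show ?thesis
  proof (rule summable_comparison_test')
    show "summable (\<lambda>n. B * q ^ n)" using q by (intro summable_mult summable_geometric) simp
    show "norm (\<bar>a n\<bar> * q ^ n) \<le> B * q ^ n" for n
      using B[of n] q by (simp add: abs_mult mult_right_mono)
  qed
qed

lemma bounded_seq_comb:
  assumes "bounded_seq a" "bounded_seq b"
  shows "bounded_seq (\<lambda>n. r * a n + s * b n)"
proof -
  obtain A B where "\<And>n. \<bar>a n\<bar> \<le> A" "\<And>n. \<bar>b n\<bar> \<le> B" using assms by (auto simp: bounded_seq_def)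
  then have "\<bar>r * a n + s * b n\<bar> \<le> \<bar>r\<bar> * A + \<bar>s\<bar> * B" for n
    by (intro order_trans[OF abs_triangle_ineq] add_mono) (auto simp: abs_mult mult_left_mono)
  then show ?thesis unfolding bounded_seq_def by blast
qed

lemma bounded_seq_shift2:
  assumes "bounded_seq a"
  shows "bounded_seq (shift2 a)"
proof -
  obtain B where B: "\<And>n. \<bar>a n\<bar> \<le> B" using assms by (auto simp: bounded_seq_def)
  have "\<bar>shift2 a n\<bar> \<le> 2 * B" for n
    using B[of n] B[of "Suc n"] by (auto simp: shift2_def)
  then show ?thesis unfolding bounded_seq_def by blast
qed

lemma bounded_seq_Suc: "bounded_seq a \<Longrightarrow> bounded_seq (\<lambda>n. a (Suc n))"
  unfolding bounded_seq_def by blast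

lemma term_bound:
  "norm (a (Suc n) *\<^sub>R \<phi> (Suc n) t) \<le> M * (\<bar>a (Suc n)\<bar> * q ^ Suc n)"
  "norm (a (Suc n) *\<^sub>R \<psi> (Suc n) t) \<le> M * (\<bar>a (Suc n)\<bar> * q ^ Suc n)"
  using mult_left_mono[OF bound[of "Suc n" t], of "\<bar>a (Suc n)\<bar>"]
    mult_left_mono[OF bound'[of n t], of "\<bar>a (Suc n)\<bar>"] by (auto simp: mult_ac)

lemma summable_tail_bound:
  assumes "bounded_seq a"
  shows "summable (\<lambda>n. M * (\<bar>a (Suc n)\<bar> * q ^ Suc n))"
proof -
  have "summable (\<lambda>n. \<bar>a (Suc n)\<bar> * q ^ Suc n)"
    using bounded_seq_summable[OF assms] by (subst summable_Suc_iff)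
  then show ?thesis by (rule summable_mult)
qed

lemma summable_tail:
  assumes "bounded_seq a"
  shows "summable (\<lambda>n. a (Suc n) *\<^sub>R \<phi> (Suc n) t)" "summable (\<lambda>n. a (Suc n) *\<^sub>R \<psi> (Suc n) t)"
proof -
  show "summable (\<lambda>n. a (Suc n) *\<^sub>R \<phi> (Suc n) t)"
    by (rule summable_comparison_test'[OF summable_tail_bound[OF assms], of 0]) (rule term_bound(1))
  show "summable (\<lambda>n. a (Suc n) *\<^sub>R \<psi> (Suc n) t)"
    by (rule summable_comparison_test'[OF summable_tail_bound[OF assms], of 0]) (rule term_bound(2))
qed

lemma tail_comb:
  assumes a: "bounded_seq a" and b: "bounded_seq b"
  shows "tail (\<lambda>n. r * a n + s * b n) t = r *\<^sub>R tail a t + s *\<^sub>R tail b t"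
proof -
  let ?f = "\<lambda>a n. a (Suc n) *\<^sub>R \<phi> (Suc n) t"
  have "(\<lambda>n. r *\<^sub>R ?f a n + s *\<^sub>R ?f b n) sums (r *\<^sub>R suminf (?f a) + s *\<^sub>R suminf (?f b))"
    by (rule sums_add[OF sums_scaleR_right[OF summable_sums[OF summable_tail(1)[OF a]]]
          sums_scaleR_right[OF summable_sums[OF summable_tail(1)[OF b]]]])
  from sums_unique[OF this] show ?thesis
    by (simp add: tail_def scaleR_add_left)
qed

lemma series_comb:
  assumes "bounded_seq a" "bounded_seq b"
  shows "series (\<lambda>n. r * a n + s * b n) t = r *\<^sub>R series a t + s *\<^sub>R series b t"
  unfolding series_def tail_comb[OF assms] by (simp add: algebra_simps)

lemma tail_derivative:
  assumes a: "bounded_seq a"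
  shows "(tail a has_vector_derivative tail_deriv a t) (at t)"
proof -
  have "((\<lambda>t. \<Sum>n. a (Suc n) *\<^sub>R \<phi> (Suc n) t) has_vector_derivative
      (\<Sum>n. a (Suc n) *\<^sub>R \<psi> (Suc n) t)) (at t within UNIV)"
  proof (rule has_vector_derivative_suminf)
    show "((\<lambda>t. a (Suc n) *\<^sub>R \<phi> (Suc n) t) has_vector_derivative a (Suc n) *\<^sub>R \<psi> (Suc n) t) (at t within UNIV)" for n t
      by (rule bounded_linear.has_vector_derivative[OF bounded_linear_scaleR_right d\<phi>])
    show "norm (a (Suc n) *\<^sub>R \<psi> (Suc n) t) \<le> M * (\<bar>a (Suc n)\<bar> * q ^ Suc n)" for n t
      by (rule term_bound(2))
    show "summable (\<lambda>n. M * (\<bar>a (Suc n)\<bar> * q ^ Suc n))" by (rule summable_tail_bound[OF a])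
    show "summable (\<lambda>n. a (Suc n) *\<^sub>R \<phi> (Suc n) t)" for t by (rule summable_tail(1)[OF a])
  qed auto
  then show ?thesis unfolding tail_def[abs_def] tail_deriv_def by simp
qed

lemma tail_deriv_derivative:
  assumes a: "bounded_seq a"
  shows "(tail_deriv a has_vector_derivative series (shift2 a) t) (at t)"
proof -
  note a' = bounded_seq_Suc[OF a]
  obtain B where B: "\<And>n. \<bar>a n\<bar> \<le> B" using a by (auto simp: bounded_seq_def)
  have summable0: "summable (\<lambda>n. a (Suc n) *\<^sub>R \<phi> n t)" for t
    by (subst summable_Suc_iff[symmetric]) (rule summable_tail(1)[OF a'])
  have "((\<lambda>t. \<Sum>n. a (Suc n) *\<^sub>R \<psi> (Suc n) t) has_vector_derivative
      (\<Sum>n. a (Suc n) *\<^sub>R (\<phi> (Suc n) t - \<phi> n t))) (at t within UNIV)"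
  proof (rule has_vector_derivative_suminf)
    show "((\<lambda>t. a (Suc n) *\<^sub>R \<psi> (Suc n) t) has_vector_derivative a (Suc n) *\<^sub>R (\<phi> (Suc n) t - \<phi> n t)) (at t within UNIV)" for n t
      by (rule bounded_linear.has_vector_derivative[OF bounded_linear_scaleR_right d\<psi>])
    show "norm (a (Suc n) *\<^sub>R (\<phi> (Suc n) t - \<phi> n t)) \<le> B * (2 * (M * q ^ n))" for n t
    proof -
      have "norm (\<phi> (Suc n) t - \<phi> n t) \<le> M * q ^ Suc n + M * q ^ n"
        using norm_triangle_ineq4[of "\<phi> (Suc n) t" "\<phi> n t"] bound[of n t] bound[of "Suc n" t] by linarith
      also have "M * q ^ Suc n \<le> M * (1 * q ^ n)"
        unfolding power_Suc using q M_nonneg by (intro mult_left_mono mult_right_mono) auto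
      finally have "norm (\<phi> (Suc n) t - \<phi> n t) \<le> 2 * (M * q ^ n)" by simp
      then have "\<bar>a (Suc n)\<bar> * norm (\<phi> (Suc n) t - \<phi> n t) \<le> B * (2 * (M * q ^ n))"
        using order_trans[OF abs_ge_zero B[of "Suc n"]] by (intro mult_mono B) auto
      then show ?thesis by simp
    qed
    show "summable (\<lambda>n. B * (2 * (M * q ^ n)))"
      using q by (intro summable_mult summable_geometric) simp
    show "summable (\<lambda>n. a (Suc n) *\<^sub>R \<psi> (Suc n) t)" for t by (rule summable_tail(2)[OF a])
  qed auto
  moreover have "(\<Sum>n. a (Suc n) *\<^sub>R (\<phi> (Suc n) t - \<phi> n t)) = series (shift2 a) t"
  proof -
    from sums_unique[OF sums_diff[OF summable_sums[OF summable_tail(1)[OF a, of t]] summable_sums[OF summable0[of t]]]]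
    have "(\<Sum>n. a (Suc n) *\<^sub>R (\<phi> (Suc n) t - \<phi> n t)) = tail a t - (\<Sum>n. a (Suc n) *\<^sub>R \<phi> n t)"
      by (simp add: tail_def scaleR_diff_right)
    also have "(\<Sum>n. a (Suc n) *\<^sub>R \<phi> n t) = tail (\<lambda>n. a (Suc n)) t + a (Suc 0) *\<^sub>R \<phi> 0 t"
      using suminf_split_head[OF summable0[of t]] by (simp add: tail_def)
    also have "tail a t - (tail (\<lambda>n. a (Suc n)) t + a (Suc 0) *\<^sub>R \<phi> 0 t) =
        (1 *\<^sub>R tail a t + (-1) *\<^sub>R tail (\<lambda>n. a (Suc n)) t) - a (Suc 0) *\<^sub>R \<phi> 0 t" by simp
    also have "1 *\<^sub>R tail a t + (-1) *\<^sub>R tail (\<lambda>n. a (Suc n)) t =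
        tail (\<lambda>n. 1 * a n + (-1) * a (Suc n)) t"
      by (rule tail_comb[OF a a', symmetric])
    also have "\<dots> = tail (shift2 a) t"
      by (simp add: tail_def shift2_def)
    finally show ?thesis by (simp add: series_def shift2_def)
  qed
  ultimately show ?thesis unfolding tail_deriv_def[abs_def] by simp
qed

lemma series_derivative_gap:
  assumes a: "bounded_seq a" and e: "(\<phi> 0 has_vector_derivative e) (at t within S)"
  shows "(series a has_vector_derivative a 0 *\<^sub>R e + tail_deriv a t) (at t within S)"
  unfolding series_def[abs_def]
  by (rule has_vector_derivative_add[OF bounded_linear.has_vector_derivative[OF bounded_linear_scaleR_right e]
        has_vector_derivative_at_within[OF tail_derivative[OF a]]])

lemma smooth_on_interval_series:
  assumes a: "bounded_seq a" and pr: "gap P 0 (2 * pi) p r"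
  shows "smooth_on_interval p r (series a)"
proof -
  obtain e where e: "\<And>t. t \<in> {p..r} \<Longrightarrow> (\<phi> 0 has_vector_derivative e) (at t within {p..r})"
    using affine[OF pr] by blast
  define c where "c m = (shift2 ^^ m) a" for m
  have c: "bounded_seq (c m)" for m
    unfolding c_def by (induction m) (auto intro: a bounded_seq_shift2)
  define D where "D m t = (if even m then series (c (m div 2)) t
    else c (m div 2) 0 *\<^sub>R e + tail_deriv (c (m div 2)) t)" for m t
  have "(D m has_vector_derivative D (Suc m) t) (at t within {p..r})" if t: "t \<in> {p..r}" for m t
  proof (cases "even m")
    case True
    then show ?thesis
      using series_derivative_gap[OF c e[OF t], of "m div 2"] by (simp add: D_def[abs_def])
  next
    case False
    then have "Suc m div 2 = Suc (m div 2)" by presburger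
    then have "c (Suc m div 2) = shift2 (c (m div 2))" by (simp add: c_def)
    moreover have "((\<lambda>t. c (m div 2) 0 *\<^sub>R e + tail_deriv (c (m div 2)) t) has_vector_derivative
        0 + series (shift2 (c (m div 2))) t) (at t within {p..r})"
      by (rule has_vector_derivative_add[OF has_vector_derivative_const
            has_vector_derivative_at_within[OF tail_deriv_derivative[OF c]]])
    ultimately show ?thesis using False by (simp add: D_def[abs_def])
  qed
  moreover have "D 0 = series a" by (simp add: D_def[abs_def] c_def)
  ultimately show ?thesis unfolding smooth_on_interval_def by (intro exI[of _ D]) simp
qed

lemma tail_continuous: "bounded_seq a \<Longrightarrow> continuous_on S (tail a)"
  by (rule continuous_at_imp_continuous_on)
    (simp add: has_vector_derivative_continuous[OF tail_derivative])

lemma series_continuous: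
  assumes "bounded_seq a"
  shows "continuous_on S (series a)"
proof -
  have "continuous_on S (\<phi> 0)" by (rule continuous_on_subset[OF cont]) simp
  then show ?thesis
    unfolding series_def[abs_def] by (intro continuous_intros tail_continuous assms)
qed

lemma piecewise_smooth_series:
  assumes a: "bounded_seq a"
  shows "piecewise_smooth 0 (2 * pi) (series a)"
  unfolding piecewise_smooth_gap
  using series_continuous[OF a] smooth_on_interval_series[OF a] finite_P
  by (intro conjI exI[of _ P]) auto

lemma series_periodic: "series a (t + 2 * pi) = series a t"
  by (simp only: series_def tail_def per)

lemma tail_deriv_periodic: "tail_deriv a (t + 2 * pi) = tail_deriv a t"
  by (simp only: tail_deriv_def per')

lemma loop_field_series: "bounded_seq a \<Longrightarrow> loop_field (series a)"
  by (simp add: loop_field_def on_circle_def series_periodic piecewise_smooth_series)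

lemma norm_tail_le:
  assumes a: "bounded_seq a" and z: "norm z \<le> M"
  shows "norm (a 0 *\<^sub>R z + tail a t) \<le> M * (\<Sum>n. \<bar>a n\<bar> * q ^ n)"
    and "norm (a 0 *\<^sub>R z + tail_deriv a t) \<le> M * (\<Sum>n. \<bar>a n\<bar> * q ^ n)"
proof -
  have "(\<Sum>n. M * (\<bar>a (Suc n)\<bar> * q ^ Suc n)) = M * (\<Sum>n. \<bar>a (Suc n)\<bar> * q ^ Suc n)"
    by (rule suminf_mult) (subst summable_Suc_iff, rule bounded_seq_summable[OF a])
  also have "(\<Sum>n. \<bar>a (Suc n)\<bar> * q ^ Suc n) = (\<Sum>n. \<bar>a n\<bar> * q ^ n) - \<bar>a 0\<bar>"
    using suminf_split_head[OF bounded_seq_summable[OF a]] by simp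
  finally have s: "(\<Sum>n. M * (\<bar>a (Suc n)\<bar> * q ^ Suc n)) = M * ((\<Sum>n. \<bar>a n\<bar> * q ^ n) - \<bar>a 0\<bar>)" .
  have z': "norm (a 0 *\<^sub>R z) \<le> M * \<bar>a 0\<bar>"
    using mult_left_mono[OF z, of "\<bar>a 0\<bar>"] by (simp add: mult.commute)
  have "norm (tail a t) \<le> M * ((\<Sum>n. \<bar>a n\<bar> * q ^ n) - \<bar>a 0\<bar>)"
    unfolding tail_def s[symmetric] by (intro norm_suminf_le term_bound(1) summable_tail_bound[OF a])
  then show "norm (a 0 *\<^sub>R z + tail a t) \<le> M * (\<Sum>n. \<bar>a n\<bar> * q ^ n)"
    using norm_triangle_ineq[of "a 0 *\<^sub>R z" "tail a t"] z' by (simp add: right_diff_distrib)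
  have "norm (tail_deriv a t) \<le> M * ((\<Sum>n. \<bar>a n\<bar> * q ^ n) - \<bar>a 0\<bar>)"
    unfolding tail_deriv_def s[symmetric] by (intro norm_suminf_le term_bound(2) summable_tail_bound[OF a])
  then show "norm (a 0 *\<^sub>R z + tail_deriv a t) \<le> M * (\<Sum>n. \<bar>a n\<bar> * q ^ n)"
    using norm_triangle_ineq[of "a 0 *\<^sub>R z" "tail_deriv a t"] z' by (simp add: right_diff_distrib)
qed

lemma h1_norm_series_le:
  assumes a: "bounded_seq a"
  shows "h1_norm (series a) \<le> sqrt (4 * pi) * M * (\<Sum>n. \<bar>a n\<bar> * q ^ n)"
proof -
  define K where "K = M * (\<Sum>n. \<bar>a n\<bar> * q ^ n)"
  note s = piecewise_smooth_series[OF a]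
  have K: "K \<ge> 0"
    unfolding K_def using M_nonneg q bounded_seq_summable[OF a] by (intro mult_nonneg_nonneg suminf_nonneg) auto
  have "norm (\<phi> 0 t) \<le> M" for t using bound[of 0 t] by simp
  then have "l2_inner 0 (2 * pi) (series a) (series a) \<le> (2 * pi - 0) * K\<^sup>2"
    using norm_tail_le(1)[OF a]
    by (intro l2_inner_self_le[of _ _ _ "{}"] piecewise_smooth_imp_piecewise_continuous[OF s])
      (auto simp: series_def K_def)
  moreover have "l2_inner 0 (2 * pi) (\<lambda>t. vector_derivative (series a) (at t))
      (\<lambda>t. vector_derivative (series a) (at t)) \<le> (2 * pi - 0) * K\<^sup>2"
  proof (rule l2_inner_self_le[OF piecewise_continuous_vector_derivative[OF s] _ finite_P])
    fix t assume "t \<in> {0<..<2 * pi} - P"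
    then obtain p r where pr: "gap P 0 (2 * pi) p r" "p < t" "t < r"
      by (rule gap_around[OF finite_P])
    obtain e where e: "norm e \<le> M"
      "\<And>t. t \<in> {p..r} \<Longrightarrow> (\<phi> 0 has_vector_derivative e) (at t within {p..r})"
      using affine[OF pr(1)] by blast
    have "at t within {p..r} = at t" using pr by (intro at_within_interior) simp
    then have "(series a has_vector_derivative a 0 *\<^sub>R e + tail_deriv a t) (at t)"
      using series_derivative_gap[OF a e(2)[of t]] pr by simp
    then have "vector_derivative (series a) (at t) = a 0 *\<^sub>R e + tail_deriv a t"
      by (rule vector_derivative_at)
    then show "norm (vector_derivative (series a) (at t)) \<le> K"
      using norm_tail_le(2)[OF a e(1)] by (simp add: K_def)
  qed simp
  ultimately have "h1_inner (series a) (series a) \<le> 4 * pi * K\<^sup>2"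
    unfolding h1_inner_l2[OF s s] by simp
  then have "h1_norm (series a) \<le> sqrt (4 * pi * K\<^sup>2)"
    unfolding h1_norm_def by simp
  also have "\<dots> = sqrt (4 * pi) * K" using K by (simp add: real_sqrt_mult)
  finally show ?thesis by (simp add: K_def mult.assoc)
qed

text \<open>
  The function \<open>g = series a'\<close> is the solution of \<open>g - g'' = f\<close> for \<open>f = series a\<close>, so the \<open>H\<^sup>1\<close> product
  with \<open>g\<close> is the \<open>L\<^sup>2\<close> product with \<open>f\<close>.
\<close>

lemma h1_inner_series_gradient:
  assumes a: "bounded_seq a" and X: "loop_field X"
  defines "a' \<equiv> \<lambda>n. if n = 0 then 0 else a (n - 1)"
  shows "h1_inner (series (\<lambda>n. 2 * (a n - a' n))) X =
    2 * l2_inner 0 (2 * pi) (\<lambda>t. vector_derivative (series a) (at t)) (\<lambda>t. vector_derivative X (at t))"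
proof -
  have a': "bounded_seq a'"
  proof -
    obtain B where "\<And>n. \<bar>a n\<bar> \<le> B" using a by (auto simp: bounded_seq_def)
    then have "\<bar>a' n\<bar> \<le> \<bar>B\<bar>" for n using order_trans[OF _ abs_ge_self] by (auto simp: a'_def)
    then show ?thesis unfolding bounded_seq_def by blast
  qed
  have sX: "piecewise_smooth 0 (2 * pi) X" and perX: "\<And>t. X (t + 2 * pi) = X t"
    using X by (auto simp: loop_field_def on_circle_def)
  note sa = piecewise_smooth_series[OF a] and sa' = piecewise_smooth_series[OF a']
  have tail: "series a' = tail a'" by (rule ext) (simp add: series_def a'_def)
  have shift: "series (shift2 a') t = series a' t - series a t" for t
  proof -
    have "shift2 a' = (\<lambda>n. 1 * a' n + (-1) * a n)" by (auto simp: shift2_def a'_def)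
    then show ?thesis by (simp only: series_comb[OF a' a]) simp
  qed
  have vd: "vector_derivative (series a') (at t) = tail_deriv a' t" for t
    unfolding tail by (rule vector_derivative_at[OF tail_derivative[OF a']])
  obtain N where N: "finite N"
    "\<And>t. t \<in> {0<..<2 * pi} - N \<Longrightarrow> (X has_vector_derivative vector_derivative X (at t)) (at t)"
    by (rule piecewise_smooth_has_derivative[OF sX]) blast
  have cd: "continuous_on {0..2 * pi} (tail_deriv a')"
    using has_vector_derivative_continuous[OF tail_deriv_derivative[OF a']]
    by (auto intro: continuous_at_imp_continuous_on)
  have "((\<lambda>t. tail_deriv a' t \<bullet> vector_derivative X (at t) + (series a' t - series a t) \<bullet> X t) has_integral
      (tail_deriv a' (2 * pi) \<bullet> X (2 * pi) - tail_deriv a' 0 \<bullet> X 0)) {0..2 * pi}"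
  proof (rule fundamental_theorem_of_calculus_interior_strong[OF N(1)])
    show "continuous_on {0..2 * pi} (\<lambda>t. tail_deriv a' t \<bullet> X t)"
      by (intro continuous_intros cd piecewise_smooth_imp_continuous[OF sX])
    fix t assume t: "t \<in> {0<..<2 * pi} - N"
    show "((\<lambda>t. tail_deriv a' t \<bullet> X t) has_vector_derivative
        (tail_deriv a' t \<bullet> vector_derivative X (at t) + (series a' t - series a t) \<bullet> X t)) (at t)"
      using bounded_bilinear.has_vector_derivative[OF bounded_bilinear_inner
          tail_deriv_derivative[OF a', of t, unfolded shift] N(2)[OF t]] .
  qed simp
  then have *: "((\<lambda>t. tail_deriv a' t \<bullet> vector_derivative X (at t) + (series a' t - series a t) \<bullet> X t) has_integral 0)
      {0..2 * pi}"
    using tail_deriv_periodic[of a' 0] perX[of 0] by simp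
  have "l2_inner 0 (2 * pi) (series a) X = integral {0..2 * pi} (\<lambda>t. series a t \<bullet> X t)"
    by (simp add: l2_inner_def)
  also have "\<dots> = h1_inner (series a') X"
  proof -
    have "(\<lambda>t. series a t \<bullet> X t) integrable_on {0..2 * pi}"
      by (intro piecewise_continuous_inner_integrable piecewise_smooth_imp_piecewise_continuous sa sX)
    from has_integral_add[OF * integrable_integral[OF this]]
    have "((\<lambda>t. tail_deriv a' t \<bullet> vector_derivative X (at t) + series a' t \<bullet> X t) has_integral
        integral {0..2 * pi} (\<lambda>t. series a t \<bullet> X t)) {0..2 * pi}"
      by (simp add: inner_diff_left)
    then show ?thesis
      by (simp add: h1_inner_def vd integral_unique add.commute)
  qed
  finally have g: "h1_inner (series a') X = l2_inner 0 (2 * pi) (series a) X" by simp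
  have "series (\<lambda>n. 2 * (a n - a' n)) = (\<lambda>t. 2 *\<^sub>R series a t + (-2) *\<^sub>R series a' t)"
  proof
    fix t
    have "series (\<lambda>n. 2 * a n + (-2) * a' n) t = 2 *\<^sub>R series a t + (-2) *\<^sub>R series a' t"
      by (rule series_comb[OF a a'])
    then show "series (\<lambda>n. 2 * (a n - a' n)) t = 2 *\<^sub>R series a t + (-2) *\<^sub>R series a' t"
      by (simp add: right_diff_distrib)
  qed
  then show ?thesis
    using h1_inner_comb_left[OF sa sa' sX, of 2 "-2"] g by (simp add: h1_inner_l2[OF sa sX])
qed

end

section \<open>The flow line of a polygon\<close>

text \<open>The coefficient of \<open>K\<^sup>n\<close> in \<open>exp (- 2 s (1 - K))\<close>.\<close>

definition coeff :: "nat \<Rightarrow> real \<Rightarrow> real" where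
  "coeff n s = exp (- 2 * s) * (2 * s) ^ n / fact n"

definition coeff_prev :: "nat \<Rightarrow> real \<Rightarrow> real" where
  "coeff_prev n s = (if n = 0 then 0 else coeff (n - 1) s)"

definition dcoeff :: "nat \<Rightarrow> real \<Rightarrow> real" where
  "dcoeff n s = 2 * (coeff_prev n s - coeff n s)"

lemma coeff_nonneg: "s \<ge> 0 \<Longrightarrow> 0 \<le> coeff n s"
  by (simp add: coeff_def)

lemma coeff_sums: "(\<lambda>n. coeff n s * q ^ n) sums exp (- 2 * (1 - q) * s)"
proof -
  have "(\<lambda>n. exp (- 2 * s) * ((2 * s * q) ^ n /\<^sub>R fact n)) sums (exp (- 2 * s) * exp (2 * s * q))"
    by (intro sums_mult exp_converges)
  moreover have "exp (- 2 * s) * ((2 * s * q) ^ n /\<^sub>R fact n) = coeff n s * q ^ n" for n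
    by (simp add: coeff_def power_mult_distrib field_simps)
  moreover have "exp (- 2 * s) * exp (2 * s * q) = exp (- 2 * (1 - q) * s)"
    by (simp add: exp_add[symmetric] algebra_simps)
  ultimately show ?thesis by simp
qed

lemma coeff_le_1:
  assumes "s \<ge> 0"
  shows "coeff n s \<le> 1"
proof -
  have "(\<lambda>n. coeff n s) sums 1" using coeff_sums[of s 1] by simp
  then show ?thesis
    using sum_le_suminf[of "\<lambda>n. coeff n s" "{n}"] coeff_nonneg[OF assms] by (simp add: sums_iff)
qed

lemma coeff_derivative: "(coeff n has_real_derivative dcoeff n s) (at s within S)"
proof (cases n)
  case 0
  show ?thesis unfolding 0 coeff_def[abs_def] dcoeff_def coeff_prev_def
    by (auto intro!: derivative_eq_intros)
next
  case (Suc m)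
  have "((\<lambda>s. exp (- 2 * s) * (2 * s) ^ Suc m / fact (Suc m)) has_real_derivative
      (- 2 * exp (- 2 * s) * (2 * s) ^ Suc m + exp (- 2 * s) * (real (Suc m) * (2 * s) ^ m * 2)) / fact (Suc m)) (at s within S)"
    by (intro derivative_eq_intros | simp)+
  also have "(- 2 * exp (- 2 * s) * (2 * s) ^ Suc m + exp (- 2 * s) * (real (Suc m) * (2 * s) ^ m * 2)) / fact (Suc m)
      = dcoeff n s"
    unfolding Suc by (simp add: dcoeff_def coeff_prev_def coeff_def field_simps del: of_nat_Suc)
  finally show ?thesis unfolding Suc coeff_def[abs_def] .
qed

lemma abs_dcoeff_le:
  assumes "s \<ge> 0"
  shows "\<bar>dcoeff n s\<bar> \<le> 2"
proof -
  have "0 \<le> coeff_prev n s" "coeff_prev n s \<le> 1"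
    using coeff_nonneg[OF assms] coeff_le_1[OF assms] by (auto simp: coeff_prev_def)
  then show ?thesis
    using coeff_nonneg[OF assms, of n] coeff_le_1[OF assms, of n] by (auto simp: dcoeff_def)
qed

lemma dcoeff_Lipschitz:
  assumes "r \<ge> 0" "s \<ge> 0"
  shows "\<bar>dcoeff n r - dcoeff n s\<bar> \<le> 8 * \<bar>r - s\<bar>"
proof -
  define D where "D x = 2 * ((if n = 0 then 0 else dcoeff (n - 1) x) - dcoeff n x)" for x
  have "norm (dcoeff n r - dcoeff n s) \<le> 8 * norm (r - s)"
  proof (rule field_differentiable_bound[of "{0..}" "dcoeff n" D])
    fix x :: real assume x: "x \<in> {0..}"
    have "(coeff_prev n has_real_derivative (if n = 0 then 0 else dcoeff (n - 1) x)) (at x within {0..})"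
      unfolding coeff_prev_def[abs_def] by (simp add: coeff_derivative)
    from DERIV_cmult[OF DERIV_diff[OF this coeff_derivative], of 2]
    have "((\<lambda>x. 2 * (coeff_prev n x - coeff n x)) has_real_derivative D x) (at x within {0..})"
      unfolding D_def .
    then show "(dcoeff n has_real_derivative D x) (at x within {0..})"
      unfolding dcoeff_def[abs_def] .
    have "\<bar>if n = 0 then 0 else dcoeff (n - 1) x\<bar> \<le> 2"
      using abs_dcoeff_le[of x "n - 1"] x by simp
    then show "norm (D x) \<le> 8"
      using abs_dcoeff_le[of x n] x by (simp add: D_def abs_le_iff)
  qed (use assms in auto)
  then show ?thesis by simp
qed

lemma coeff_difference_quotient:
  assumes "r \<ge> 0" "s \<ge> 0" "r \<noteq> s"
  shows "\<bar>1 / (r - s) * (coeff n r - coeff n s) - dcoeff n s\<bar> \<le> 8 * \<bar>r - s\<bar>"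
proof -
  let ?f = "\<lambda>x. coeff n x - dcoeff n s * x"
  have "norm (?f r - ?f s) \<le> (8 * \<bar>r - s\<bar>) * norm (r - s)"
  proof (rule field_differentiable_bound[of "{min r s..max r s}" ?f "\<lambda>x. dcoeff n x - dcoeff n s"])
    fix x assume x: "x \<in> {min r s..max r s}"
    show "(?f has_real_derivative dcoeff n x - dcoeff n s) (at x within {min r s..max r s})"
      by (auto intro!: derivative_eq_intros coeff_derivative)
    have "x \<ge> 0" "\<bar>x - s\<bar> \<le> \<bar>r - s\<bar>" using x assms by auto
    then show "norm (dcoeff n x - dcoeff n s) \<le> 8 * \<bar>r - s\<bar>"
      using dcoeff_Lipschitz[of x s n] assms by simp
  qed auto
  moreover have "1 / (r - s) * (coeff n r - coeff n s) - dcoeff n s = (?f r - ?f s) / (r - s)"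
    using assms(3) by (simp add: field_simps)
  ultimately show ?thesis
    using assms(3) by (simp add: divide_le_eq)
qed

context green_iterates
begin

lemma h1_norm_series_le_bound:
  assumes a: "\<And>n. \<bar>a n\<bar> \<le> B"
  shows "h1_norm (series a) \<le> sqrt (4 * pi) * M * (B / (1 - q))"
proof -
  have b: "bounded_seq a" using a unfolding bounded_seq_def by blast
  have geo: "(\<lambda>n. B * q ^ n) sums (B * (1 / (1 - q)))"
    using q by (intro sums_mult geometric_sums) simp
  have "(\<Sum>n. \<bar>a n\<bar> * q ^ n) \<le> (\<Sum>n. B * q ^ n)"
    using a q bounded_seq_summable[OF b] sums_summable[OF geo]
    by (intro suminf_le) (auto intro: mult_right_mono)
  then have "(\<Sum>n. \<bar>a n\<bar> * q ^ n) \<le> B / (1 - q)"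
    using sums_unique[OF geo] by simp
  then have "sqrt (4 * pi) * M * (\<Sum>n. \<bar>a n\<bar> * q ^ n) \<le> sqrt (4 * pi) * M * (B / (1 - q))"
    using M_nonneg by (intro mult_left_mono) auto
  then show ?thesis using h1_norm_series_le[OF b] by linarith
qed

lemma flow_limit_exists:
  fixes L :: "real ^ 'n"
  assumes L: "\<And>i. L $ i > 0" and c: "on_circle c" and C: "is_lift L c (\<lambda>t. p + t *\<^sub>R v + \<phi> 0 t)"
  shows "\<exists>\<sigma>. flow_limit L c \<sigma>"
proof -
  define A where "A s = (\<lambda>n. coeff n s)" for s
  define G where "G s = (\<lambda>n. 2 * (A s n - (if n = 0 then 0 else A s (n - 1))))" for s
  define U where "U s t = 1 *\<^sub>R (p + t *\<^sub>R v) + 1 *\<^sub>R series (A s) t" for s t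
  define u where "u s t = torus_proj L (U s t)" for s t
  have A1: "\<bar>A s n\<bar> \<le> 1" if "s \<ge> 0" for s n
    using coeff_nonneg[OF that, of n] coeff_le_1[OF that, of n] by (simp add: A_def)
  then have A: "bounded_seq (A s)" if "s \<ge> 0" for s
    using that unfolding bounded_seq_def by blast
  have Gd: "G s n = - dcoeff n s" for s n
    by (simp add: G_def A_def dcoeff_def coeff_prev_def)
  have "\<bar>G s n\<bar> \<le> 2" if "s \<ge> 0" for s n
    unfolding Gd abs_minus_cancel by (rule abs_dcoeff_le[OF that])
  then have G: "bounded_seq (G s)" if "s \<ge> 0" for s
    using that unfolding bounded_seq_def by blast
  have sU: "piecewise_smooth 0 (2 * pi) (U s)" if "s \<ge> 0" for s
    unfolding U_def[abs_def] by (intro piecewise_smooth_comb piecewise_smooth_affine piecewise_smooth_series A that)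
  have lift: "is_lift L (u s) (U s)" if "s \<ge> 0" for s
    unfolding is_lift_def u_def U_def[abs_def]
    using that by (auto intro!: continuous_intros series_continuous A)
  have per: "torus_proj L (U s (t + 2 * pi)) = torus_proj L (U s t)" for s t
  proof -
    have "c (0 + 2 * pi) = c 0" using c unfolding on_circle_def by blast
    then have "torus_proj L (p + (2 * pi) *\<^sub>R v + \<phi> 0 (0 + 2 * pi)) = torus_proj L (p + \<phi> 0 0)"
      using C by (simp add: is_lift_def)
    then have "torus_proj L (p + (2 * pi) *\<^sub>R v + \<phi> 0 0) = torus_proj L (p + \<phi> 0 0)"
      by (simp only: per)
    from torus_proj_add[OF this, of "U s t - (p + \<phi> 0 0)"]
    have "torus_proj L (U s t + (2 * pi) *\<^sub>R v) = torus_proj L (U s t)"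
      by (simp add: algebra_simps)
    moreover have "U s (t + 2 * pi) = U s t + (2 * pi) *\<^sub>R v"
      unfolding U_def series_periodic scaleR_add_left by simp
    ultimately show ?thesis by simp
  qed
  have loop: "loop L (u s)" if "s \<ge> 0" for s
    unfolding loop_def piecewise_smooth_curve_def on_circle_def
    using lift[OF that] sU[OF that] per by (auto simp: u_def)
  have grad: "energy_gradient L (u s) (series (G s))" if s: "s \<ge> 0" for s
    unfolding energy_gradient_def
  proof (intro conjI allI impI)
    show "loop_field (series (G s))" by (rule loop_field_series[OF G[OF s]])
    fix X :: "real \<Rightarrow> real ^ 'n" assume X: "loop_field X"
    have sX: "piecewise_smooth 0 (2 * pi) X" using X by (simp add: loop_field_def)
    let ?dX = "\<lambda>t. vector_derivative X (at t)"
    have "X (0 + 2 * pi) = X 0" using X unfolding loop_field_def on_circle_def by blast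
    then have "((\<lambda>t. ?dX t \<bullet> v) has_integral 0) {0..2 * pi}"
      using has_integral_linear[OF piecewise_smooth_has_integral[OF sX] bounded_linear_inner_left[of v]]
      by (simp add: o_def)
    then have "l2_inner 0 (2 * pi) (\<lambda>t. vector_derivative (\<lambda>t. p + t *\<^sub>R v) (at t)) ?dX = 0"
      unfolding vector_derivative_affine l2_inner_commute[of _ _ "\<lambda>t. v"]
      by (simp add: l2_inner_def integral_unique)
    moreover have "l2_inner 0 (2 * pi) (\<lambda>t. vector_derivative (U s) (at t)) ?dX =
        1 * l2_inner 0 (2 * pi) (\<lambda>t. vector_derivative (\<lambda>t. p + t *\<^sub>R v) (at t)) ?dX +
        1 * l2_inner 0 (2 * pi) (\<lambda>t. vector_derivative (series (A s)) (at t)) ?dX"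
      unfolding U_def[abs_def]
      by (rule l2_inner_derivative_comb_left[OF piecewise_smooth_affine piecewise_smooth_series[OF A[OF s]]
            piecewise_continuous_vector_derivative[OF sX]])
    ultimately have "2 * l2_inner 0 (2 * pi) (\<lambda>t. vector_derivative (U s) (at t)) ?dX = h1_inner (series (G s)) X"
      unfolding G_def h1_inner_series_gradient[OF A[OF s] X] by simp
    then show "((\<lambda>e. morse_energy L (\<lambda>t. torus_exp (u s t) (e *\<^sub>R X t))) has_real_derivative
        h1_inner (series (G s)) X) (at 0)"
      using morse_energy_derivative[OF L loop[OF s] lift[OF s] X] by simp
  qed
  have deriv: "((\<lambda>r. h1_norm (\<lambda>t. (U r t - U s t) /\<^sub>R (r - s) - (- series (G s) t))) \<longlongrightarrow> 0) (at s within {0..})"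
    if s: "s \<ge> 0" for s
  proof (rule Lim_null_comparison)
    have "((\<lambda>r. sqrt (4 * pi) * M * (8 * \<bar>r - s\<bar> / (1 - q))) \<longlongrightarrow> sqrt (4 * pi) * M * (8 * \<bar>s - s\<bar> / (1 - q))) (at s within {0..})"
      using q by (intro tendsto_intros) auto
    then show "((\<lambda>r. sqrt (4 * pi) * M * (8 * \<bar>r - s\<bar> / (1 - q))) \<longlongrightarrow> 0) (at s within {0..})"
      by simp
    have "eventually (\<lambda>r. r \<ge> 0 \<and> r \<noteq> s) (at s within {0..})"
      by (auto simp: eventually_at_filter)
    then show "eventually (\<lambda>r. norm (h1_norm (\<lambda>t. (U r t - U s t) /\<^sub>R (r - s) - (- series (G s) t)))
        \<le> sqrt (4 * pi) * M * (8 * \<bar>r - s\<bar> / (1 - q))) (at s within {0..})"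
    proof eventually_elim
      case (elim r)
      define E where "E = (\<lambda>n. 1 / (r - s) * (1 * A r n + (-1) * A s n) + 1 * G s n)"
      have "series E t = (1 / (r - s)) *\<^sub>R (1 *\<^sub>R series (A r) t + (-1) *\<^sub>R series (A s) t) + 1 *\<^sub>R series (G s) t" for t
        unfolding E_def using elim
        by (simp only: series_comb[OF bounded_seq_comb[OF A[of r] A[OF s]] G[OF s]] series_comb[OF A[of r] A[OF s]])
      then have "(\<lambda>t. (U r t - U s t) /\<^sub>R (r - s) - (- series (G s) t)) = series E"
        by (auto simp: U_def inverse_eq_divide)
      moreover have "\<bar>E n\<bar> \<le> 8 * \<bar>r - s\<bar>" for n
        using coeff_difference_quotient[of r s n] elim s by (simp add: E_def Gd A_def)
      ultimately show ?case
        using h1_norm_series_le_bound[of E "8 * \<bar>r - s\<bar>"] h1_norm_nonneg[of "series E"] by simp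
    qed
  qed
  have "neg_gradient_flow L u"
    unfolding neg_gradient_flow_def
    by (intro exI[of _ U] exI[of _ "\<lambda>s. series (G s)"] allI impI conjI loop lift grad deriv)
  moreover have "u 0 = c"
  proof
    fix t
    have "tail (A 0) t = 0" by (simp add: tail_def A_def coeff_def)
    then have "series (A 0) t = \<phi> 0 t" by (simp add: series_def A_def coeff_def)
    then show "u 0 t = c t" using C by (simp add: u_def U_def is_lift_def)
  qed
  moreover have "loop_tendsto L u (\<lambda>t. torus_proj L (p + t *\<^sub>R v))"
    unfolding loop_tendsto_def
  proof (intro conjI exI[of _ U] exI[of _ "\<lambda>t. p + t *\<^sub>R v"] allI impI)
    have "torus_proj L (p + (t + 2 * pi) *\<^sub>R v) = torus_proj L (p + t *\<^sub>R v)" for t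
    proof -
      have "c (t + 2 * pi) = c t" using c unfolding on_circle_def by blast
      then have "torus_proj L (p + (t + 2 * pi) *\<^sub>R v + \<phi> 0 (t + 2 * pi)) = torus_proj L (p + t *\<^sub>R v + \<phi> 0 t)"
        using C by (simp add: is_lift_def)
      then have "torus_proj L (p + (t + 2 * pi) *\<^sub>R v + \<phi> 0 t) = torus_proj L (p + t *\<^sub>R v + \<phi> 0 t)"
        by (simp only: green_iterates.per[OF green_iterates_axioms])
      from torus_proj_add[OF this, of "- \<phi> 0 t"] show ?thesis by simp
    qed
    then have "on_circle (\<lambda>t. torus_proj L (p + t *\<^sub>R v))"
      unfolding on_circle_def by simp
    then show "loop L (\<lambda>t. torus_proj L (p + t *\<^sub>R v))"
      unfolding loop_def piecewise_smooth_curve_def using is_lift_affine piecewise_smooth_affine by blast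
    show "is_lift L (u s) (U s)" if "s \<ge> 0" for s by (rule lift[OF that])
    show "is_lift L (\<lambda>t. torus_proj L (p + t *\<^sub>R v)) (\<lambda>t. p + t *\<^sub>R v)" by (rule is_lift_affine)
    show "((\<lambda>s. h1_norm (\<lambda>t. U s t - (p + t *\<^sub>R v))) \<longlongrightarrow> 0) at_top"
    proof (rule Lim_null_comparison)
      have "filterlim (\<lambda>s. - 2 * (1 - q) * s) at_bot at_top"
        by (rule filterlim_tendsto_neg_mult_at_bot[OF tendsto_const _ filterlim_ident]) (use q in simp)
      then have "((\<lambda>s. exp (- 2 * (1 - q) * s)) \<longlongrightarrow> 0) at_top"
        by (rule filterlim_compose[OF exp_at_bot])
      from tendsto_mult_left[OF this, of "sqrt (4 * pi) * M"]
      show "((\<lambda>s. sqrt (4 * pi) * M * exp (- 2 * (1 - q) * s)) \<longlongrightarrow> 0) at_top" by simp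
      show "eventually (\<lambda>s. norm (h1_norm (\<lambda>t. U s t - (p + t *\<^sub>R v))) \<le>
          sqrt (4 * pi) * M * exp (- 2 * (1 - q) * s)) at_top"
        using eventually_ge_at_top[of 0]
      proof eventually_elim
        case (elim s)
        have "(\<lambda>t. U s t - (p + t *\<^sub>R v)) = series (A s)" by (auto simp: U_def)
        moreover have "(\<Sum>n. \<bar>A s n\<bar> * q ^ n) = exp (- 2 * (1 - q) * s)"
          using sums_unique[OF coeff_sums[of s q]] coeff_nonneg[OF elim] by (simp add: A_def)
        ultimately show ?case
          using h1_norm_series_le[OF A[OF elim]] h1_norm_nonneg[of "series (A s)"] by simp
      qed
    qed
  qed
  ultimately show ?thesis unfolding flow_limit_def by blast
qed

end

lemma mean_zero_part:
  fixes g :: "real \<Rightarrow> 'a::euclidean_space"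
  assumes g: "continuous_on UNIV g" and per: "\<And>t. g (t + 2 * pi) = g t"
  obtains \<mu> M where "mean_zero_periodic (\<lambda>t. g t - \<mu>) M"
proof -
  define \<mu> where "\<mu> = (1 / (2 * pi)) *\<^sub>R integral {0..2 * pi} g"
  define f where "f t = g t - \<mu>" for t
  have cf: "continuous_on UNIV f" unfolding f_def by (intro continuous_intros g)
  have perf: "f (t + 2 * pi) = f t + 0" for t by (simp add: f_def per)
  have "((\<lambda>t. integral {t - 2 * pi..t} f) has_vector_derivative 0) (at t)" for t
    using sliding_integral_derivative[OF cf, of "2 * pi" t] perf[of "t - 2 * pi"] by simp
  then obtain w where w: "\<And>t. integral {t - 2 * pi..t} f = w"
    using has_vector_derivative_zero_constant[of UNIV "\<lambda>t. integral {t - 2 * pi..t} f"] by auto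
  have gi: "(g has_integral integral {0..2 * pi} g) {0..2 * pi}"
    by (intro integrable_integral integrable_continuous_interval continuous_on_subset[OF g]) simp
  have "((\<lambda>t. \<mu>) has_integral integral {0..2 * pi} g) {0..2 * pi}"
    using has_integral_const_real[of \<mu> 0 "2 * pi"] by (simp add: \<mu>_def)
  from has_integral_diff[OF gi this] have "(f has_integral 0) {0..2 * pi}"
    by (simp add: f_def[abs_def])
  then have "w = 0" using w[of "2 * pi"] by (simp add: integral_unique)
  have "compact (f ` {0..2 * pi})"
    by (intro compact_continuous_image continuous_on_subset[OF cf]) auto
  then have "bounded (f ` {0..2 * pi})" by (rule compact_imp_bounded)
  then obtain M where "\<forall>x\<in>f ` {0..2 * pi}. norm x \<le> M"
    unfolding bounded_iff by blast
  then have M: "norm (f t) \<le> M" if "t \<in> {0..2 * pi}" for t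
    using that by blast
  have "norm (f t) \<le> M" for t
  proof -
    obtain s and m :: int where "t = s + of_int m * (2 * pi)" "0 \<le> s" "s < 2 * pi"
      using floor_period[of "2 * pi" t] by auto
    then show ?thesis
      using quasi_periodic_imp_int_shift[of f "2 * pi" 0 s m, OF perf] M[of s] by simp
  qed
  then have "mean_zero_periodic f M"
    unfolding mean_zero_periodic_def using cf perf w \<open>w = 0\<close> by simp
  then show ?thesis using that unfolding f_def[abs_def] by blast
qed

lemma polygon_flow_limit_exists:
  fixes L :: "real ^ 'n" and u :: "nat \<Rightarrow> real ^ 'n"
  assumes L: "\<And>i. L $ i > 0" and k: "k > 0" and c: "on_circle c" and C: "is_lift L c C"
    and per: "\<And>t. C (t + 2 * pi) = C t + (\<Sum>j<k. u j)"
    and arc: "\<And>i r. i < k \<Longrightarrow> r \<in> {0..2 * pi / real k} \<Longrightarrow>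
       C (2 * pi * real i / real k + r) = p + (\<Sum>j<i. u j) + (r / (2 * pi / real k)) *\<^sub>R u i"
  shows "\<exists>\<sigma>. flow_limit L c \<sigma>"
proof -
  define v where "v = (1 / (2 * pi)) *\<^sub>R (\<Sum>j<k. u j)"
  have v: "(2 * pi) *\<^sub>R v = (\<Sum>j<k. u j)" by (simp add: v_def)
  have "continuous_on UNIV (\<lambda>t. C t - t *\<^sub>R v)"
    using C unfolding is_lift_def by (intro continuous_intros) auto
  moreover have "C (t + 2 * pi) - (t + 2 * pi) *\<^sub>R v = C t - t *\<^sub>R v" for t
    unfolding per scaleR_add_left v by simp
  ultimately obtain \<mu> M0 where mz: "mean_zero_periodic (\<lambda>t. C t - t *\<^sub>R v - \<mu>) M0"
    by (rule mean_zero_part)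
  define f where "f t = C t - t *\<^sub>R v - \<mu>" for t
  define e where "e i = (real k / (2 * pi)) *\<^sub>R u i - v" for i
  define M where "M = \<bar>M0\<bar> + (\<Sum>i<k. norm (e i))"
  have "M0 \<le> M" using sum_nonneg[of "{..<k}" "\<lambda>i. norm (e i)"] by (simp add: M_def)
  then have f: "mean_zero_periodic f M"
    using mz unfolding f_def[abs_def] mean_zero_periodic_def by (meson order_trans)
  have eM: "norm (e i) \<le> M" if "i < k" for i
    using member_le_sum[of i "{..<k}" "\<lambda>i. norm (e i)"] that by (simp add: M_def)
  define \<phi> where "\<phi> n = (green ^^ n) f" for n
  define \<psi> where "\<psi> n = green_deriv (\<phi> (n - 1))" for n
  have \<phi>: "mean_zero_periodic (\<phi> n) (M * contraction_rate ^ n)" for n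
  proof (induction n)
    case (Suc n)
    from mean_zero_periodic_green(1)[OF this] show ?case by (simp add: \<phi>_def mult_ac)
  qed (simp add: \<phi>_def f)
  have \<psi>: "mean_zero_periodic (\<psi> (Suc n)) (M * contraction_rate ^ Suc n)" for n
    using mean_zero_periodic_green(2)[OF \<phi>[of n]] by (simp add: \<psi>_def mult_ac)
  define P where "P = (\<lambda>i. 2 * pi * real i / real k) ` {..k}"
  have "green_iterates \<phi> \<psi> contraction_rate M P"
  proof
    show "0 \<le> contraction_rate" "contraction_rate < 1" by (rule contraction_rate)+
    show "continuous_on UNIV (\<phi> 0)" using \<phi>[of 0] unfolding mean_zero_periodic_def by blast
    show "\<phi> n (t + 2 * pi) = \<phi> n t" for n t using \<phi>[of n] unfolding mean_zero_periodic_def by blast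
    show "\<psi> (Suc n) (t + 2 * pi) = \<psi> (Suc n) t" for n t using \<psi>[of n] unfolding mean_zero_periodic_def by blast
    show "norm (\<phi> n t) \<le> M * contraction_rate ^ n" for n t using \<phi>[of n] unfolding mean_zero_periodic_def by blast
    show "norm (\<psi> (Suc n) t) \<le> M * contraction_rate ^ Suc n" for n t
      using \<psi>[of n] unfolding mean_zero_periodic_def by blast
    show "(\<phi> (Suc n) has_vector_derivative \<psi> (Suc n) t) (at t)" for n t
      using green_derivative(1)[OF \<phi>[of n]] by (simp add: \<phi>_def \<psi>_def)
    show "(\<psi> (Suc n) has_vector_derivative \<phi> (Suc n) t - \<phi> n t) (at t)" for n t
      using green_derivative(2)[OF \<phi>[of n]] by (simp add: \<phi>_def \<psi>_def)
    show "finite P" by (simp add: P_def)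
    fix a b assume ab: "gap P 0 (2 * pi) a b"
    then have "0 \<le> a" "a < 2 * pi" by (auto simp: gap_def)
    then obtain i r where ir: "i < k" "r \<in> {0..<2 * pi / real k}" "a = 2 * pi * real i / real k + r"
      by (rule circle_arc_index[OF k])
    let ?t = "2 * pi * real i / real k"
    have "2 * pi * real (Suc i) / real k \<in> P" using ir(1) unfolding P_def by (intro imageI) simp
    moreover have next_eq: "2 * pi * real (Suc i) / real k = ?t + 2 * pi / real k"
      using k by (simp add: field_simps)
    ultimately have "?t + 2 * pi / real k \<notin> {a<..<b}" using ab unfolding gap_def by auto
    then have b: "b \<le> ?t + 2 * pi / real k" using ir by auto
    define w where "w = p + (\<Sum>j<i. u j) - real i *\<^sub>R u i - \<mu>"
    have aff: "w + t *\<^sub>R e i = \<phi> 0 t" if t: "t \<in> {a..b}" for t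
    proof -
      have "t - ?t \<in> {0..2 * pi / real k}" using t b ir by auto
      from arc[OF ir(1) this] have "C t = p + (\<Sum>j<i. u j) + ((t - ?t) / (2 * pi / real k)) *\<^sub>R u i" by simp
      also have "(t - ?t) / (2 * pi / real k) = t * (real k / (2 * pi)) - real i"
        using k by (simp add: field_simps)
      finally show ?thesis
        by (simp add: \<phi>_def f_def w_def e_def scaleR_diff_left scaleR_diff_right)
    qed
    have "(\<phi> 0 has_vector_derivative e i) (at t within {a..b})" if t: "t \<in> {a..b}" for t
    proof (rule has_vector_derivative_transform[OF t])
      show "((\<lambda>t. w + t *\<^sub>R e i) has_vector_derivative e i) (at t within {a..b})"
        by (auto intro!: derivative_eq_intros)
    qed (simp add: aff)
    then show "\<exists>e. norm e \<le> M \<and> (\<forall>t\<in>{a..b}. (\<phi> 0 has_vector_derivative e) (at t within {a..b}))"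
      using eM[OF ir(1)] by blast
  qed
  moreover have "C = (\<lambda>t. \<mu> + t *\<^sub>R v + \<phi> 0 t)"
    by (auto simp: \<phi>_def f_def)
  then have "is_lift L c (\<lambda>t. \<mu> + t *\<^sub>R v + \<phi> 0 t)" using C by simp
  ultimately show ?thesis
    using green_iterates.flow_limit_exists[of \<phi> \<psi> contraction_rate M P L c \<mu> v, OF _ L c] by blast
qed

theorem theorem1p8:
  fixes L :: "real ^ 'n" and \<gamma> :: "real \<Rightarrow> (real ^ 'n) set" and k :: nat and h :: real
  assumes "\<And>i. L $ i > 0"
    and "closed_geodesic L \<gamma>"
    and "minind L \<gamma> = k"
    and "h > 0"
  shows "(\<exists>c. restart_curve L \<gamma> k h c) \<and>
    (\<forall>c. restart_curve L \<gamma> k h c \<longrightarrow>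
      (\<exists>\<sigma>. flow_limit L c \<sigma>) \<and>
      (\<forall>\<sigma>. flow_limit L c \<sigma> \<longrightarrow> closed_geodesic L \<sigma> \<and> minind L \<sigma> \<le> k))"
proof (intro conjI allI impI)
  note L = assms(1)
  have g: "geodesic L \<gamma>" using assms(2) by (simp add: closed_geodesic_def)
  have k2: "2 \<le> k" using minind_ge_2[OF L g] assms(3) by simp
  then have k: "k > 0" by simp
  show "\<exists>c. restart_curve L \<gamma> k h c" by (rule restart_curve_exists[OF L k g])
  fix c assume "restart_curve L \<gamma> k h c"
  then obtain y where c: "reconnects L k y c" unfolding restart_curve_def by blast
  obtain C p u where C: "is_lift L c C" "\<And>t. C (t + 2 * pi) = C t + (\<Sum>j<k. u j)"
    "\<And>i r. i < k \<Longrightarrow> r \<in> {0..2 * pi / real k} \<Longrightarrow>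
       C (2 * pi * real i / real k + r) = p + (\<Sum>j<i. u j) + (r / (2 * pi / real k)) *\<^sub>R u i"
    "\<And>i. i < k \<Longrightarrow> reduced L (u i)"
    by (rule reconnects_lift[OF L k c]) blast
  have "on_circle c" using c by (simp add: reconnects_def)
  then show "\<exists>\<sigma>. flow_limit L c \<sigma>"
    by (rule polygon_flow_limit_exists[OF L k _ C(1-3)])
  fix \<sigma> assume "flow_limit L c \<sigma>"
  then obtain s where \<sigma>: "\<sigma> = (\<lambda>t. torus_proj L (s + t *\<^sub>R ((1 / (2 * pi)) *\<^sub>R (C (2 * pi) - C 0))))"
    "on_circle \<sigma>"
    by (rule flow_limit_geodesic[OF L _ C(1)])
  then show "closed_geodesic L \<sigma>"
    unfolding closed_geodesic_def geodesic_iff by blast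
  have "C (2 * pi) - C 0 = (\<Sum>j<k. u j)" using C(2)[of 0] by simp
  then have eq: "(2 * pi / real k) *\<^sub>R ((1 / (2 * pi)) *\<^sub>R (C (2 * pi) - C 0)) = (1 / real k) *\<^sub>R (\<Sum>j<k. u j)"
    by simp
  have "reduced L ((2 * pi / real k) *\<^sub>R ((1 / (2 * pi)) *\<^sub>R (C (2 * pi) - C 0)))"
    unfolding eq by (rule reduced_sum_bound[OF k C(4)])
  then have "one_over_geodesic L k \<sigma>"
    unfolding \<sigma>(1) by (rule one_over_geodesic_reduced[OF L])
  then show "minind L \<sigma> \<le> k" by (rule minind_le[OF k2])
qed

end
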